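(* Consider the stationary marked random connection model on $\mathbb{R}^d\times\mathbb{M}$ with intensity parameter $t\in\mathbb{R}_+=[0,\infty)$ and cluster density $\kappa(t)$. The function $t\mapsto t\kappa(t)+d_\varphi t^2/2$ is continuously differentiable on $(0,\infty)$, convex on $\mathbb{R}_+$ and right differentiable at zero.
   Context: Stationary marked random connection model (RCM). $\mathbb{M}$ is a complete separable metric space with a Borel probability measure $\mathbb{Q}$, $\mathbb{X}=\mathbb{R}^d\times\mathbb{M}$ ($d\ge1$), $\lambda_d$ is Lebesgue measure and $\lambda=\lambda_d\otimes\mathbb{Q}$. The connection function $\varphi\colon\mathbb{X}^2\to[0,1]$ is measurable, symmetric, and satisfies $\varphi((x,p),(y,q))=\varphi((0,p),(y-x,q))$; one writes $\varphi(x,p,q):=\varphi((0,p),(x,q))$ and assumes $$d_\varphi:=\iint\varphi(x,p,q)\,dx\,\mathbb{Q}^2(d(p,q))<\infty .$$ For $t\ge0$, under $\mathbb{P}_t$ (expectation $\mathbb{E}_t$), $\eta$ is a Poisson process on $\mathbb{X}$ with intensity measure $t\lambda$. For $v\in\mathbb{X}$, $\xi^v$ is the random graph with vertex set $\eta\cup\{v\}$ in which, given $\eta$, each pair of distinct vertices $(x,p),(y,q)$ is joined by an edge with probability $\varphi((x,p),(y,q))$, independently for different pairs. $C^v$ denotes the connected component of $v$ in $\xi^v$ and $|C^v|\in\mathbb{N}\cup\{\infty\}$ its number of vertices. The cluster density is $$\kappa(t):=\int\mathbb{E}_t|C^{(0,p)}|^{-1}\,\mathbb{Q}(dp),\qquad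 t\ge0,$$ with $\infty^{-1}:=0$. *)

theory Defs
  imports "HOL-Probability.Probability"
begin

definition num_points :: "'x set \<Rightarrow> ennreal" where
  "num_points A = emeasure (count_space UNIV) A"

text \<open>
  A realization of a point process is encoded as its countable set of points rather than as a
  counting measure. For intensity measures without atoms, in particular for multiples of
  a product of Lebesgue measure with a probability measure, a Poisson process almost surely
  has no multiple points, so that nothing is lost.

  The number of points in \<open>B\<close> has the Poisson distribution with parameter \<open>\<mu> B\<close>. The probabilities
  are written out because \<^const>\<open>poisson_pmf\<close> does not cover the parameter 0; the Poisson
  distribution with parameter \<open>\<infinity>\<close> is the point mass at \<open>\<infinity>\<close>.
\<close>

definition poisson_process :: "'w measure \<Rightarrow> ('w \<Rightarrow> 'x set) \<Rightarrow> 'x measure \<Rightarrow> bool" where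
  "poisson_process P \<eta> \<mu> \<longleftrightarrow>
     prob_space P \<and>
     (\<forall>\<omega>\<in>space P. countable (\<eta> \<omega>) \<and> \<eta> \<omega> \<subseteq> space \<mu>) \<and>
     (\<forall>B\<in>sets \<mu>. (\<lambda>\<omega>. num_points (\<eta> \<omega> \<inter> B)) \<in> borel_measurable P) \<and>
     (\<forall>B\<in>sets \<mu>. emeasure \<mu> B < \<infinity> \<longrightarrow>
        (\<forall>k::nat. measure P {\<omega>\<in>space P. num_points (\<eta> \<omega> \<inter> B) = of_nat k}
                    = measure \<mu> B ^ k / fact k * exp (- measure \<mu> B))) \<and>
     (\<forall>B\<in>sets \<mu>. emeasure \<mu> B = \<infinity> \<longrightarrow> (AE \<omega> in P. num_points (\<eta> \<omega> \<inter> B) = \<infinity>)) \<and>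
     (\<forall>(n::nat) B. B ` {..<n} \<subseteq> sets \<mu> \<and> disjoint_family_on B {..<n} \<longrightarrow>
        prob_space.indep_vars P (\<lambda>_. borel) (\<lambda>i \<omega>. num_points (\<eta> \<omega> \<inter> B i)) {..<n})"

definition vertex_pairs :: "'x set \<Rightarrow> 'x set set" where
  "vertex_pairs V = {e. e \<subseteq> V \<and> card e = 2}"

text \<open>
  The connection probability as a function of the unordered pair; it is well defined
  if the connection function is symmetric.
\<close>

definition pair_prob :: "('x \<Rightarrow> 'x \<Rightarrow> real) \<Rightarrow> 'x set \<Rightarrow> real" where
  "pair_prob \<phi> e = (THE r. \<exists>v w. e = {v, w} \<and> v \<noteq> w \<and> r = \<phi> v w)"

lemma pair_prob_eq:
  assumes "\<And>v w. \<phi> v w = \<phi> w v" and "v \<noteq> w"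
  shows "pair_prob \<phi> {v, w} = \<phi> v w"
  unfolding pair_prob_def
  using assms by (intro the_equality) (auto simp: doubleton_eq_iff)

text \<open>
  The conditional law of the edges given that the vertex set is \<open>V\<close>. A configuration \<open>c\<close>
  assigns to each pair of distinct vertices whether it is joined by an edge; these
  indicators are independent.
\<close>

definition edge_law :: "('x \<Rightarrow> 'x \<Rightarrow> real) \<Rightarrow> 'x set \<Rightarrow> ('x set \<Rightarrow> bool) measure" where
  "edge_law \<phi> V =
     (\<Pi>\<^sub>M e\<in>vertex_pairs V. measure_pmf (bernoulli_pmf (pair_prob \<phi> e)))"

definition cluster :: "'x set \<Rightarrow> ('x set \<Rightarrow> bool) \<Rightarrow> 'x \<Rightarrow> 'x set" where
  "cluster V c v = {w. (v, w) \<in> {(x, y). {x, y} \<in> vertex_pairs V \<and> c {x, y}}\<^sup>*}"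

text \<open>
  The expectation of \<open>|C\<^sup>v|\<^sup>-\<^sup>1\<close>: the inner integral is the conditional expectation given \<open>\<eta>\<close>.
  In \<^typ>\<open>ennreal\<close> the inverse of \<open>\<infinity>\<close> is 0.
\<close>

definition expected_inverse_cluster_size ::
    "('x \<Rightarrow> 'x \<Rightarrow> real) \<Rightarrow> 'w measure \<Rightarrow> ('w \<Rightarrow> 'x set) \<Rightarrow> 'x \<Rightarrow> ennreal" where
  "expected_inverse_cluster_size \<phi> P \<eta> v =
     (\<integral>\<^sup>+\<omega>. (\<integral>\<^sup>+c. inverse (num_points (cluster (insert v (\<eta> \<omega>)) c v))
               \<partial>edge_law \<phi> (insert v (\<eta> \<omega>))) \<partial>P)"

definition cluster_density ::
    "('a::euclidean_space \<times> 'm \<Rightarrow> 'a \<times> 'm \<Rightarrow> real) \<Rightarrow> 'm measure \<Rightarrow>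
     'w measure \<Rightarrow> ('w \<Rightarrow> ('a \<times> 'm) set) \<Rightarrow> real" where
  "cluster_density \<phi> Q P \<eta> =
     enn2real (\<integral>\<^sup>+p. expected_inverse_cluster_size \<phi> P \<eta> (0, p) \<partial>Q)"

definition d_phi ::
    "('a::euclidean_space \<times> 'm \<Rightarrow> 'a \<times> 'm \<Rightarrow> real) \<Rightarrow> 'm measure \<Rightarrow> ennreal" where
  "d_phi \<phi> Q = (\<integral>\<^sup>+(p, q). (\<integral>\<^sup>+x. ennreal (\<phi> (0, p) (x, q)) \<partial>lborel) \<partial>(Q \<Otimes>\<^sub>M Q))"

text \<open>
  The following bounds show that \<^const>\<open>enn2real\<close> in \<^const>\<open>cluster_density\<close> is only applied to
  finite values.
\<close>

lemma prob_space_edge_law: "prob_space (edge_law \<phi> V)"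
  unfolding edge_law_def by (intro prob_space_PiM prob_space_measure_pmf)

lemma inverse_cluster_size_le_1: "inverse (num_points (cluster V c v)) \<le> 1"
proof -
  have "num_points {v} \<le> num_points (cluster V c v)"
    unfolding num_points_def by (intro emeasure_mono) (auto simp: cluster_def)
  hence "1 \<le> num_points (cluster V c v)"
    by (simp add: num_points_def)
  thus ?thesis
    by (cases "num_points (cluster V c v)")
       (auto simp flip: ennreal_1 simp: inverse_ennreal inverse_le_1_iff)
qed

lemma expected_inverse_cluster_size_le_1:
  assumes "prob_space P"
  shows "expected_inverse_cluster_size \<phi> P \<eta> v \<le> 1"
proof -
  have "(\<integral>\<^sup>+c. inverse (num_points (cluster W c v)) \<partial>edge_law \<phi> W) \<le> 1" for W
  proof -
    have "(\<integral>\<^sup>+c. inverse (num_points (cluster W c v)) \<partial>edge_law \<phi> W)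
            \<le> (\<integral>\<^sup>+c. 1 \<partial>edge_law \<phi> W)"
      by (intro nn_integral_mono inverse_cluster_size_le_1)
    thus ?thesis using prob_space.emeasure_space_1[OF prob_space_edge_law[of \<phi> W]] by simp
  qed
  hence "expected_inverse_cluster_size \<phi> P \<eta> v \<le> (\<integral>\<^sup>+\<omega>. 1 \<partial>P)"
    unfolding expected_inverse_cluster_size_def by (intro nn_integral_mono)
  thus ?thesis using prob_space.emeasure_space_1[OF assms] by simp
qed

end

theory Submission
  imports Defs
begin

text \<open>
  Let \<open>N r t\<close> be the expected number of clusters when the graph is restricted to the points
  whose position lies in the ball of radius \<open>r\<close> around the origin, and let \<open>V r\<close> be the volume of
  that ball. If every vertex of a cluster carries the weight one over the size of the cluster,
  each cluster has weight one; by stationarity \<open>N r t / V r\<close> therefore tends to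
  \<open>t * \<kappa> t\<close> as \<open>r\<close> tends to infinity (\<open>window_density_tendsto\<close>). Everything reduces to
  estimates on \<open>N r / V r\<close> that do not depend on \<open>r\<close>.

  Convexity. The second derivative in \<open>t\<close> of an expectation under a Poisson process is an
  integral over the expected effect of adding two points, in the sense of a second difference.
  An edge merges two clusters or none, and it is less likely to merge two clusters if more edges
  are present; hence the number of clusters is a supermodular function of the edge set, and its
  second difference is at least minus the indicator that the two new points are adjacent
  (\<open>num_clusters_second_difference\<close>). So the second derivative of \<open>N r\<close> is at least
  minus the integral of \<open>\<phi>\<close> over pairs of points in the window, which is at least
  \<open>- d_phi * V r\<close>. Adding \<open>d_phi * t\<^sup>2 / 2\<close> to \<open>N r t / V r\<close> makes it convex.

  Differentiability. A convex function \<open>f\<close> is differentiable at \<open>t\<close> as soon as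
  \<open>f (t + s) + f (t - s) - 2 * f t\<close> is small compared with \<open>s\<close>, and a differentiable convex
  function has a continuous derivative (\<open>C1_differentiable_on_convex_second_difference\<close>). To
  bound this second difference, write \<open>N r t\<close> as a sum over the sizes \<open>n\<close> of clusters
  (\<open>cluster_expansion\<close>): its terms are mixtures of \<open>t ^ n * exp (- t * h)\<close>, where \<open>h\<close> is the
  mass of the points that would be attached to the cluster. The same sum with an additional
  factor \<open>n\<close> is the expected number of points, \<open>t * V r\<close>, for \<^emph>\<open>every\<close> intensity. If \<open>t * h\<close>
  deviates from \<open>n\<close>, the term is exponentially smaller than the corresponding term at
  one of the intensities \<open>t * (1 + \<delta>)\<close>, \<open>t * (1 - \<delta>)\<close> (\<open>exponential_tilting\<close>), whose sum is
  known; if it does not, the term is nearly stationary in \<open>t\<close>. This large deviation argument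
  goes back to Aizenman, Kesten and Newman. With \<open>s = t * \<delta> ^ 3\<close> it bounds the
  second difference of \<open>N r / V r\<close> by \<open>640 * t * \<delta> ^ 4\<close> (\<open>cluster_number_second_difference\<close>).

  At zero the function is right differentiable because the difference quotients of a convex
  function are monotone, and here they are nonnegative.

  The Poisson process enters only through its restriction to a window of finite intensity: given
  that it has \<open>n\<close> points there, a uniformly random enumeration of them is a vector of independent
  points (\<open>arrangement_kernel_law\<close>). This turns expectations into exponential generating functions
  of integrals over finite powers of the window.
\<close>

section \<open>Convex functions with small second differences\<close>

text \<open>
  The difference quotients at \<open>t\<close> increase with the increment, and the second difference divided by
  \<open>s\<close> is the gap between the quotients for the increments \<open>s\<close> and \<open>- s\<close>. By monotonicity, a single
  \<open>s\<close> for each \<open>\<epsilon>\<close> is enough.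
\<close>

lemma has_derivative_convex_second_difference:
  fixes f :: "real \<Rightarrow> real"
  assumes cvx: "convex_on {a<..} f" and t: "a < t"
    and sd: "\<And>\<epsilon>. 0 < \<epsilon> \<Longrightarrow> \<exists>s>0. s < t - a \<and> f (t + s) + f (t - s) - 2 * f t \<le> \<epsilon> * s"
  shows "\<exists>D. (f has_real_derivative D) (at t)"
proof -
  define g where "g s = (f (t + s) - f t) / s" for s
  have mono: "g r \<le> g s" if "r \<noteq> 0" "s \<noteq> 0" "r \<le> s" "a < t + r" for r s
  proof -
    have strict: "(f (x2 + t) - f t) / x2 \<ge> (f (x1 + t) - f t) / x1"
      if le: "x1 < x2" "x1 \<noteq> 0" "x2 \<noteq> 0" "a < t + x1" for x1 x2
    proof -
      \<comment> \<open>the three ways in which \<open>t\<close>, \<open>t + x1\<close>, \<open>t + x2\<close> can be ordered\<close>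
      consider "0 < x1" | "x1 < 0" "0 < x2" | "x2 < 0"
        using le by (metis linorder_cases)
      then show ?thesis
      proof cases
        case 1
        have "(f t - f (t+x1)) / (t - (t+x1)) \<le> (f t - f (t+x2)) / (t - (t+x2))"
          using convex_on_slope_le[OF cvx, of "t" "t+x2" "t+x1"] 1 that t
          by auto
        then show ?thesis using 1 that
          by (simp add: minus_divide_left [symmetric] add.commute divide_simps algebra_simps)
      next
        case 2
        have "(f (t+x1) - f t) / ((t+x1) - t) \<le> (f t - f (t+x2)) / (t - (t+x2))"
          using convex_on_slope_le[OF cvx, of "t+x1" "t+x2" "t"] 2 that t
          by (auto intro: order_trans)
        then show ?thesis using 2 that
          by (simp add: add.commute divide_simps algebra_simps split: if_splits)
      next
        case 3
        have "(f (t+x1) - f t) / ((t+x1) - t) \<le> (f (t+x2) - f t) / ((t+x2) - t)"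
          using convex_on_slope_le[OF cvx, of "t+x1" "t" "t+x2"] 3 that t
          by auto
        then show ?thesis using 3 that by (simp add: add.commute)
      qed
    qed
    show ?thesis
      using strict[of r s] that by (cases "r = s") (auto simp: g_def add.commute)
  qed
  have sdg: "(f (t + s) + f (t - s) - 2 * f t) = (g s - g (- s)) * s" if "s > 0" for s
    using that by (simp add: g_def field_simps)
  define D where "D = Inf (g ` {0<..})"
  have D_le: "D \<le> g s" and le_D: "g (- r) \<le> D" if "s > 0" "0 < r" "r < t - a" for s r
  proof -
    have "g (-r) \<le> g s" if "s > 0" for s using mono[of "-r" s] that \<open>0 < r\<close> \<open>r < t - a\<close> by simp
    then show "g (-r) \<le> D" "D \<le> g s"
      unfolding D_def using that by (auto intro!: cINF_greatest cINF_lower bdd_belowI2)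
  qed
  have "(g \<longlongrightarrow> D) (at 0)"
  proof (rule LIM_I)
    fix \<epsilon> :: real assume "\<epsilon> > 0"
    then obtain s where s: "s > 0" "s < t - a" "f (t + s) + f (t - s) - 2 * f t \<le> \<epsilon>/2 * s"
      using sd[of "\<epsilon>/2"] by auto
    have gs: "g s - g (-s) \<le> \<epsilon>/2" using s sdg[of s] by simp
    show "\<exists>d>0. \<forall>x. x \<noteq> 0 \<and> norm (x - 0) < d \<longrightarrow> norm (g x - D) < \<epsilon>"
    proof (intro exI[of _ s] conjI allI impI s)
      fix x :: real assume "x \<noteq> 0 \<and> norm (x - 0) < s"
      then have "g (-s) \<le> g x" "g x \<le> g s"
        using mono[of "-s" x] mono[of x s] s by auto
      moreover have "D \<le> g s" "g (-s) \<le> D" using D_le[of s s] le_D[of s s] s by auto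
      ultimately show "norm (g x - D) < \<epsilon>" using gs \<open>\<epsilon> > 0\<close> by auto
    qed
  qed
  then show ?thesis unfolding g_def DERIV_def by blast
qed

text \<open>
  For \<open>y\<close> near \<open>t\<close>, the derivative at \<open>y\<close> lies between the slopes of the chords that join \<open>y\<close> to
  \<open>t - s\<close> and to \<open>t + s\<close>. These slopes depend continuously on \<open>y\<close>, and at \<open>y = t\<close> they are close
  to each other.
\<close>

lemma C1_differentiable_on_convex_second_difference:
  fixes f :: "real \<Rightarrow> real"
  assumes cvx: "convex_on {a<..} f"
    and sd: "\<And>t \<epsilon>. a < t \<Longrightarrow> 0 < \<epsilon> \<Longrightarrow> \<exists>s>0. s < t - a \<and> f (t + s) + f (t - s) - 2 * f t \<le> \<epsilon> * s"
  shows "f C1_differentiable_on {a<..}"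
proof -
  have der: "(f has_real_derivative deriv f t) (at t)" if "a < t" for t
    using has_derivative_convex_second_difference[OF cvx that sd[OF that]] DERIV_imp_deriv
    by blast
  have tangent: "deriv f t * (x - t) \<le> f x - f t" if "a < t" "a < x" for t x
  proof (rule convex_on_imp_above_tangent[OF cvx])
    show "(f has_real_derivative deriv f t) (at t within {a<..})"
      using der[OF that(1)] by (rule has_field_derivative_at_within)
  qed (use that in \<open>auto simp: interior_open\<close>)
  have "continuous_on {a<..} (deriv f)"
  proof (rule continuous_at_imp_continuous_on, rule ballI)
    fix t assume "t \<in> {a<..}"
    then have t: "a < t" by simp
    have "isCont f t" using der[OF t] by (rule DERIV_isCont)
    then have ft: "(f \<longlongrightarrow> f t) (at t)" by (simp add: isCont_def)
    show "isCont (deriv f) t" unfolding isCont_def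
    proof (rule tendstoI)
      fix \<epsilon> :: real assume "\<epsilon> > 0"
      then obtain s where s: "s > 0" "s < t - a" "f (t + s) + f (t - s) - 2 * f t \<le> \<epsilon>/2 * s"
        using sd[of t "\<epsilon>/2"] t by auto
      define u l where "u = (f (t + s) - f t) / s" and "l = (f t - f (t - s)) / s"
      have "u - l = (f (t + s) + f (t - s) - 2 * f t) / s"
        by (simp add: u_def l_def flip: diff_divide_distrib)
      then have ul: "u - l \<le> \<epsilon>/2" using s by (simp add: divide_le_eq)
      have dl: "l \<le> deriv f t" using tangent[of t "t - s"] s t by (simp add: l_def field_simps)
      have du: "deriv f t \<le> u" using tangent[of t "t + s"] s t by (simp add: u_def field_simps)
      have "((\<lambda>y. (f (t + s) - f y) / (t + s - y)) \<longlongrightarrow> (f (t + s) - f t) / (t + s - t)) (at t)"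
        using s by (intro tendsto_intros ft) auto
      then have "eventually (\<lambda>y. (f (t + s) - f y) / (t + s - y) < u + \<epsilon>/2) (at t)"
        using \<open>\<epsilon> > 0\<close> by (intro order_tendstoD(2)) (auto simp: u_def)
      moreover have "((\<lambda>y. (f y - f (t - s)) / (y - (t - s))) \<longlongrightarrow> (f t - f (t - s)) / (t - (t - s))) (at t)"
        using s by (intro tendsto_intros ft) auto
      then have "eventually (\<lambda>y. (f y - f (t - s)) / (y - (t - s)) > l - \<epsilon>/2) (at t)"
        using \<open>\<epsilon> > 0\<close> by (intro order_tendstoD(1)) (auto simp: l_def)
      moreover have "eventually (\<lambda>y. y \<in> {t - s<..<t + s}) (at t)"
        using s by (intro eventually_at_in_open') auto
      ultimately show "eventually (\<lambda>y. dist (deriv f y) (deriv f t) < \<epsilon>) (at t)"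
      proof eventually_elim
        case (elim y)
        have "deriv f y \<le> (f (t + s) - f y) / (t + s - y)"
          using tangent[of y "t + s"] elim s t by (simp add: field_simps)
        moreover have "(f y - f (t - s)) / (y - (t - s)) \<le> deriv f y"
          using tangent[of y "t - s"] elim s t by (simp add: field_simps)
        ultimately show ?case using elim ul dl du unfolding dist_real_def by linarith
      qed
    qed
  qed
  then show ?thesis
    unfolding C1_differentiable_on_def
    using der has_real_derivative_iff_has_vector_derivative by (intro exI[of _ "deriv f"]) auto
qed

text \<open>
  The quotients decrease as \<open>t\<close> decreases to \<open>a\<close>, so they converge as soon as they are bounded below.
\<close>

lemma convex_on_right_differentiable:
  fixes f :: "real \<Rightarrow> real"
  assumes cvx: "convex_on {a..} f" and lower: "\<And>t. a < t \<Longrightarrow> c \<le> (f t - f a) / (t - a)"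
  shows "f differentiable (at_right a)"
proof -
  define g where "g t = (f t - f a) / (t - a)" for t
  have mono: "g r \<le> g s" if "a < r" "r \<le> s" for r s
    using convex_on_slope_le[OF cvx, of a s r] that
    by (cases "r = s") (auto simp: g_def field_simps)
  define D where "D = Inf (g ` {a<..})"
  have D_le: "D \<le> g s" if "a < s" for s
    unfolding D_def using that lower by (auto intro!: cINF_lower bdd_belowI2 simp: g_def)
  have "(g \<longlongrightarrow> D) (at_right a)"
  proof (rule order_tendstoI)
    fix y assume "y < D"
    then show "eventually (\<lambda>x. y < g x) (at_right a)"
      using D_le by (intro eventually_at_rightI[of a "a + 1"]) (auto intro: less_le_trans)
  next
    fix y assume "D < y"
    then obtain s where s: "a < s" "g s < y"
      unfolding D_def by (subst (asm) cINF_less_iff) (auto simp: g_def intro!: bdd_belowI2 lower)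
    then show "eventually (\<lambda>x. g x < y) (at_right a)"
      by (intro eventually_at_rightI[of a s]) (auto intro: le_less_trans[OF mono[OF _ less_imp_le]])
  qed
  then have "(f has_field_derivative D) (at_right a)"
    unfolding has_field_derivative_iff g_def .
  then show ?thesis
    using real_differentiable_def by blast
qed

section \<open>Weights of the form \<open>t ^ n * exp (- t * h)\<close>\<close>

text \<open>
  The weight \<open>u ^ n * exp (- u * h)\<close> is multiplied by \<open>(1 + e) ^ n * exp (- e * r * h)\<close> when \<open>r\<close> is
  replaced by \<open>r * (1 + e)\<close>, and \<open>exp (e - 2 * \<delta>\<^sup>2) \<le> 1 + e\<close> for \<open>e = \<delta>\<close> and \<open>e = - \<delta>\<close>. The sign
  of the deviation of \<open>r * h\<close> from \<open>n\<close> decides which of the two tilted weights is large.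
\<close>

lemma exponential_tilting:
  fixes r h \<delta> :: real and n :: nat
  assumes n: "1 \<le> n" and r: "0 < r" and \<delta>: "0 < \<delta>" "\<delta> \<le> 1/2"
  shows "exp (real n * (\<delta> * \<bar>1 - r * h / n\<bar> - 2 * \<delta>\<^sup>2)) * (r ^ n * exp (- (r * h)))
     \<le> (r * (1 + \<delta>)) ^ n * exp (- (r * (1 + \<delta>) * h)) + (r * (1 - \<delta>)) ^ n * exp (- (r * (1 - \<delta>) * h))"
proof -
  have tilt: "exp (real n * (e * (1 - r * h / n) - 2 * \<delta>\<^sup>2)) * (r ^ n * exp (- (r * h)))
     \<le> (r * (1 + e)) ^ n * exp (- (r * (1 + e) * h))" if e: "exp (e - 2 * \<delta>\<^sup>2) \<le> 1 + e" for e
  proof -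
    have "exp (real n * (e * (1 - r * h / n) - 2 * \<delta>\<^sup>2)) = exp (e - 2 * \<delta>\<^sup>2) ^ n * exp (- (e * r * h))"
      using n by (simp add: exp_of_nat_mult[symmetric] mult_exp_exp) (simp add: field_simps)
    also have "\<dots> \<le> (1 + e) ^ n * exp (- (e * r * h))"
      using e by (intro mult_right_mono power_mono) auto
    finally have "exp (real n * (e * (1 - r * h / n) - 2 * \<delta>\<^sup>2)) * (r ^ n * exp (- (r * h)))
       \<le> (1 + e) ^ n * exp (- (e * r * h)) * (r ^ n * exp (- (r * h)))"
      using r by (intro mult_right_mono) auto
    also have "\<dots> = (r * (1 + e)) ^ n * (exp (- (e * r * h)) * exp (- (r * h)))"
      by (simp only: power_mult_distrib mult_ac)
    also have "exp (- (e * r * h)) * exp (- (r * h)) = exp (- (r * (1 + e) * h))"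
      by (simp add: mult_exp_exp algebra_simps)
    finally show ?thesis .
  qed
  have "exp (\<delta> - 2 * \<delta>\<^sup>2) \<le> 1 + \<delta>"
  proof -
    have "\<delta> - 2 * \<delta>\<^sup>2 \<le> ln (1 + \<delta>)"
      using ln_one_plus_pos_lower_bound[of \<delta>] \<delta> zero_le_power2[of \<delta>] by linarith
    then show ?thesis using \<delta> by (subst ln_ge_iff[symmetric]) auto
  qed
  moreover have "exp (- \<delta> - 2 * \<delta>\<^sup>2) \<le> 1 + (- \<delta>)"
    using ln_one_minus_pos_lower_bound[of \<delta>] \<delta> by (subst ln_ge_iff[symmetric]) auto
  moreover have "0 \<le> (r * (1 + \<delta>)) ^ n * exp (- (r * (1 + \<delta>) * h))"
    "0 \<le> (r * (1 - \<delta>)) ^ n * exp (- (r * (1 - \<delta>) * h))"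
    using r \<delta> by (auto intro!: mult_nonneg_nonneg zero_le_power)
  ultimately show ?thesis
    using tilt[of \<delta>] tilt[of "- \<delta>"] by (cases "1 - r * h / n \<ge> 0") (simp_all add: abs_if right_diff_distrib[of \<delta>] split: if_splits)
qed

text \<open>
  The left-hand side is the factor, up to \<open>n * \<delta> ^ 3\<close>, by which a weight with relative deviation \<open>y\<close>
  can change in a second difference with increment of relative size \<open>\<delta> ^ 3\<close>. Deviations up to
  \<open>2 * \<delta>\<close> are harmless. Larger ones are absorbed by the exponential: linearly in \<open>y\<close> if
  \<open>n * \<delta>\<^sup>2 \<ge> 1\<close>, and otherwise through its quadratic term, where the second argument of the
  minimum supplies a factor \<open>n * \<delta> ^ 3\<close>. The exponent 3 makes both cases of order \<open>\<delta>\<close>.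
\<close>

lemma tilted_deviation_bound:
  fixes y \<delta> :: real and n :: nat
  assumes n: "1 \<le> n" and \<delta>: "0 < \<delta>" "\<delta> \<le> 1/2"
  defines "z \<equiv> 3 * \<delta> ^ 3 + 2 * \<bar>y\<bar>"
  shows "z * min 1 (n * \<delta> ^ 3 * z) \<le> 20 * \<delta> + 150 * \<delta> * exp (real n * (\<delta> * \<bar>y\<bar> - 2 * \<delta>\<^sup>2))"
proof -
  define E where "E = exp (real n * (\<delta> * \<bar>y\<bar> - 2 * \<delta>\<^sup>2))"
  have E: "0 < E" "real n * (\<delta> * \<bar>y\<bar> - 2 * \<delta>\<^sup>2) \<le> E"
    unfolding E_def using exp_ge_add_one_self[of "real n * (\<delta> * \<bar>y\<bar> - 2 * \<delta>\<^sup>2)"]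
    by (simp, linarith)
  have \<delta>2: "\<delta>\<^sup>2 \<le> 1/4" using \<delta> power_mono[of \<delta> "1/2" 2] by (simp add: power2_eq_square)
  have \<delta>3: "\<delta> ^ 3 \<le> \<delta> / 4" using mult_left_mono[OF \<delta>2, of \<delta>] \<delta> by (simp add: power3_eq_cube power2_eq_square mult.assoc)
  have z0: "0 \<le> z" using \<delta> by (auto simp: z_def)
  have zz: "z * min 1 (n * \<delta> ^ 3 * z) \<le> z" using z0 by (simp add: mult_left_le)
  consider "\<bar>y\<bar> \<le> 2 * \<delta>" | "\<bar>y\<bar> > 2 * \<delta>" "1 \<le> n * \<delta>\<^sup>2" | "n * \<delta>\<^sup>2 < 1" by linarith
  then have "z * min 1 (n * \<delta> ^ 3 * z) \<le> 20 * \<delta> + 150 * \<delta> * E"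
  proof cases
    case 1
    have "0 \<le> 150 * \<delta> * E" using E \<delta> by simp
    then show ?thesis using zz 1 \<delta>3 \<delta> unfolding z_def by linarith
  next
    case 2
    have "1 * (\<bar>y\<bar> - 2 * \<delta>) \<le> (real n * \<delta>\<^sup>2) * (\<bar>y\<bar> - 2 * \<delta>)" using 2 by (intro mult_right_mono) auto
    also have "\<dots> = \<delta> * (real n * (\<delta> * \<bar>y\<bar> - 2 * \<delta>\<^sup>2))" by (simp add: power2_eq_square algebra_simps)
    also have "\<dots> \<le> \<delta> * E" using E \<delta> by (intro mult_left_mono) auto
    finally have "\<bar>y\<bar> \<le> 2 * \<delta> + \<delta> * E" by simp
    moreover have "0 \<le> \<delta> * E" using E \<delta> by simp
    ultimately show ?thesis using zz \<delta>3 \<delta> unfolding z_def by linarith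
  next
    case 3
    define w where "w = n * \<delta> * \<bar>y\<bar>"
    have w0: "0 \<le> w" using \<delta> by (simp add: w_def)
    have "w\<^sup>2 / 2 \<le> exp w" using exp_lower_Taylor_quadratic[OF w0] w0 by (simp)
    also have "exp w = E * exp (2 * (n * \<delta>\<^sup>2))" by (simp add: E_def w_def mult_exp_exp algebra_simps)
    also have "\<dots> \<le> E * exp 2" using 3 E by (intro mult_left_mono) auto
    also have "exp 2 \<le> (9::real)"
    proof -
      have "exp 2 = exp 1 * exp (1::real)" by (simp flip: exp_add)
      also have "\<dots> \<le> 3 * 3" using exp_le by (intro mult_mono) auto
      finally show ?thesis by simp
    qed
    finally have w2: "w\<^sup>2 \<le> 18 * E" using E by simp
    have z2: "z\<^sup>2 \<le> 2 * ((3 * \<delta> ^ 3)\<^sup>2 + (2 * \<bar>y\<bar>)\<^sup>2)"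
      unfolding z_def using sum_squares_bound[of "3 * \<delta> ^ 3" "2 * \<bar>y\<bar>"] by (simp add: power2_sum)
    \<comment> \<open>Here \<open>n * \<delta>\<^sup>2\<close> is bounded, so that the tilt costs only the constant factor \<open>exp 2\<close>.\<close>
    have "z * min 1 (n * \<delta> ^ 3 * z) \<le> z * (n * \<delta> ^ 3 * z)" using z0 by (intro mult_left_mono) auto
    also have "\<dots> = n * \<delta> ^ 3 * z\<^sup>2" by (simp add: power2_eq_square)
    also have "\<dots> \<le> n * \<delta> ^ 3 * (2 * ((3 * \<delta> ^ 3)\<^sup>2 + (2 * \<bar>y\<bar>)\<^sup>2))"
      using \<delta> z2 by (intro mult_left_mono) auto
    also have "\<dots> = 18 * ((n * \<delta>\<^sup>2) * (\<delta> ^ 6 * \<delta>)) + 8 * (n * \<delta> ^ 3 * y\<^sup>2)"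
      by (simp add: power_mult_distrib power2_eq_square eval_nat_numeral algebra_simps)
    also have "(n * \<delta>\<^sup>2) * (\<delta> ^ 6 * \<delta>) \<le> 1 * (1 * \<delta>)"
      using 3 \<delta> by (intro mult_mono power_le_one mult_nonneg_nonneg zero_le_power) auto
    also have "n * \<delta> ^ 3 * y\<^sup>2 \<le> n * (n * \<delta> ^ 3 * y\<^sup>2)"
      using n \<delta> mult_right_mono[of 1 "real n" "n * \<delta> ^ 3 * y\<^sup>2"] by auto
    also have "\<dots> = \<delta> * w\<^sup>2" by (simp add: w_def power_mult_distrib power2_eq_square eval_nat_numeral algebra_simps)
    also have "\<dots> \<le> \<delta> * (18 * E)" using w2 \<delta> by (intro mult_left_mono) auto
    finally have "z * min 1 (n * \<delta> ^ 3 * z) \<le> 18 * \<delta> + 144 * (\<delta> * E)" by (simp add: algebra_simps)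
    moreover have "0 \<le> \<delta> * E" using E \<delta> by simp
    ultimately show ?thesis using \<delta> by linarith
  qed
  then show ?thesis unfolding E_def .
qed

lemma square_one_minus_exp_le:
  fixes v w :: real assumes "0 \<le> v" "v \<le> w"
  shows "(1 - exp (- v))\<^sup>2 \<le> w * min 1 w"
proof -
  have "0 \<le> 1 - exp (- v)" "1 - exp (-v) \<le> min 1 w"
    using assms exp_ge_add_one_self[of "-v"] by auto
  moreover have "0 \<le> w" using assms by simp
  ultimately show ?thesis unfolding power2_eq_square by (intro mult_mono) auto
qed

text \<open>
  Since \<open>p * q \<le> t\<^sup>2\<close> and \<open>p + q = 2 * t\<close>, the geometric mean of \<open>a p\<close> and \<open>a q\<close> is at most \<open>a t\<close>.
  The second difference is therefore at most the square of the difference of the square roots of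
  \<open>a p\<close> and \<open>a q\<close>, which is small if their logarithms are close. The logarithms differ by a
  multiple of \<open>n * \<delta> ^ 3\<close> times the deviation bounded in \<open>tilted_deviation_bound\<close>, and
  \<open>exponential_tilting\<close> converts the exponential there into weights at other intensities. The factor
  \<open>n\<close> in the error term is essential: it is with this factor that the sum of the weights is known.
\<close>

lemma gamma_weight_second_difference:
  fixes t h \<delta> :: real and n :: nat
  assumes n: "1 \<le> n" and t: "0 < t" and \<delta>: "0 < \<delta>" "\<delta> \<le> 1/2"
  defines "a \<equiv> \<lambda>u. u ^ n * exp (- (u * h))"
  defines "p \<equiv> t * (1 + \<delta> ^ 3)" and "q \<equiv> t * (1 - \<delta> ^ 3)"
  shows "a p + a q \<le> 2 * a t + n * (\<delta> ^ 4 * (20 * (a p + a q)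
     + 150 * (a (p * (1 + \<delta>)) + a (p * (1 - \<delta>)) + a (q * (1 + \<delta>)) + a (q * (1 - \<delta>)))))"
proof -
  define \<sigma> where "\<sigma> = \<delta> ^ 3"
  have "\<delta>\<^sup>2 \<le> 1/4" using \<delta> power_mono[of \<delta> "1/2" 2] by (simp add: power2_eq_square)
  then have "\<delta> ^ 3 \<le> \<delta> / 4" using mult_left_mono[of "\<delta>\<^sup>2" "1/4" \<delta>] \<delta>
    by (simp add: power3_eq_cube power2_eq_square mult.assoc)
  then have \<sigma>: "0 < \<sigma>" "\<sigma> \<le> 1/8" using \<delta> by (auto simp: \<sigma>_def)
  have p_eq: "p = t * (1 + \<sigma>)" and q_eq: "q = t * (1 - \<sigma>)" by (simp_all add: p_def q_def \<sigma>_def)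
  have pq: "0 < p" "0 < q" unfolding p_def q_def \<sigma>_def[symmetric] using t \<sigma> by auto
  define \<alpha> \<beta> where "\<alpha> = n * ln p - p * h" and "\<beta> = n * ln q - q * h"
  have a\<alpha>: "a p = exp \<alpha>" and a\<beta>: "a q = exp \<beta>"
    using pq by (auto simp: a_def \<alpha>_def \<beta>_def exp_diff exp_of_nat_mult exp_minus divide_simps)
  have apos: "0 \<le> a u" if "0 \<le> u" for u using that by (auto simp: a_def)
  have mid: "exp ((\<alpha> + \<beta>) / 2) \<le> a t"
  proof -
    have "ln p + ln q = ln (p * q)" using pq by (simp add: ln_mult)
    also have "\<dots> \<le> ln (t * t)"
    proof (subst ln_le_cancel_iff)
      have "p * q = t * t - (t * \<sigma>) * (t * \<sigma>)" by (simp add: p_def q_def \<sigma>_def algebra_simps)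
      then show "p * q \<le> t * t" by simp
    qed (use pq t in auto)
    also have "\<dots> = 2 * ln t" using t by (simp add: ln_mult)
    finally have "n * (ln p + ln q) \<le> n * (2 * ln t)" by (intro mult_left_mono) auto
    moreover have "\<alpha> + \<beta> = n * (ln p + ln q) - (p + q) * h"
      by (simp add: \<alpha>_def \<beta>_def algebra_simps)
    moreover have "p + q = 2 * t" by (simp add: p_def q_def algebra_simps)
    ultimately have "(\<alpha> + \<beta>) / 2 \<le> n * ln t - t * h" by simp
    then have "exp ((\<alpha> + \<beta>) / 2) \<le> exp (n * ln t - t * h)" by simp
    also have "\<dots> = a t" using t by (simp add: a_def exp_diff exp_of_nat_mult exp_minus divide_simps)
    finally show ?thesis .
  qed
  define z where "z r = 3 * \<delta> ^ 3 + 2 * \<bar>1 - r * h / n\<bar>" for r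
  have lnpq: "ln p - ln q \<le> 2 * \<sigma> / (1 - \<sigma>)" "2 * \<sigma> / (1 + \<sigma>) \<le> ln p - ln q"
  proof -
    have "ln p - ln q = ln (p / q)" using pq by (simp add: ln_div)
    also have "\<dots> \<le> p / q - 1" using pq by (intro ln_le_minus_one) auto
    also have "\<dots> = 2 * \<sigma> / (1 - \<sigma>)" using t \<sigma> by (simp add: p_eq q_eq diff_divide_eq_iff) (simp add: divide_simps)
    finally show "ln p - ln q \<le> 2 * \<sigma> / (1 - \<sigma>)" .
    have "ln q - ln p = ln (q / p)" using pq by (simp add: ln_div)
    also have "\<dots> \<le> q / p - 1" using pq by (intro ln_le_minus_one) auto
    also have "\<dots> = - (2 * \<sigma> / (1 + \<sigma>))" using t \<sigma> by (simp add: p_eq q_eq diff_divide_eq_iff) (simp add: divide_simps)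
    finally show "2 * \<sigma> / (1 + \<sigma>) \<le> ln p - ln q" by simp
  qed
  have frac: "1 / (1 - \<sigma>) - 1 / (1 + \<sigma>) \<le> 3 * \<sigma>"
  proof -
    have "\<sigma> * \<sigma> \<le> 1/8 * (1/8)" using \<sigma> by (intro mult_mono) auto
    then have "2 \<le> 3 * (1 - \<sigma> * \<sigma>)" by (simp add: right_diff_distrib)
    then have "\<sigma> * 2 \<le> \<sigma> * (3 * (1 - \<sigma> * \<sigma>))" using \<sigma> by (intro mult_left_mono) auto
    then show ?thesis using \<sigma> by (simp add: divide_simps) (simp add: algebra_simps)
  qed
  have up: "(\<alpha> - \<beta>) / 2 \<le> n * \<sigma> * z p"
  proof -
    define y where "y = 1 - p * h / n"
    have "p * h = n * (1 - y)" using n by (simp add: y_def)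
    then have th: "t * h = n * (1 - y) / (1 + \<sigma>)" using \<sigma> by (simp add: p_eq eq_divide_eq mult_ac)
    have "(\<alpha> - \<beta>) / 2 = n * ((ln p - ln q) / 2) - \<sigma> * (t * h)"
      by (simp add: \<alpha>_def \<beta>_def p_eq q_eq diff_divide_distrib algebra_simps)
    also have "\<dots> \<le> n * (\<sigma> / (1 - \<sigma>)) - \<sigma> * (t * h)"
      using lnpq by (intro diff_right_mono mult_left_mono) (simp_all add: mult.commute)
    also have "\<dots> = n * \<sigma> * ((1 / (1 - \<sigma>) - 1 / (1 + \<sigma>)) + y / (1 + \<sigma>))"
      by (simp only: th) (simp add: diff_divide_distrib add_divide_distrib algebra_simps)
    also have "\<dots> \<le> n * \<sigma> * (3 * \<sigma> + 2 * \<bar>y\<bar>)"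
    proof (intro mult_left_mono add_mono frac)
      have "y / (1 + \<sigma>) \<le> \<bar>y\<bar> / 1" using \<sigma> by (intro frac_le) auto
      then show "y / (1 + \<sigma>) \<le> 2 * \<bar>y\<bar>" by simp
    qed (use \<sigma> in auto)
    finally show ?thesis by (simp add: z_def y_def \<sigma>_def)
  qed
  have down: "(\<beta> - \<alpha>) / 2 \<le> n * \<sigma> * z q"
  proof -
    define y where "y = 1 - q * h / n"
    have "q * h = n * (1 - y)" using n by (simp add: y_def)
    then have th: "t * h = n * (1 - y) / (1 - \<sigma>)" using \<sigma> by (simp add: q_eq eq_divide_eq mult_ac)
    have "(\<beta> - \<alpha>) / 2 = \<sigma> * (t * h) - n * ((ln p - ln q) / 2)"
      by (simp add: \<alpha>_def \<beta>_def p_eq q_eq diff_divide_distrib algebra_simps)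
    also have "\<dots> \<le> \<sigma> * (t * h) - n * (\<sigma> / (1 + \<sigma>))"
      using lnpq by (intro diff_left_mono mult_left_mono) (simp_all add: mult.commute)
    also have "\<dots> = n * \<sigma> * ((1 / (1 - \<sigma>) - 1 / (1 + \<sigma>)) + (- y) / (1 - \<sigma>))"
      by (simp only: th) (simp add: diff_divide_distrib add_divide_distrib algebra_simps)
    also have "\<dots> \<le> n * \<sigma> * (3 * \<sigma> + 2 * \<bar>y\<bar>)"
    proof (intro mult_left_mono add_mono frac)
      have "(- y) / (1 - \<sigma>) \<le> \<bar>y\<bar> / (1/2)" using \<sigma> by (intro frac_le) auto
      then show "(- y) / (1 - \<sigma>) \<le> 2 * \<bar>y\<bar>" by simp
    qed (use \<sigma> in auto)
    finally show ?thesis by (simp add: z_def y_def \<sigma>_def)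
  qed
  have dev: "n * \<sigma> * z r * min 1 (n * \<sigma> * z r) * a r
      \<le> n * (\<delta> ^ 4 * (20 * a r + 150 * (a (r * (1 + \<delta>)) + a (r * (1 - \<delta>)))))" if r: "0 < r" for r
  proof -
    let ?E = "exp (real n * (\<delta> * \<bar>1 - r * h / n\<bar> - 2 * \<delta>\<^sup>2))"
    have "z r * min 1 (n * \<sigma> * z r) * a r \<le> (20 * \<delta> + 150 * \<delta> * ?E) * a r"
      using tilted_deviation_bound[OF n \<delta>, of "1 - r * h / n"] apos[of r] r
      by (intro mult_right_mono) (auto simp: z_def \<sigma>_def)
    also have "\<dots> = 20 * \<delta> * a r + 150 * \<delta> * (?E * a r)" by (simp add: algebra_simps)
    also have "\<dots> \<le> 20 * \<delta> * a r + 150 * \<delta> * (a (r * (1 + \<delta>)) + a (r * (1 - \<delta>)))"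
      using exponential_tilting[OF n r \<delta>, of h] \<delta> unfolding a_def
      by (intro add_left_mono mult_left_mono) auto
    finally have "(n * \<sigma>) * (z r * min 1 (n * \<sigma> * z r) * a r)
      \<le> (n * \<sigma>) * (20 * \<delta> * a r + 150 * \<delta> * (a (r * (1 + \<delta>)) + a (r * (1 - \<delta>))))"
      using \<sigma> by (intro mult_left_mono) auto
    then show ?thesis by (simp add: \<sigma>_def algebra_simps eval_nat_numeral)
  qed
  have devp: "0 \<le> n * (\<delta> ^ 4 * (20 * a r + 150 * (a (r * (1 + \<delta>)) + a (r * (1 - \<delta>)))))" if "0 < r" for r
    using that \<delta> by (intro mult_nonneg_nonneg add_nonneg_nonneg apos zero_le_power) auto
  have ident: "exp x + exp y - 2 * exp ((x + y) / 2) = (1 - exp (- ((x - y) / 2)))\<^sup>2 * exp x" for x y :: real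
  proof -
    have "(1 - exp (- ((x - y) / 2)))\<^sup>2 * exp x
       = exp x - 2 * (exp (- ((x - y) / 2)) * exp x) + exp (- ((x - y) / 2)) * exp (- ((x - y) / 2)) * exp x"
      by (simp add: power2_eq_square algebra_simps)
    also have "exp (- ((x - y) / 2)) * exp x = exp ((x + y) / 2)" by (simp add: mult_exp_exp field_simps)
    also have "exp (- ((x - y) / 2)) * exp (- ((x - y) / 2)) * exp x = exp y" by (simp add: mult_exp_exp field_simps)
    finally show ?thesis by simp
  qed
  have key: "a p + a q - 2 * a t \<le> n * (\<delta> ^ 4 * (20 * a p + 150 * (a (p * (1 + \<delta>)) + a (p * (1 - \<delta>)))))
     + n * (\<delta> ^ 4 * (20 * a q + 150 * (a (q * (1 + \<delta>)) + a (q * (1 - \<delta>)))))"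
  proof (cases "\<beta> \<le> \<alpha>")
    case True
    have "a p + a q - 2 * a t \<le> (1 - exp (- ((\<alpha> - \<beta>) / 2)))\<^sup>2 * a p"
      using mid ident[of \<alpha> \<beta>] by (simp add: a\<alpha> a\<beta>)
    also have "\<dots> \<le> n * \<sigma> * z p * min 1 (n * \<sigma> * z p) * a p"
      using True up pq by (intro mult_right_mono square_one_minus_exp_le apos) auto
    finally show ?thesis using dev[of p] devp[of q] pq by linarith
  next
    case False
    have "a p + a q - 2 * a t \<le> (1 - exp (- ((\<beta> - \<alpha>) / 2)))\<^sup>2 * a q"
      using mid ident[of \<beta> \<alpha>] by (simp add: a\<alpha> a\<beta> add.commute)
    also have "\<dots> \<le> n * \<sigma> * z q * min 1 (n * \<sigma> * z q) * a q"
      using False down pq by (intro mult_right_mono square_one_minus_exp_le apos) auto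
    finally show ?thesis using dev[of q] devp[of p] pq by linarith
  qed
  then show ?thesis by (simp add: algebra_simps)
qed

section \<open>Exponential generating functions\<close>

text \<open>
  Expectations under a Poisson process in a window of finite mass are, up to a factor
  \<open>exp (- m * t)\<close>, exponential generating functions; a geometric bound on the coefficients makes
  them entire.
\<close>

lemma egf_summable:
  fixes u :: "nat \<Rightarrow> real"
  assumes "\<And>k. \<bar>u k\<bar> \<le> C * M ^ k"
  shows "summable (\<lambda>k. u k / fact k * x ^ k)"
proof (rule summable_comparison_test')
  show "summable (\<lambda>k. C * (inverse (fact k) * \<bar>M * x\<bar> ^ k))"
    by (intro summable_mult summable_exp)
  fix k
  have "norm (u k / fact k * x ^ k) = \<bar>u k\<bar> * (inverse (fact k) * \<bar>x\<bar> ^ k)"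
    by (simp add: abs_mult power_abs divide_inverse)
  also have "\<dots> \<le> \<bar>C * M ^ k\<bar> * (inverse (fact k) * \<bar>x\<bar> ^ k)"
    using assms[of k] by (intro mult_right_mono) auto
  also have "\<dots> = \<bar>C\<bar> * (inverse (fact k) * \<bar>M * x\<bar> ^ k)"
    by (simp add: abs_mult power_abs power_mult_distrib)
  also have "\<bar>C\<bar> = C" using assms[of 0] by simp
  finally show "norm (u k / fact k * x ^ k) \<le> C * (inverse (fact k) * \<bar>M * x\<bar> ^ k)" .
qed

lemma egf_has_derivative:
  fixes u :: "nat \<Rightarrow> real"
  assumes "\<And>k. \<bar>u k\<bar> \<le> C * M ^ k"
  shows "((\<lambda>x. \<Sum>k. u k / fact k * x ^ k) has_real_derivative (\<Sum>k. u (Suc k) / fact k * x ^ k)) (at x)"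
proof -
  have "((\<lambda>x. \<Sum>k. u k / fact k * x ^ k) has_real_derivative (\<Sum>k. diffs (\<lambda>k. u k / fact k) k * x ^ k)) (at x)"
    by (rule termdiffs_strong_converges_everywhere) (rule egf_summable[OF assms])
  also have "diffs (\<lambda>k. u k / fact k) = (\<lambda>k. u (Suc k) / fact k)"
    by (auto simp: diffs_def fun_eq_iff simp del: of_nat_Suc)
  finally show ?thesis .
qed

text \<open>
  The second derivative of \<open>exp (- m * t) * (\<Sum>k. u k / fact k * t ^ k)\<close> is the same expression with
  \<open>u k\<close> replaced by the second difference \<open>u (k + 2) - 2 * m * u (k + 1) + m\<^sup>2 * u k\<close>, and the
  coefficients \<open>m ^ k\<close> are transformed into the constant 1.
\<close>

lemma convex_on_poisson_transform:
  fixes u :: "nat \<Rightarrow> real" and m D :: real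
  assumes bnd: "\<And>k. \<bar>u k\<bar> \<le> C * M ^ k" and m: "0 \<le> m"
    and diff: "\<And>k. u (Suc (Suc k)) - 2 * m * u (Suc k) + m\<^sup>2 * u k \<ge> - D * m ^ k"
  shows "convex_on {0..} (\<lambda>t. exp (- (m * t)) * (\<Sum>k. u k / fact k * t ^ k) + D * t\<^sup>2 / 2)"
proof -
  have bnd1: "\<bar>u (Suc k)\<bar> \<le> (C * M) * M ^ k" for k using bnd[of "Suc k"] by (simp add: mult.assoc)
  have bnd2: "\<bar>u (Suc (Suc k))\<bar> \<le> (C * M * M) * M ^ k" for k using bnd[of "Suc (Suc k)"] by (simp add: mult_ac)
  define U where "U t = (\<Sum>k. u k / fact k * t ^ k)" for t
  define U1 where "U1 t = (\<Sum>k. u (Suc k) / fact k * t ^ k)" for t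
  define U2 where "U2 t = (\<Sum>k. u (Suc (Suc k)) / fact k * t ^ k)" for t
  have dU: "(U has_real_derivative U1 t) (at t)" for t
    using egf_has_derivative[OF bnd] unfolding U_def U1_def .
  have dU1: "(U1 has_real_derivative U2 t) (at t)" for t
    using egf_has_derivative[of "\<lambda>k. u (Suc k)", OF bnd1] unfolding U1_def U2_def .
  have "convex_on {0..} (\<lambda>t. exp (- (m * t)) * U t + D * t\<^sup>2 / 2)"
  proof (rule f''_ge0_imp_convex)
    show "((\<lambda>t. exp (- (m * t)) * U t + D * t\<^sup>2 / 2) has_real_derivative
        exp (- (m * t)) * (U1 t - m * U t) + D * t) (at t)" for t
      by (auto intro!: derivative_eq_intros dU simp: algebra_simps)
    show "((\<lambda>t. exp (- (m * t)) * (U1 t - m * U t) + D * t) has_real_derivative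
        exp (- (m * t)) * (U2 t - 2 * m * U1 t + m\<^sup>2 * U t) + D) (at t)" for t
      by (auto intro!: derivative_eq_intros dU dU1 simp: algebra_simps power2_eq_square)
    fix t :: real assume t: "t \<in> {0..}"
    have up: "(\<lambda>k. (u (Suc (Suc k)) / fact k * t ^ k - (2 * m) * (u (Suc k) / fact k * t ^ k)) + m\<^sup>2 * (u k / fact k * t ^ k))
       sums (U2 t - (2 * m) * U1 t + m\<^sup>2 * U t)"
      unfolding U_def U1_def U2_def
      by (intro sums_add sums_diff sums_mult summable_sums egf_summable[OF bnd] egf_summable[of "\<lambda>k. u (Suc k)", OF bnd1]
          egf_summable[of "\<lambda>k. u (Suc (Suc k))", OF bnd2])
    have low: "(\<lambda>k. - D * ((m * t) ^ k /\<^sub>R fact k)) sums (- D * exp (m * t))"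
      by (intro sums_mult exp_converges)
    have le: "- D * ((m * t) ^ k /\<^sub>R fact k) \<le>
      (u (Suc (Suc k)) / fact k * t ^ k - (2 * m) * (u (Suc k) / fact k * t ^ k)) + m\<^sup>2 * (u k / fact k * t ^ k)" for k
    proof -
      have "- D * m ^ k * (t ^ k / fact k) \<le> (u (Suc (Suc k)) - 2 * m * u (Suc k) + m\<^sup>2 * u k) * (t ^ k / fact k)"
        using t diff[of k] by (intro mult_right_mono) auto
      also have "\<dots> = (u (Suc (Suc k)) / fact k * t ^ k - (2 * m) * (u (Suc k) / fact k * t ^ k)) + m\<^sup>2 * (u k / fact k * t ^ k)"
        by (simp only: ring_distribs times_divide_eq_left times_divide_eq_right mult_ac)
      finally show ?thesis by (simp add: power_mult_distrib divide_inverse mult_ac)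
    qed
    have "- D * exp (m * t) \<le> U2 t - (2 * m) * U1 t + m\<^sup>2 * U t"
      by (rule sums_le[OF le low up])
    then have "exp (- (m * t)) * (- D * exp (m * t)) \<le> exp (- (m * t)) * (U2 t - (2 * m) * U1 t + m\<^sup>2 * U t)"
      by (intro mult_left_mono) auto
    then show "0 \<le> exp (- (m * t)) * (U2 t - 2 * m * U1 t + m\<^sup>2 * U t) + D"
      by (simp add: exp_minus field_simps)
  qed auto
  then show ?thesis unfolding U_def .
qed

section \<open>Clusters of a finite graph\<close>

lemma vertex_pairs_doubleton_iff: "{x, y} \<in> vertex_pairs V \<longleftrightarrow> x \<in> V \<and> y \<in> V \<and> x \<noteq> y"
  by (auto simp: vertex_pairs_def card_insert_if)

lemma vertex_pairsE:
  assumes "e \<in> vertex_pairs V" obtains x y where "e = {x, y}" "x \<in> V" "y \<in> V" "x \<noteq> y"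
  using assms by (auto simp: vertex_pairs_def card_2_iff)

lemma finite_vertex_pairs [simp]: "finite V \<Longrightarrow> finite (vertex_pairs V)"
  by (rule finite_subset[of _ "Pow V"]) (auto simp: vertex_pairs_def)

lemma vertex_pairs_mono: "V \<subseteq> W \<Longrightarrow> vertex_pairs V \<subseteq> vertex_pairs W"
  by (auto simp: vertex_pairs_def)

definition adjacency :: "'x set \<Rightarrow> ('x set \<Rightarrow> bool) \<Rightarrow> ('x \<times> 'x) set" where
  "adjacency V c = {(x, y). {x, y} \<in> vertex_pairs V \<and> c {x, y}}"

lemma cluster_eq_Image: "cluster V c v = (adjacency V c)\<^sup>* `` {v}"
  by (auto simp: cluster_def adjacency_def)

lemma mem_cluster_iff: "w \<in> cluster V c v \<longleftrightarrow> (v, w) \<in> (adjacency V c)\<^sup>*"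
  by (simp add: cluster_eq_Image)

lemma sym_adjacency: "sym (adjacency V c)"
  by (auto simp: adjacency_def sym_def insert_commute)

lemma mem_cluster_self [simp]: "v \<in> cluster V c v"
  by (simp add: mem_cluster_iff)

lemma mem_cluster_sym: "w \<in> cluster V c v \<Longrightarrow> v \<in> cluster V c w"
  using sym_rtrancl[OF sym_adjacency, of V c] by (auto simp: mem_cluster_iff sym_def)

lemma mem_cluster_trans: "w \<in> cluster V c v \<Longrightarrow> u \<in> cluster V c w \<Longrightarrow> u \<in> cluster V c v"
  by (auto simp: mem_cluster_iff)

lemma cluster_eqI: "w \<in> cluster V c v \<Longrightarrow> cluster V c w = cluster V c v"
  by (meson mem_cluster_sym mem_cluster_trans subset_antisym subsetI)

lemma cluster_closed:
  assumes "v \<in> T" and "\<And>x y. x \<in> T \<Longrightarrow> (x, y) \<in> adjacency V c \<Longrightarrow> y \<in> T"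
  shows "cluster V c v \<subseteq> T"
proof
  fix w assume "w \<in> cluster V c v"
  then have "(v, w) \<in> (adjacency V c)\<^sup>*" by (simp add: mem_cluster_iff)
  then show "w \<in> T" by (induction rule: rtrancl_induct) (use assms in auto)
qed

lemma cluster_subset: "v \<in> V \<Longrightarrow> cluster V c v \<subseteq> V"
  by (rule cluster_closed) (auto simp: adjacency_def vertex_pairs_doubleton_iff)

lemma finite_cluster: "finite V \<Longrightarrow> v \<in> V \<Longrightarrow> finite (cluster V c v)"
  using cluster_subset finite_subset by metis

lemma cluster_mono:
  assumes "adjacency V c \<subseteq> adjacency W d" shows "cluster V c v \<subseteq> cluster W d v"
  using rtrancl_mono[OF assms] by (auto simp: mem_cluster_iff)

lemma cluster_cong:
  assumes "V = W" "\<And>e. e \<in> vertex_pairs V \<Longrightarrow> c e = d e"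
  shows "cluster V c v = cluster W d v"
proof -
  have "adjacency V c = adjacency W d" using assms by (auto simp: adjacency_def)
  then show ?thesis by (simp add: cluster_eq_Image)
qed

definition num_clusters :: "'x set \<Rightarrow> ('x set \<Rightarrow> bool) \<Rightarrow> nat" where
  "num_clusters V c = card (cluster V c ` V)"

lemma num_clusters_cong:
  assumes "V = W" "\<And>e. e \<in> vertex_pairs V \<Longrightarrow> c e = d e"
  shows "num_clusters V c = num_clusters W d"
  unfolding num_clusters_def using cluster_cong[OF assms] assms by (auto intro!: arg_cong[of _ _ card])

lemma num_clusters_le: "finite V \<Longrightarrow> num_clusters V c \<le> card V"
  unfolding num_clusters_def by (rule card_image_le)

lemma fibre_cluster:
  assumes "S \<in> cluster V c ` V" shows "{v \<in> V. cluster V c v = S} = S"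
proof -
  obtain u where u: "u \<in> V" "S = cluster V c u" using assms by auto
  show ?thesis
  proof (intro set_eqI iffI)
    fix v assume "v \<in> S"
    then show "v \<in> {v \<in> V. cluster V c v = S}"
      using u cluster_subset[of u V c] cluster_eqI[of v V c u] by auto
  next
    fix v assume "v \<in> {v \<in> V. cluster V c v = S}"
    then show "v \<in> S" using mem_cluster_self[of v V c] by simp
  qed
qed

lemma sum_over_clusters:
  fixes g :: "'x set \<Rightarrow> real"
  assumes "finite V"
  shows "(\<Sum>v\<in>V. g (cluster V c v)) = (\<Sum>S\<in>cluster V c ` V. real (card S) * g S)"
proof -
  have "(\<Sum>v\<in>V. g (cluster V c v)) = (\<Sum>S\<in>cluster V c ` V. \<Sum>v\<in>{v\<in>V. cluster V c v = S}. g (cluster V c v))"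
    using assms by (subst sum.group) auto
  also have "\<dots> = (\<Sum>S\<in>cluster V c ` V. \<Sum>v\<in>{v\<in>V. cluster V c v = S}. g S)"
    by (intro sum.cong) auto
  also have "\<dots> = (\<Sum>S\<in>cluster V c ` V. real (card S) * g S)"
    by (intro sum.cong refl) (simp add: fibre_cluster)
  finally show ?thesis .
qed

text \<open>
  Every cluster receives total weight one from its vertices.
\<close>

lemma sum_inverse_cluster_size:
  assumes "finite V"
  shows "(\<Sum>v\<in>V. 1 / real (card (cluster V c v))) = num_clusters V c"
proof -
  have "(\<Sum>v\<in>V. 1 / real (card (cluster V c v))) = (\<Sum>S\<in>cluster V c ` V. real (card S) * (1 / real (card S)))"
    using sum_over_clusters[OF assms, of "\<lambda>S. 1 / real (card S)" c] by simp
  also have "\<dots> = (\<Sum>S\<in>cluster V c ` V. 1)"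
  proof (intro sum.cong refl)
    fix S assume "S \<in> cluster V c ` V"
    then obtain v where v: "v \<in> V" "S = cluster V c v" by auto
    then have "finite S" "v \<in> S" using finite_cluster[OF assms, of v c] by auto
    then have "finite S" "S \<noteq> {}" by auto
    then show "real (card S) * (1 / real (card S)) = 1" by simp
  qed
  finally show ?thesis by (simp add: num_clusters_def)
qed

lemma sum_cluster_sizes:
  assumes "finite V" shows "(\<Sum>S\<in>cluster V c ` V. real (card S)) = card V"
  using sum_over_clusters[OF assms, of "\<lambda>S. 1" c] by simp

lemma adjacency_insert_edge:
  "adjacency V (\<lambda>e. e \<in> insert {x, y} A) \<subseteq> adjacency V (\<lambda>e. e \<in> A) \<union> {(x, y), (y, x)}"
  by (auto simp: adjacency_def doubleton_eq_iff)

text \<open>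
  The new edge unites the clusters of its endpoints and leaves all other clusters unchanged.
\<close>

lemma num_clusters_insert_edge:
  assumes V: "finite V" and xy: "{x, y} \<in> vertex_pairs V"
  shows "real (num_clusters V (\<lambda>e. e \<in> insert {x, y} A))
       = real (num_clusters V (\<lambda>e. e \<in> A)) - of_bool (y \<notin> cluster V (\<lambda>e. e \<in> A) x)"
proof -
  let ?C = "cluster V (\<lambda>e. e \<in> A)" and ?D = "cluster V (\<lambda>e. e \<in> insert {x, y} A)"
  have xV: "x \<in> V" "y \<in> V" using xy by (auto simp: vertex_pairs_doubleton_iff)
  have sub: "?C v \<subseteq> ?D v" for v by (intro cluster_mono) (auto simp: adjacency_def)
  have y_D: "y \<in> ?D x"
    unfolding mem_cluster_iff using xy by (intro r_into_rtrancl) (auto simp: adjacency_def)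
  have closedC: "w \<in> ?C v" if "u \<in> ?C v" "(u, w) \<in> adjacency V (\<lambda>e. e \<in> A)" for u v w
    using that unfolding mem_cluster_iff by (rule rtrancl_into_rtrancl)
  have other: "?D v = ?C v" if "x \<notin> ?C v" "y \<notin> ?C v" for v
  proof (rule antisym[OF _ sub], rule cluster_closed)
    fix a b assume "a \<in> ?C v" "(a, b) \<in> adjacency V (\<lambda>e. e \<in> insert {x, y} A)"
    then show "b \<in> ?C v" using adjacency_insert_edge[of V x y A] that closedC by blast
  qed simp
  show ?thesis
  proof (cases "y \<in> ?C x")
    case True
    have "?D v = ?C v" for v
    proof (cases "x \<in> ?C v")
      case xv: True
      then have yv: "y \<in> ?C v" using True mem_cluster_trans by metis
      show ?thesis
      proof (rule antisym[OF _ sub], rule cluster_closed)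
        fix a b assume "a \<in> ?C v" "(a, b) \<in> adjacency V (\<lambda>e. e \<in> insert {x, y} A)"
        then show "b \<in> ?C v" using adjacency_insert_edge[of V x y A] xv yv closedC by blast
      qed simp
    next
      case False
      moreover have "y \<notin> ?C v" using False True mem_cluster_sym mem_cluster_trans by metis
      ultimately show ?thesis by (rule other)
    qed
    then show ?thesis using True by (simp add: num_clusters_def)
  next
    case False
    then have neq: "?C x \<noteq> ?C y" by auto
    have merged: "?D x = ?C x \<union> ?C y"
    proof (rule antisym)
      show "?D x \<subseteq> ?C x \<union> ?C y"
      proof (rule cluster_closed)
        fix a b assume "a \<in> ?C x \<union> ?C y" "(a, b) \<in> adjacency V (\<lambda>e. e \<in> insert {x, y} A)"
        then show "b \<in> ?C x \<union> ?C y"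
          using adjacency_insert_edge[of V x y A] closedC by (blast intro: mem_cluster_self)
      qed simp
      show "?C x \<union> ?C y \<subseteq> ?D x" using sub[of x] sub[of y] cluster_eqI[OF y_D] by auto
    qed
    define R where "R = ?C ` V - {?C x, ?C y}"
    have C_img: "?C ` V = insert (?C x) (insert (?C y) R)" using xV by (auto simp: R_def)
    have D_img: "?D ` V = insert (?D x) R"
    proof (intro set_eqI iffI)
      fix S assume "S \<in> ?D ` V"
      then obtain v where v: "v \<in> V" "S = ?D v" by auto
      show "S \<in> insert (?D x) R"
      proof (cases "x \<in> ?C v \<or> y \<in> ?C v")
        case True
        then have "v \<in> ?C x \<union> ?C y" using mem_cluster_sym by fast
        then have "v \<in> ?D x" by (simp only: merged)
        then have "?D v = ?D x" by (rule cluster_eqI)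
        then show ?thesis using v by simp
      next
        case False
        then have "S = ?C v" using v other by simp
        moreover have "?C v \<noteq> ?C x" "?C v \<noteq> ?C y" using False by (metis mem_cluster_self)+
        ultimately show ?thesis using v by (auto simp: R_def)
      qed
    next
      fix S assume "S \<in> insert (?D x) R"
      then consider "S = ?D x" | "S \<in> R" by auto
      then show "S \<in> ?D ` V"
      proof cases
        case 2
        then obtain v where v: "v \<in> V" "S = ?C v" "?C v \<noteq> ?C x" "?C v \<noteq> ?C y" by (auto simp: R_def)
        then have "x \<notin> ?C v" "y \<notin> ?C v"
          using cluster_eqI[of x V "\<lambda>e. e \<in> A" v] cluster_eqI[of y V "\<lambda>e. e \<in> A" v] by auto
        then have "S = ?D v" using v(2) other by metis
        then show ?thesis using v(1) by (rule image_eqI)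
      qed (use xV in auto)
    qed
    have Dx: "?D x \<notin> R"
    proof
      assume "?D x \<in> R"
      then obtain v where v: "?D x = ?C v" "?C v \<noteq> ?C x" by (auto simp: R_def)
      then have "x \<in> ?C v" by (metis mem_cluster_self)
      then show False using v cluster_eqI[of x V "\<lambda>e. e \<in> A" v] by auto
    qed
    have R: "finite R" "?C x \<notin> insert (?C y) R" "?C y \<notin> R"
      using V neq by (simp_all add: R_def)
    have "card (?D ` V) = Suc (card R)" "card (?C ` V) = Suc (Suc (card R))"
      unfolding D_img C_img card_insert_disjoint[OF R(1) Dx] card_insert_disjoint[OF R(1,3)]
        card_insert_disjoint[OF finite.insertI[OF R(1)] R(2)] by (rule refl)+
    then show ?thesis using False by (simp add: num_clusters_def)
  qed
qed

text \<open>
  The edges of \<open>B - A\<close> are added one at a time, to \<open>A\<close> and to \<open>A \<inter> B\<close> simultaneously. If such an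
  edge joins two different clusters of the larger graph, it also joins two different clusters of the
  smaller one, because the clusters there are smaller.
\<close>

lemma num_clusters_supermodular:
  assumes V: "finite V" and AB: "A \<subseteq> vertex_pairs V" "B \<subseteq> vertex_pairs V"
  shows "real (num_clusters V (\<lambda>e. e \<in> A)) + real (num_clusters V (\<lambda>e. e \<in> B))
       \<le> real (num_clusters V (\<lambda>e. e \<in> A \<union> B)) + real (num_clusters V (\<lambda>e. e \<in> A \<inter> B))"
proof -
  let ?n = "\<lambda>A. real (num_clusters V (\<lambda>e. e \<in> A))"
  have fin: "finite D" if "D \<subseteq> vertex_pairs V" for D using that V finite_subset finite_vertex_pairs by metis
  have "?n A + ?n ((A \<inter> B) \<union> D) \<le> ?n (A \<union> D) + ?n (A \<inter> B)" if "D \<subseteq> vertex_pairs V" for D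
    using fin[OF that] that
  proof (induction D rule: finite_induct)
    case (insert e D)
    have "e \<in> vertex_pairs V" using insert.prems by simp
    moreover from this obtain x y where "e = {x, y}" by (rule vertex_pairsE)
    ultimately have e: "e = {x, y}" "{x, y} \<in> vertex_pairs V" by simp_all
    have "cluster V (\<lambda>e. e \<in> (A \<inter> B) \<union> D) x \<subseteq> cluster V (\<lambda>e. e \<in> A \<union> D) x"
      by (intro cluster_mono) (auto simp: adjacency_def)
    then have "(of_bool (y \<notin> cluster V (\<lambda>e. e \<in> A \<union> D) x) :: real) \<le> of_bool (y \<notin> cluster V (\<lambda>e. e \<in> (A \<inter> B) \<union> D) x)"
      by auto
    moreover have "?n A + ?n ((A \<inter> B) \<union> D) \<le> ?n (A \<union> D) + ?n (A \<inter> B)"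
      by (rule insert.IH) (use insert.prems in simp)
    moreover have "?n (A \<union> insert e D) = ?n (A \<union> D) - of_bool (y \<notin> cluster V (\<lambda>e. e \<in> A \<union> D) x)"
      using num_clusters_insert_edge[OF V e(2), of "A \<union> D"] by (simp only: e(1) Un_insert_right)
    moreover have "?n ((A \<inter> B) \<union> insert e D)
        = ?n ((A \<inter> B) \<union> D) - of_bool (y \<notin> cluster V (\<lambda>e. e \<in> (A \<inter> B) \<union> D) x)"
      using num_clusters_insert_edge[OF V e(2), of "(A \<inter> B) \<union> D"] by (simp only: e(1) Un_insert_right)
    ultimately show ?case by linarith
  qed simp
  from this[of "B"] AB have "?n A + ?n ((A \<inter> B) \<union> B) \<le> ?n (A \<union> B) + ?n (A \<inter> B)" by simp
  moreover have "(A \<inter> B) \<union> B = B" by auto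
  ultimately show ?thesis by simp
qed

lemma num_clusters_insert_isolated:
  assumes V: "finite V" and z: "z \<notin> V" and c: "\<And>v. v \<in> V \<Longrightarrow> \<not> c {z, v}"
  shows "num_clusters (insert z V) c = Suc (num_clusters V c)"
proof -
  have adj: "adjacency (insert z V) c = adjacency V c"
    using c z by (auto simp: adjacency_def vertex_pairs_doubleton_iff insert_commute)
  then have cl: "cluster (insert z V) c = cluster V c" by (auto simp: cluster_eq_Image fun_eq_iff)
  have "cluster V c z \<subseteq> {z}"
    by (rule cluster_closed) (use z in \<open>auto simp: adjacency_def vertex_pairs_doubleton_iff\<close>)
  then have "cluster V c z \<notin> cluster V c ` V"
    using z cluster_subset[of _ V c] mem_cluster_self[of z V c] by blast
  then show ?thesis using V by (simp add: num_clusters_def cl)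
qed

text \<open>
  Within \<open>insert x (insert y V)\<close>, let \<open>A\<close> and \<open>B\<close> be the sets of edges that avoid \<open>y\<close> and \<open>x\<close>,
  respectively. Their intersection consists of the edges within \<open>V\<close>, and their union contains all edges
  except possibly \<open>{x, y}\<close>, which removes at most one cluster. Supermodularity compares these four
  graphs; passing to the common vertex set only adds isolated vertices.
\<close>

lemma num_clusters_second_difference:
  assumes V: "finite V" and xy: "x \<notin> V" "y \<notin> V" "x \<noteq> y"
  shows "real (num_clusters (insert x V) c) + real (num_clusters (insert y V) c) - of_bool (c {x, y})
      \<le> real (num_clusters (insert x (insert y V)) c) + real (num_clusters V c)"
proof -
  let ?W = "insert x (insert y V)"
  define A B where "A = {e \<in> vertex_pairs (insert x V). c e}" and "B = {e \<in> vertex_pairs (insert y V). c e}"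
  have W: "finite ?W" using V by simp
  have AB: "A \<subseteq> vertex_pairs ?W" "B \<subseteq> vertex_pairs ?W"
    using vertex_pairs_mono[of "insert x V" ?W] vertex_pairs_mono[of "insert y V" ?W] by (auto simp: A_def B_def)
  have "num_clusters ?W (\<lambda>e. e \<in> A) = Suc (num_clusters (insert x V) (\<lambda>e. e \<in> A))"
    unfolding insert_commute[of x y] using V xy
    by (intro num_clusters_insert_isolated) (auto simp: A_def vertex_pairs_doubleton_iff)
  also have "num_clusters (insert x V) (\<lambda>e. e \<in> A) = num_clusters (insert x V) c"
    by (intro num_clusters_cong) (auto simp: A_def)
  finally have nA: "num_clusters ?W (\<lambda>e. e \<in> A) = Suc (num_clusters (insert x V) c)" .
  have "num_clusters ?W (\<lambda>e. e \<in> B) = Suc (num_clusters (insert y V) (\<lambda>e. e \<in> B))"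
    using V xy by (intro num_clusters_insert_isolated) (auto simp: B_def vertex_pairs_doubleton_iff)
  also have "num_clusters (insert y V) (\<lambda>e. e \<in> B) = num_clusters (insert y V) c"
    by (intro num_clusters_cong) (auto simp: B_def)
  finally have nB: "num_clusters ?W (\<lambda>e. e \<in> B) = Suc (num_clusters (insert y V) c)" .
  have AB_int: "A \<inter> B = {e \<in> vertex_pairs V. c e}" using xy by (auto simp: A_def B_def vertex_pairs_def)
  have "num_clusters ?W (\<lambda>e. e \<in> A \<inter> B) = Suc (num_clusters (insert y V) (\<lambda>e. e \<in> A \<inter> B))"
    using V xy by (intro num_clusters_insert_isolated) (auto simp: AB_int vertex_pairs_doubleton_iff)
  also have "num_clusters (insert y V) (\<lambda>e. e \<in> A \<inter> B) = Suc (num_clusters V (\<lambda>e. e \<in> A \<inter> B))"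
    using V xy by (intro num_clusters_insert_isolated) (auto simp: AB_int vertex_pairs_doubleton_iff)
  also have "num_clusters V (\<lambda>e. e \<in> A \<inter> B) = num_clusters V c"
    by (intro num_clusters_cong) (auto simp: AB_int)
  finally have nI: "num_clusters ?W (\<lambda>e. e \<in> A \<inter> B) = Suc (Suc (num_clusters V c))" .
  have pair: "{x, y} \<in> vertex_pairs ?W" using xy by (auto simp: vertex_pairs_doubleton_iff)
  have split: "{e \<in> vertex_pairs ?W. c e} = (if c {x, y} then insert {x, y} (A \<union> B) else A \<union> B)"
  proof -
    have "vertex_pairs ?W \<subseteq> vertex_pairs (insert x V) \<union> vertex_pairs (insert y V) \<union> {{x, y}}"
    proof
      fix e assume "e \<in> vertex_pairs ?W"
      then obtain u v where e: "e = {u, v}" "u \<in> ?W" "v \<in> ?W" "u \<noteq> v" by (rule vertex_pairsE)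
      then show "e \<in> vertex_pairs (insert x V) \<union> vertex_pairs (insert y V) \<union> {{x, y}}"
        by (cases "u = x"; cases "v = x"; cases "u = y"; cases "v = y")
           (simp_all add: vertex_pairs_doubleton_iff insert_commute)
    qed
    then have upper: "{e \<in> vertex_pairs ?W. c e} \<subseteq> insert {x, y} (A \<union> B)" by (auto simp: A_def B_def)
    have lower: "A \<union> B \<subseteq> {e \<in> vertex_pairs ?W. c e}" using AB by (auto simp: A_def B_def)
    show ?thesis
    proof (cases "c {x, y}")
      case True
      then have "insert {x, y} (A \<union> B) \<subseteq> {e \<in> vertex_pairs ?W. c e}" using lower pair by simp
      then show ?thesis using upper True by (simp add: antisym)
    next
      case False
      then have "{x, y} \<notin> {e \<in> vertex_pairs ?W. c e}" by simp
      then have "{e \<in> vertex_pairs ?W. c e} \<subseteq> A \<union> B" using upper by (simp add: subset_insert)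
      then show ?thesis using lower False by (simp add: antisym)
    qed
  qed
  have "num_clusters ?W c = num_clusters ?W (\<lambda>e. e \<in> {e \<in> vertex_pairs ?W. c e})"
    by (intro num_clusters_cong) auto
  also have "real \<dots> \<ge> real (num_clusters ?W (\<lambda>e. e \<in> A \<union> B)) - of_bool (c {x, y})"
    unfolding split using num_clusters_insert_edge[OF W pair, of "A \<union> B"] by auto
  finally have "real (num_clusters ?W (\<lambda>e. e \<in> A \<union> B)) - of_bool (c {x, y}) \<le> real (num_clusters ?W c)" .
  then show ?thesis using num_clusters_supermodular[OF W AB] nA nB nI by simp
qed

definition spans :: "'x set \<Rightarrow> ('x set \<Rightarrow> bool) \<Rightarrow> bool" where
  "spans S c \<longleftrightarrow> S \<noteq> {} \<and> (\<forall>v\<in>S. cluster S c v = S)"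

text \<open>
  The two conditions on the right concern disjoint sets of edges, so that they are independent in the
  random graph.
\<close>

lemma mem_clusters_iff:
  assumes "S \<subseteq> V"
  shows "S \<in> cluster V c ` V \<longleftrightarrow> spans S c \<and> (\<forall>v\<in>S. \<forall>w\<in>V - S. \<not> c {v, w})"
proof
  assume "S \<in> cluster V c ` V"
  then obtain u where u: "u \<in> V" "S = cluster V c u" by auto
  have no_edge: "\<not> c {v, w}" if "v \<in> S" "w \<in> V - S" for v w
  proof
    assume "c {v, w}"
    then have "(v, w) \<in> adjacency V c" using that assms by (auto simp: adjacency_def vertex_pairs_doubleton_iff)
    then show False using that u(2) by (auto simp: mem_cluster_iff intro: rtrancl_into_rtrancl)
  qed
  have "cluster S c v = S" if v: "v \<in> S" for v
  proof (rule antisym[OF cluster_subset[OF v]])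
    have "cluster V c v \<subseteq> cluster S c v"
    proof (rule cluster_closed)
      fix a b assume a: "a \<in> cluster S c v" and ab: "(a, b) \<in> adjacency V c"
      have "a \<in> S" using a cluster_subset[OF v] by auto
      then have "b \<in> S" using ab no_edge by (auto simp: adjacency_def vertex_pairs_doubleton_iff)
      then have "(a, b) \<in> adjacency S c"
        using ab \<open>a \<in> S\<close> by (auto simp: adjacency_def vertex_pairs_doubleton_iff)
      then show "b \<in> cluster S c v" using a by (auto simp: mem_cluster_iff intro: rtrancl_into_rtrancl)
    qed simp
    then show "S \<subseteq> cluster S c v" using v u cluster_eqI by metis
  qed
  moreover have "u \<in> S" using u by simp
  ultimately show "spans S c \<and> (\<forall>v\<in>S. \<forall>w\<in>V - S. \<not> c {v, w})"
    using no_edge by (auto simp: spans_def)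
next
  assume S: "spans S c \<and> (\<forall>v\<in>S. \<forall>w\<in>V - S. \<not> c {v, w})"
  then obtain v where v: "v \<in> S" "cluster S c v = S" by (auto simp: spans_def)
  have "cluster V c v \<subseteq> S"
    by (rule cluster_closed) (use S v in \<open>auto simp: adjacency_def vertex_pairs_doubleton_iff\<close>)
  moreover have "cluster S c v \<subseteq> cluster V c v"
    using assms by (intro cluster_mono) (auto simp: adjacency_def vertex_pairs_doubleton_iff)
  ultimately have "cluster V c v = S" using v by auto
  then show "S \<in> cluster V c ` V" using v assms by auto
qed

section \<open>Independent edges\<close>

text \<open>
  The mean of \<open>F\<close> for a random subset of \<open>S\<close> that contains each \<open>e\<close> with probability \<open>a e\<close>,
  independently. As a finite sum it is a polynomial in the probabilities, so that measurability in the
  positions of the vertices is evident.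
\<close>

definition bernoulli_expectation :: "('e \<Rightarrow> real) \<Rightarrow> 'e set \<Rightarrow> ('e set \<Rightarrow> real) \<Rightarrow> real" where
  "bernoulli_expectation a S F = (\<Sum>E\<in>Pow S. (\<Prod>e\<in>E. a e) * (\<Prod>e\<in>S - E. 1 - a e) * F E)"

lemma bernoulli_expectation_empty [simp]: "bernoulli_expectation a {} F = F {}"
  by (simp add: bernoulli_expectation_def)

lemma bernoulli_expectation_insert:
  assumes "finite S" "e \<notin> S"
  shows "bernoulli_expectation a (insert e S) F
    = a e * bernoulli_expectation a S (\<lambda>E. F (insert e E)) + (1 - a e) * bernoulli_expectation a S F"
proof -
  let ?w = "\<lambda>T E. (\<Prod>e\<in>E. a e) * (\<Prod>e\<in>T - E. 1 - a e)"
  have inj: "inj_on (insert e) (Pow S)" using assms(2) by (auto simp: inj_on_def)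
  have "bernoulli_expectation a (insert e S) F
     = (\<Sum>E\<in>Pow S. ?w (insert e S) E * F E) + (\<Sum>E\<in>insert e ` Pow S. ?w (insert e S) E * F E)"
    unfolding bernoulli_expectation_def Pow_insert using assms by (intro sum.union_disjoint) auto
  also have "(\<Sum>E\<in>insert e ` Pow S. ?w (insert e S) E * F E)
     = (\<Sum>E\<in>Pow S. ?w (insert e S) (insert e E) * F (insert e E))"
    by (subst sum.reindex[OF inj]) simp
  also have "\<dots> = (\<Sum>E\<in>Pow S. a e * (?w S E * F (insert e E)))"
  proof (intro sum.cong refl)
    fix E assume "E \<in> Pow S"
    then have "finite E" "e \<notin> E" using assms finite_subset by auto
    moreover have "insert e S - insert e E = S - E" using assms(2) by auto
    ultimately show "?w (insert e S) (insert e E) * F (insert e E) = a e * (?w S E * F (insert e E))"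
      by simp
  qed
  also have "(\<Sum>E\<in>Pow S. ?w (insert e S) E * F E) = (\<Sum>E\<in>Pow S. (1 - a e) * (?w S E * F E))"
  proof (intro sum.cong refl)
    fix E assume "E \<in> Pow S"
    then have "insert e S - E = insert e (S - E)" "e \<notin> S - E" using assms(2) by auto
    then show "?w (insert e S) E * F E = (1 - a e) * (?w S E * F E)" using assms(1) by simp
  qed
  finally show ?thesis by (simp add: bernoulli_expectation_def sum_distrib_left)
qed

lemma bernoulli_expectation_cong:
  assumes "S = T" "\<And>e. e \<in> S \<Longrightarrow> a e = b e" "\<And>E. E \<subseteq> S \<Longrightarrow> F E = G E"
  shows "bernoulli_expectation a S F = bernoulli_expectation b T G"
  unfolding bernoulli_expectation_def using assms
  by (auto intro!: sum.cong arg_cong2[of _ _ _ _ "(*)"] prod.cong)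

lemma bernoulli_expectation_mono:
  assumes "\<And>e. e \<in> S \<Longrightarrow> 0 \<le> a e \<and> a e \<le> 1" "\<And>E. E \<subseteq> S \<Longrightarrow> F E \<le> G E"
  shows "bernoulli_expectation a S F \<le> bernoulli_expectation a S G"
  unfolding bernoulli_expectation_def using assms
  by (intro sum_mono mult_left_mono mult_nonneg_nonneg prod_nonneg) auto

lemma bernoulli_expectation_add:
  "bernoulli_expectation a S (\<lambda>E. F E + G E) = bernoulli_expectation a S F + bernoulli_expectation a S G"
  by (simp add: bernoulli_expectation_def sum.distrib distrib_left)

lemma bernoulli_expectation_sum:
  "bernoulli_expectation a S (\<lambda>E. \<Sum>i\<in>I. F i E) = (\<Sum>i\<in>I. bernoulli_expectation a S (F i))"
  unfolding bernoulli_expectation_def sum_distrib_left by (rule sum.swap)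

lemma bernoulli_expectation_cmult:
  "bernoulli_expectation a S (\<lambda>E. c * F E) = c * bernoulli_expectation a S F"
  by (simp add: bernoulli_expectation_def sum_distrib_left mult_ac)

lemma bernoulli_expectation_multc:
  "bernoulli_expectation a S (\<lambda>E. F E * c) = bernoulli_expectation a S F * c"
  by (simp add: bernoulli_expectation_def sum_distrib_right mult.assoc)

lemma bernoulli_expectation_union:
  assumes "finite T" "finite S" "S \<inter> T = {}"
  shows "bernoulli_expectation a (S \<union> T) F
     = bernoulli_expectation a S (\<lambda>E. bernoulli_expectation a T (\<lambda>E'. F (E \<union> E')))"
  using assms
proof (induction T arbitrary: F rule: finite_induct)
  case (insert e T)
  have "bernoulli_expectation a (S \<union> insert e T) F = bernoulli_expectation a (insert e (S \<union> T)) F" by simp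
  also have "\<dots> = bernoulli_expectation a S (\<lambda>E. bernoulli_expectation a (insert e T) (\<lambda>E'. F (E \<union> E')))"
    using insert by (simp add: bernoulli_expectation_insert bernoulli_expectation_add bernoulli_expectation_cmult)
  finally show ?case .
qed simp

lemma bernoulli_expectation_const: "finite S \<Longrightarrow> bernoulli_expectation a S (\<lambda>E. c) = c"
  by (induction S rule: finite_induct) (auto simp: bernoulli_expectation_insert algebra_simps)

lemma bernoulli_expectation_marginal:
  assumes "finite S" "T \<subseteq> S" "\<And>E. E \<subseteq> S \<Longrightarrow> F E = F (E \<inter> T)"
  shows "bernoulli_expectation a S F = bernoulli_expectation a T F"
proof -
  have T: "finite T" using assms finite_subset by auto
  have "bernoulli_expectation a S F = bernoulli_expectation a (T \<union> (S - T)) F"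
    using assms by (intro bernoulli_expectation_cong) auto
  also have "\<dots> = bernoulli_expectation a T (\<lambda>E. bernoulli_expectation a (S - T) (\<lambda>E'. F (E \<union> E')))"
    using assms T by (intro bernoulli_expectation_union) auto
  also have "\<dots> = bernoulli_expectation a T (\<lambda>E. bernoulli_expectation a (S - T) (\<lambda>E'. F E))"
  proof (intro bernoulli_expectation_cong refl)
    fix E E' assume "E \<subseteq> T" "E' \<subseteq> S - T"
    then have "(E \<union> E') \<inter> T = E" "E \<union> E' \<subseteq> S" using assms(2) by auto
    then show "F (E \<union> E') = F E" using assms(3)[of "E \<union> E'"] by simp
  qed
  finally show ?thesis using assms by (simp add: bernoulli_expectation_const)
qed

lemma bernoulli_expectation_none:
  assumes "finite S" shows "bernoulli_expectation a S (\<lambda>E. of_bool (E = {})) = (\<Prod>e\<in>S. 1 - a e)"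
  using assms
proof (induction S rule: finite_induct)
  case (insert e S)
  then show ?case by (simp add: bernoulli_expectation_insert bernoulli_expectation_const)
qed simp

lemma bernoulli_expectation_mem:
  assumes "finite S" "e \<in> S" shows "bernoulli_expectation a S (\<lambda>E. of_bool (e \<in> E)) = a e"
proof -
  have "bernoulli_expectation a S (\<lambda>E. of_bool (e \<in> E)) = bernoulli_expectation a {e} (\<lambda>E. of_bool (e \<in> E))"
    using assms by (intro bernoulli_expectation_marginal) auto
  also have "\<dots> = a e" by (subst bernoulli_expectation_insert) auto
  finally show ?thesis .
qed

text \<open>
  The event does not depend on the edges within \<open>V - S\<close>, and it factorizes over the edges within \<open>S\<close>
  and the set \<open>X\<close> of edges between \<open>S\<close> and \<open>V - S\<close>.
\<close>

lemma bernoulli_expectation_mem_clusters: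
  assumes V: "finite V" and S: "S \<subseteq> V"
  shows "bernoulli_expectation a (vertex_pairs V) (\<lambda>E. of_bool (S \<in> cluster V (\<lambda>e. e \<in> E) ` V))
     = bernoulli_expectation a (vertex_pairs S) (\<lambda>E. of_bool (spans S (\<lambda>e. e \<in> E)))
       * (\<Prod>w\<in>V - S. \<Prod>v\<in>S. 1 - a {v, w})"
proof -
  define X where "X = (\<lambda>(w, v). {v, w}) ` ((V - S) \<times> S)"
  have fin: "finite S" "finite (vertex_pairs S)" "finite X" "finite (vertex_pairs (V - S))"
    using V finite_subset[OF S V] by (simp_all add: X_def)
  have disj: "vertex_pairs S \<inter> X = {}" by (auto simp: X_def vertex_pairs_def)
  have XV: "X \<subseteq> vertex_pairs V" using S by (auto simp: X_def vertex_pairs_doubleton_iff)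
  have SV: "vertex_pairs S \<subseteq> vertex_pairs V" using S by (rule vertex_pairs_mono)
  have iff: "S \<in> cluster V (\<lambda>e. e \<in> E) ` V \<longleftrightarrow> spans S (\<lambda>e. e \<in> E) \<and> E \<inter> X = {}" for E
    unfolding mem_clusters_iff[OF S] by (auto simp: X_def)
  have spans_cong: "spans S (\<lambda>e. e \<in> E) = spans S (\<lambda>e. e \<in> E')" if "E \<inter> vertex_pairs S = E' \<inter> vertex_pairs S" for E E'
  proof -
    have "cluster S (\<lambda>e. e \<in> E) v = cluster S (\<lambda>e. e \<in> E') v" for v
      using that by (intro cluster_cong) auto
    then show ?thesis by (simp add: spans_def)
  qed
  have "bernoulli_expectation a (vertex_pairs V) (\<lambda>E. of_bool (S \<in> cluster V (\<lambda>e. e \<in> E) ` V))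
     = bernoulli_expectation a (vertex_pairs S \<union> X) (\<lambda>E. of_bool (S \<in> cluster V (\<lambda>e. e \<in> E) ` V))"
  proof (rule bernoulli_expectation_marginal)
    show "of_bool (S \<in> cluster V (\<lambda>e. e \<in> E) ` V)
        = (of_bool (S \<in> cluster V (\<lambda>e. e \<in> E \<inter> (vertex_pairs S \<union> X)) ` V) :: real)" for E
      unfolding iff using spans_cong[of E "E \<inter> (vertex_pairs S \<union> X)"] by auto
  qed (use V SV XV in auto)
  also have "\<dots> = bernoulli_expectation a (vertex_pairs S) (\<lambda>E. bernoulli_expectation a X
      (\<lambda>E'. of_bool (spans S (\<lambda>e. e \<in> E)) * of_bool (E' = {})))"
  proof (subst bernoulli_expectation_union[OF fin(3,2) disj], intro bernoulli_expectation_cong refl)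
    fix E E' assume E: "E \<subseteq> vertex_pairs S" "E' \<subseteq> X"
    have "spans S (\<lambda>e. e \<in> E \<union> E') = spans S (\<lambda>e. e \<in> E)"
      by (rule spans_cong) (use E disj in auto)
    moreover have "(E \<union> E') \<inter> X = E'" using E disj by auto
    ultimately show "of_bool (S \<in> cluster V (\<lambda>e. e \<in> E \<union> E') ` V) = (of_bool (spans S (\<lambda>e. e \<in> E)) * of_bool (E' = {}) :: real)"
      unfolding iff by auto
  qed
  also have "\<dots> = bernoulli_expectation a (vertex_pairs S) (\<lambda>E. of_bool (spans S (\<lambda>e. e \<in> E))) * (\<Prod>e\<in>X. 1 - a e)"
    using fin by (simp add: bernoulli_expectation_cmult bernoulli_expectation_multc bernoulli_expectation_none
)
  also have "(\<Prod>e\<in>X. 1 - a e) = (\<Prod>(w, v)\<in>(V - S) \<times> S. 1 - a {v, w})"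
    unfolding X_def by (subst prod.reindex) (auto simp: inj_on_def doubleton_eq_iff case_prod_beta)
  also have "\<dots> = (\<Prod>w\<in>V - S. \<Prod>v\<in>S. 1 - a {v, w})"
    by (rule prod.cartesian_product[symmetric])
  finally show ?thesis .
qed

lemma bernoulli_expectation_cluster_functional:
  fixes g :: "nat \<Rightarrow> real"
  assumes V: "finite V"
  shows "bernoulli_expectation a (vertex_pairs V) (\<lambda>E. \<Sum>S\<in>cluster V (\<lambda>e. e \<in> E) ` V. g (card S))
    = (\<Sum>S\<in>Pow V. g (card S) * (bernoulli_expectation a (vertex_pairs S) (\<lambda>E. of_bool (spans S (\<lambda>e. e \<in> E)))
       * (\<Prod>w\<in>V - S. \<Prod>v\<in>S. 1 - a {v, w})))"
proof -
  have "(\<Sum>S\<in>cluster V c ` V. g (card S)) = (\<Sum>S\<in>Pow V. g (card S) * of_bool (S \<in> cluster V c ` V))" for c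
  proof -
    have "cluster V c ` V \<subseteq> Pow V" using cluster_subset by fastforce
    then show ?thesis using V by (intro sum.mono_neutral_cong_left) auto
  qed
  then have "bernoulli_expectation a (vertex_pairs V) (\<lambda>E. \<Sum>S\<in>cluster V (\<lambda>e. e \<in> E) ` V. g (card S))
     = (\<Sum>S\<in>Pow V. g (card S) * bernoulli_expectation a (vertex_pairs V) (\<lambda>E. of_bool (S \<in> cluster V (\<lambda>e. e \<in> E) ` V)))"
    by (simp add: bernoulli_expectation_sum bernoulli_expectation_cmult)
  also have "\<dots> = (\<Sum>S\<in>Pow V. g (card S) * (bernoulli_expectation a (vertex_pairs S) (\<lambda>E. of_bool (spans S (\<lambda>e. e \<in> E)))
       * (\<Prod>w\<in>V - S. \<Prod>v\<in>S. 1 - a {v, w})))"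
    using bernoulli_expectation_mem_clusters[OF V] by (intro sum.cong) auto
  finally show ?thesis .
qed

section \<open>Relabelling the vertices\<close>

lemma vertex_pairs_image: "inj_on \<pi> V \<Longrightarrow> vertex_pairs (\<pi> ` V) = (`) \<pi> ` vertex_pairs V"
  unfolding vertex_pairs_def
  by (auto simp: subset_image_iff card_image inj_on_subset image_iff)

lemma inj_on_image_vertex_pairs: "inj_on \<pi> V \<Longrightarrow> inj_on ((`) \<pi>) (vertex_pairs V)"
  by (rule inj_on_subset[OF inj_on_image_Pow]) (auto simp: vertex_pairs_def)

lemma cluster_image:
  assumes \<pi>: "inj_on \<pi> V" and v: "v \<in> V"
  shows "cluster (\<pi> ` V) c (\<pi> v) = \<pi> ` cluster V (\<lambda>e. c (\<pi> ` e)) v"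
proof (rule antisym)
  let ?C = "cluster V (\<lambda>e. c (\<pi> ` e)) v"
  show "cluster (\<pi> ` V) c (\<pi> v) \<subseteq> \<pi> ` ?C"
  proof (rule cluster_closed)
    fix x y assume "x \<in> \<pi> ` ?C" and xy: "(x, y) \<in> adjacency (\<pi> ` V) c"
    then obtain a where a: "a \<in> ?C" "x = \<pi> a" by auto
    have aV: "a \<in> V" using a cluster_subset[OF v] by auto
    obtain b where b: "b \<in> V" "y = \<pi> b" using xy by (auto simp: adjacency_def vertex_pairs_doubleton_iff)
    have "(a, b) \<in> adjacency V (\<lambda>e. c (\<pi> ` e))"
      using xy a b aV by (auto simp: adjacency_def vertex_pairs_doubleton_iff)
    then show "y \<in> \<pi> ` ?C" using a b by (auto simp: mem_cluster_iff intro: rtrancl_into_rtrancl)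
  qed simp
  have "?C \<subseteq> {a \<in> V. \<pi> a \<in> cluster (\<pi> ` V) c (\<pi> v)}"
  proof (rule cluster_closed)
    fix a b assume a: "a \<in> {a \<in> V. \<pi> a \<in> cluster (\<pi> ` V) c (\<pi> v)}" and ab: "(a, b) \<in> adjacency V (\<lambda>e. c (\<pi> ` e))"
    have "b \<in> V" "(\<pi> a, \<pi> b) \<in> adjacency (\<pi> ` V) c"
      using ab \<pi> by (auto simp: adjacency_def vertex_pairs_doubleton_iff dest: inj_onD)
    then show "b \<in> {a \<in> V. \<pi> a \<in> cluster (\<pi> ` V) c (\<pi> v)}"
      using a by (auto simp: mem_cluster_iff intro: rtrancl_into_rtrancl)
  qed (use v in simp)
  then show "\<pi> ` ?C \<subseteq> cluster (\<pi> ` V) c (\<pi> v)" by auto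
qed

lemma cluster_image_edges:
  assumes \<pi>: "inj_on \<pi> V" and v: "v \<in> V" and E: "E \<subseteq> vertex_pairs V"
  shows "cluster (\<pi> ` V) (\<lambda>e. e \<in> (`) \<pi> ` E) (\<pi> v) = \<pi> ` cluster V (\<lambda>e. e \<in> E) v"
proof -
  have "cluster V (\<lambda>e. \<pi> ` e \<in> (`) \<pi> ` E) v = cluster V (\<lambda>e. e \<in> E) v"
    using inj_on_image_mem_iff[OF inj_on_image_vertex_pairs[OF \<pi>] _ E] by (intro cluster_cong) auto
  then show ?thesis by (simp add: cluster_image[OF \<pi> v])
qed

lemma card_cluster_image_edges:
  assumes \<pi>: "inj_on \<pi> V" and v: "v \<in> V" and E: "E \<subseteq> vertex_pairs V"
  shows "card (cluster (\<pi> ` V) (\<lambda>e. e \<in> (`) \<pi> ` E) (\<pi> v)) = card (cluster V (\<lambda>e. e \<in> E) v)"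
  unfolding cluster_image_edges[OF assms]
  using inj_on_subset[OF \<pi> cluster_subset[OF v]] by (rule card_image)

lemma num_clusters_image_edges:
  assumes \<pi>: "inj_on \<pi> V" and E: "E \<subseteq> vertex_pairs V"
  shows "num_clusters (\<pi> ` V) (\<lambda>e. e \<in> (`) \<pi> ` E) = num_clusters V (\<lambda>e. e \<in> E)"
proof -
  have "cluster (\<pi> ` V) (\<lambda>e. e \<in> (`) \<pi> ` E) ` \<pi> ` V = (`) \<pi> ` cluster V (\<lambda>e. e \<in> E) ` V"
    unfolding image_image using cluster_image_edges[OF \<pi> _ E] by (intro image_cong) auto
  moreover have "inj_on ((`) \<pi>) (cluster V (\<lambda>e. e \<in> E) ` V)"
    by (rule inj_on_subset[OF inj_on_image_Pow[OF \<pi>]]) (use cluster_subset in fastforce)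
  ultimately show ?thesis by (simp add: num_clusters_def card_image)
qed

lemma spans_image_edges:
  assumes \<pi>: "inj_on \<pi> V" and E: "E \<subseteq> vertex_pairs V"
  shows "spans (\<pi> ` V) (\<lambda>e. e \<in> (`) \<pi> ` E) \<longleftrightarrow> spans V (\<lambda>e. e \<in> E)"
proof -
  have "\<pi> ` cluster V (\<lambda>e. e \<in> E) v = \<pi> ` V \<longleftrightarrow> cluster V (\<lambda>e. e \<in> E) v = V" if "v \<in> V" for v
    using inj_on_image_eq_iff[OF \<pi> cluster_subset[OF that] order_refl] .
  then show ?thesis using cluster_image_edges[OF \<pi> _ E] by (simp add: spans_def)
qed

lemma bernoulli_expectation_image:
  assumes "inj_on f S"
  shows "bernoulli_expectation a (f ` S) F = bernoulli_expectation (\<lambda>e. a (f e)) S (\<lambda>E. F (f ` E))"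
proof -
  have "bernoulli_expectation a (f ` S) F
      = (\<Sum>E\<in>Pow S. (\<Prod>e\<in>f ` E. a e) * (\<Prod>e\<in>f ` S - f ` E. 1 - a e) * F (f ` E))"
    unfolding bernoulli_expectation_def image_Pow_surj[OF refl, symmetric]
    by (subst sum.reindex[OF inj_on_image_Pow[OF assms]]) simp
  also have "\<dots> = bernoulli_expectation (\<lambda>e. a (f e)) S (\<lambda>E. F (f ` E))"
    unfolding bernoulli_expectation_def
  proof (intro sum.cong refl)
    fix E assume "E \<in> Pow S"
    then have "inj_on f E" "inj_on f (S - E)" "f ` S - f ` E = f ` (S - E)"
      using inj_on_subset[OF assms] inj_on_image_set_diff[OF assms, of S E] by auto
    then show "(\<Prod>e\<in>f ` E. a e) * (\<Prod>e\<in>f ` S - f ` E. 1 - a e) * F (f ` E)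
       = (\<Prod>e\<in>E. a (f e)) * (\<Prod>e\<in>S - E. 1 - a (f e)) * F (f ` E)"
      by (simp add: prod.reindex)
  qed
  finally show ?thesis .
qed

text \<open>
  The graph lives on the indices, and \<open>z\<close> assigns a point to each index. This keeps the set
  of possible edges independent of the positions and gives a meaning to coinciding points.
\<close>

definition edge_prob :: "('x \<Rightarrow> 'x \<Rightarrow> real) \<Rightarrow> ('i \<Rightarrow> 'x) \<Rightarrow> 'i set \<Rightarrow> real" where
  "edge_prob \<phi> z = pair_prob (\<lambda>i j. \<phi> (z i) (z j))"

abbreviation graph_mean ::
    "('x \<Rightarrow> 'x \<Rightarrow> real) \<Rightarrow> ('i \<Rightarrow> 'x) \<Rightarrow> 'i set \<Rightarrow> ('i set set \<Rightarrow> real) \<Rightarrow> real" where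
  "graph_mean \<phi> z V F \<equiv> bernoulli_expectation (edge_prob \<phi> z) (vertex_pairs V) F"

lemma edge_prob_doubleton:
  assumes "\<And>v w. \<phi> v w = \<phi> w v" and "i \<noteq> j" shows "edge_prob \<phi> z {i, j} = \<phi> (z i) (z j)"
  unfolding edge_prob_def using assms by (intro pair_prob_eq) auto

lemma edge_prob_image:
  assumes sym: "\<And>v w. \<phi> v w = \<phi> w v" and \<pi>: "inj_on \<pi> V" and e: "e \<in> vertex_pairs V"
  shows "edge_prob \<phi> z (\<pi> ` e) = edge_prob \<phi> (\<lambda>i. z (\<pi> i)) e"
proof -
  obtain i j where "e = {i, j}" "i \<in> V" "j \<in> V" "i \<noteq> j" using e by (rule vertex_pairsE)
  moreover from this have "\<pi> i \<noteq> \<pi> j" using \<pi> by (auto dest: inj_onD)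
  ultimately show ?thesis by (simp add: edge_prob_doubleton[of \<phi>, OF sym])
qed

lemma bernoulli_expectation_relabel:
  assumes sym: "\<And>v w. \<phi> v w = \<phi> w v" and \<pi>: "inj_on \<pi> V"
    and F: "\<And>E. E \<subseteq> vertex_pairs V \<Longrightarrow> F ((`) \<pi> ` E) = G E"
  shows "graph_mean \<phi> z (\<pi> ` V) F
     = graph_mean \<phi> (\<lambda>i. z (\<pi> i)) V G"
  unfolding vertex_pairs_image[OF \<pi>] bernoulli_expectation_image[OF inj_on_image_vertex_pairs[OF \<pi>]]
  using edge_prob_image[of \<phi>, OF sym \<pi>] F by (intro bernoulli_expectation_cong) auto

text \<open>
  The vertex with index \<open>k\<close> is the root; the \<open>k\<close> points before it are the points of the process.
\<close>

definition inverse_root_cluster :: "('x \<Rightarrow> 'x \<Rightarrow> real) \<Rightarrow> nat \<Rightarrow> (nat \<Rightarrow> 'x) \<Rightarrow> real" where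
  "inverse_root_cluster \<phi> k x = graph_mean \<phi> x {..<Suc k}
     (\<lambda>E. 1 / real (card (cluster {..<Suc k} (\<lambda>e. e \<in> E) k)))"

lemma (in product_sigma_finite) distr_PiM_relabel:
  assumes J: "finite J" and \<pi>: "bij_betw \<pi> J I" and M: "\<And>j. j \<in> J \<Longrightarrow> M (\<pi> j) = M j"
  shows "distr (PiM I M) (PiM J M) (\<lambda>x. \<lambda>j\<in>J. x (\<pi> j)) = PiM J M"
proof (rule PiM_eqI[OF J])
  have meas: "(\<lambda>x. \<lambda>j\<in>J. x (\<pi> j)) \<in> PiM I M \<rightarrow>\<^sub>M PiM J M"
  proof (rule measurable_restrict)
    fix j assume "j \<in> J"
    then show "(\<lambda>x. x (\<pi> j)) \<in> PiM I M \<rightarrow>\<^sub>M M j"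
      using measurable_component_singleton[of "\<pi> j" I M] bij_betwE[OF \<pi>] M by auto
  qed
  have I: "finite I" "I = \<pi> ` J" using J \<pi> by (auto simp: bij_betw_def)
  fix A assume A: "\<And>j. j \<in> J \<Longrightarrow> A j \<in> sets (M j)"
  define B where "B i = A (inv_into J \<pi> i)" for i
  have B: "B (\<pi> j) = A j" if "j \<in> J" for j
    using that \<pi> by (simp add: B_def bij_betw_def inv_into_f_f)
  have "(\<lambda>x. \<lambda>j\<in>J. x (\<pi> j)) -` Pi\<^sub>E J A \<inter> space (PiM I M) = Pi\<^sub>E I B"
  proof (intro set_eqI iffI)
    fix x assume "x \<in> Pi\<^sub>E I B"
    then show "x \<in> (\<lambda>x. \<lambda>j\<in>J. x (\<pi> j)) -` Pi\<^sub>E J A \<inter> space (PiM I M)"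
      using B A[THEN sets.sets_into_space] M unfolding I(2) by (fastforce simp: space_PiM PiE_iff)
  next
    fix x assume "x \<in> (\<lambda>x. \<lambda>j\<in>J. x (\<pi> j)) -` Pi\<^sub>E J A \<inter> space (PiM I M)"
    then show "x \<in> Pi\<^sub>E I B" using B unfolding I(2) by (auto simp: space_PiM PiE_iff)
  qed
  then have "emeasure (distr (PiM I M) (PiM J M) (\<lambda>x. \<lambda>j\<in>J. x (\<pi> j))) (Pi\<^sub>E J A) = emeasure (PiM I M) (Pi\<^sub>E I B)"
    using meas J A by (subst emeasure_distr) (auto intro!: sets_PiM_I_finite)
  also have "\<dots> = (\<Prod>i\<in>I. emeasure (M i) (B i))"
    using I B A M by (intro emeasure_PiM) auto
  also have "\<dots> = (\<Prod>j\<in>J. emeasure (M j) (A j))"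
    using M B by (subst prod.reindex_bij_betw[OF \<pi>, symmetric]) (auto intro!: prod.cong)
  finally show "emeasure (distr (PiM I M) (PiM J M) (\<lambda>x. \<lambda>j\<in>J. x (\<pi> j))) (Pi\<^sub>E J A) = (\<Prod>j\<in>J. emeasure (M j) (A j))" .
qed simp

section \<open>Random graphs in a window of finite mass\<close>

text \<open>
  The finite measure \<open>\<mu>\<close> is the intensity measure in a window for unit intensity. It is not normalized: an
  integral over its \<open>k\<close>-th power, multiplied by \<open>exp (- mass * t) * t ^ k / fact k\<close>, is the contribution of
  \<open>k\<close> points to an expectation under a Poisson process with intensity measure \<open>t\<close> times \<open>\<mu>\<close>.
\<close>

locale finite_connection_model = finite_measure \<mu> for \<mu> :: "'x measure" +
  fixes \<phi> :: "'x \<Rightarrow> 'x \<Rightarrow> real"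
  assumes measurable_connection [measurable]: "(\<lambda>(v, w). \<phi> v w) \<in> borel_measurable (\<mu> \<Otimes>\<^sub>M \<mu>)"
    and connection_bounds: "\<And>v w. 0 \<le> \<phi> v w \<and> \<phi> v w \<le> 1"
    and connection_sym: "\<And>v w. \<phi> v w = \<phi> w v"
begin

abbreviation power_measure :: "nat set \<Rightarrow> (nat \<Rightarrow> 'x) measure" where
  "power_measure I \<equiv> (\<Pi>\<^sub>M i\<in>I. \<mu>)"

abbreviation mass :: real where "mass \<equiv> measure \<mu> (space \<mu>)"

sublocale product_sigma_finite "\<lambda>_::nat. \<mu>" by standard

lemma connection_measurable [measurable (raw)]:
  assumes "f \<in> M \<rightarrow>\<^sub>M \<mu>" "g \<in> M \<rightarrow>\<^sub>M \<mu>"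
  shows "(\<lambda>x. \<phi> (f x) (g x)) \<in> borel_measurable M"
  using measurable_compose[OF measurable_Pair[OF assms] measurable_connection] by simp

lemma edge_prob_bounds:
  assumes "e \<in> vertex_pairs V" shows "0 \<le> edge_prob \<phi> z e \<and> edge_prob \<phi> z e \<le> 1"
  using assms by (rule vertex_pairsE) (simp add: edge_prob_doubleton[of \<phi>, OF connection_sym] connection_bounds)

lemma measurable_edge_prob:
  assumes "e \<in> vertex_pairs I" shows "(\<lambda>x. edge_prob \<phi> x e) \<in> borel_measurable (power_measure I)"
proof -
  from assms obtain i j where "e = {i, j}" and [measurable]: "i \<in> I" "j \<in> I" and "i \<noteq> j" by (rule vertex_pairsE)
  then show ?thesis by (simp add: edge_prob_doubleton[of \<phi>, OF connection_sym])
qed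

lemma measurable_bernoulli_expectation:
  assumes "V \<subseteq> I"
  shows "(\<lambda>x. graph_mean \<phi> x V F) \<in> borel_measurable (power_measure I)"
proof -
  have "(\<lambda>x. edge_prob \<phi> x e) \<in> borel_measurable (power_measure I)" if "e \<in> vertex_pairs V" for e
    using measurable_edge_prob[of e I] vertex_pairs_mono[OF assms] that by auto
  then show ?thesis
    unfolding bernoulli_expectation_def
    by (intro borel_measurable_sum borel_measurable_times borel_measurable_prod borel_measurable_diff
        borel_measurable_const) auto
qed

lemma bernoulli_expectation_edge_prob_cong:
  assumes "\<And>i. i \<in> V \<Longrightarrow> x i = y i"
  shows "graph_mean \<phi> x V F
       = graph_mean \<phi> y V F"
proof (intro bernoulli_expectation_cong refl)
  fix e assume "e \<in> vertex_pairs V"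
  then obtain i j where "e = {i, j}" "i \<in> V" "j \<in> V" "i \<noteq> j" by (rule vertex_pairsE)
  then show "edge_prob \<phi> x e = edge_prob \<phi> y e"
    using assms by (simp add: edge_prob_doubleton[of \<phi>, OF connection_sym])
qed

lemma bernoulli_expectation_edge_prob_nonneg:
  assumes "finite V" "\<And>E. E \<subseteq> vertex_pairs V \<Longrightarrow> 0 \<le> F E"
  shows "0 \<le> graph_mean \<phi> x V F"
proof -
  have "graph_mean \<phi> x V (\<lambda>_. 0)
      \<le> graph_mean \<phi> x V F"
    using edge_prob_bounds assms(2) by (rule bernoulli_expectation_mono)
  then show ?thesis using assms(1) by (simp add: bernoulli_expectation_const)
qed

lemma nn_integral_power_measure_relabel:
  assumes J: "finite J" and \<pi>: "bij_betw \<pi> J I" and f: "f \<in> borel_measurable (power_measure J)"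
  shows "(\<integral>\<^sup>+x. f x \<partial>power_measure J) = (\<integral>\<^sup>+x. f (\<lambda>j\<in>J. x (\<pi> j)) \<partial>power_measure I)"
proof -
  have meas: "(\<lambda>x. \<lambda>j\<in>J. x (\<pi> j)) \<in> power_measure I \<rightarrow>\<^sub>M power_measure J"
  proof (rule measurable_restrict)
    fix j assume "j \<in> J"
    then show "(\<lambda>x. x (\<pi> j)) \<in> power_measure I \<rightarrow>\<^sub>M \<mu>"
      using measurable_component_singleton[of "\<pi> j" I "\<lambda>_. \<mu>"] bij_betwE[OF \<pi>] by auto
  qed
  have "(\<integral>\<^sup>+x. f x \<partial>power_measure J)
      = (\<integral>\<^sup>+x. f x \<partial>distr (power_measure I) (power_measure J) (\<lambda>x. \<lambda>j\<in>J. x (\<pi> j)))"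
    using distr_PiM_relabel[OF J \<pi>] by simp
  also have "\<dots> = (\<integral>\<^sup>+x. f (\<lambda>j\<in>J. x (\<pi> j)) \<partial>power_measure I)"
    using f by (simp add: nn_integral_distr[OF meas])
  finally show ?thesis .
qed

lemma nn_integral_bernoulli_relabel:
  assumes J: "finite J" and \<pi>: "bij_betw \<pi> J I"
    and F: "\<And>E. E \<subseteq> vertex_pairs J \<Longrightarrow> F ((`) \<pi> ` E) = G E"
  shows "(\<integral>\<^sup>+x. ennreal (graph_mean \<phi> x I F) \<partial>power_measure I)
       = (\<integral>\<^sup>+x. ennreal (graph_mean \<phi> x J G) \<partial>power_measure J)"
proof -
  have \<pi>': "inj_on \<pi> J" "I = \<pi> ` J" using \<pi> by (auto simp: bij_betw_def)
  have "(\<integral>\<^sup>+x. ennreal (graph_mean \<phi> x J G) \<partial>power_measure J)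
    = (\<integral>\<^sup>+x. ennreal (graph_mean \<phi> (\<lambda>j\<in>J. x (\<pi> j)) J G) \<partial>power_measure I)"
    by (intro nn_integral_power_measure_relabel[OF J \<pi>] measurable_compose[OF measurable_bernoulli_expectation] measurable_ennreal) simp
  also have "\<dots> = (\<integral>\<^sup>+x. ennreal (graph_mean \<phi> x I F) \<partial>power_measure I)"
  proof (intro nn_integral_cong arg_cong[of _ _ ennreal])
    fix x
    have "graph_mean \<phi> (\<lambda>j\<in>J. x (\<pi> j)) J G
        = graph_mean \<phi> (\<lambda>j. x (\<pi> j)) J G"
      by (intro bernoulli_expectation_edge_prob_cong) simp
    also have "\<dots> = graph_mean \<phi> x I F"
      unfolding \<pi>'(2) using bernoulli_expectation_relabel[of \<phi> \<pi> J F G x, OF connection_sym \<pi>'(1) F] by simp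
    finally show "graph_mean \<phi> (\<lambda>j\<in>J. x (\<pi> j)) J G
        = graph_mean \<phi> x I F" .
  qed
  finally show ?thesis by simp
qed

lemma finite_measure_power_measure: "finite J \<Longrightarrow> finite_measure (power_measure J)"
  by (intro finite_measureI) (simp add: space_PiM emeasure_PiM emeasure_eq_measure ennreal_power)

lemma emeasure_power_measure_space: "finite J \<Longrightarrow> emeasure (power_measure J) (space (power_measure J)) = ennreal (mass ^ card J)"
  by (simp add: space_PiM emeasure_PiM emeasure_eq_measure ennreal_power)

lemma nn_integral_power_measure_forget:
  assumes I: "finite I" "i \<notin> I" and f: "f \<in> borel_measurable (power_measure I)"
    and f': "f \<in> borel_measurable (power_measure (insert i I))"
    and cong: "\<And>x y. f (x(i := y)) = f x"
  shows "(\<integral>\<^sup>+x. f x \<partial>power_measure (insert i I)) = ennreal mass * (\<integral>\<^sup>+x. f x \<partial>power_measure I)"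
proof -
  have "(\<integral>\<^sup>+x. f x \<partial>power_measure (insert i I)) = (\<integral>\<^sup>+x. \<integral>\<^sup>+y. f (x(i := y)) \<partial>\<mu> \<partial>power_measure I)"
    using I f' by (rule product_nn_integral_insert)
  also have "\<dots> = (\<integral>\<^sup>+x. f x * ennreal mass \<partial>power_measure I)" by (simp add: cong emeasure_eq_measure)
  also have "\<dots> = ennreal mass * (\<integral>\<^sup>+x. f x \<partial>power_measure I)"
    using f by (simp add: nn_integral_multc mult.commute)
  finally show ?thesis .
qed

definition total_clusters :: "nat set \<Rightarrow> ennreal" where
  "total_clusters I = (\<integral>\<^sup>+x. ennreal (graph_mean \<phi> x I
      (\<lambda>E. real (num_clusters I (\<lambda>e. e \<in> E)))) \<partial>power_measure I)"

lemma total_clusters_card: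
  assumes "finite I" "finite J" "card I = card J" shows "total_clusters I = total_clusters J"
proof -
  obtain \<pi> where \<pi>: "bij_betw \<pi> J I" using assms finite_same_card_bij by metis
  then have "inj_on \<pi> J" "I = \<pi> ` J" by (auto simp: bij_betw_def)
  then show ?thesis
    unfolding total_clusters_def using assms \<pi>
    by (intro nn_integral_bernoulli_relabel) (auto simp: num_clusters_image_edges)
qed

lemma total_clusters_le:
  assumes "finite I" shows "total_clusters I \<le> ennreal (real (card I) * mass ^ card I)"
proof -
  have "total_clusters I \<le> (\<integral>\<^sup>+x. ennreal (card I) \<partial>power_measure I)"
    unfolding total_clusters_def
  proof (intro nn_integral_mono ennreal_leI)
    fix x
    have "graph_mean \<phi> x I (\<lambda>E. real (num_clusters I (\<lambda>e. e \<in> E)))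
        \<le> graph_mean \<phi> x I (\<lambda>E. real (card I))"
      using assms edge_prob_bounds by (intro bernoulli_expectation_mono) (auto simp: num_clusters_le)
    then show "graph_mean \<phi> x I (\<lambda>E. real (num_clusters I (\<lambda>e. e \<in> E))) \<le> real (card I)"
      using assms by (simp add: bernoulli_expectation_const)
  qed
  also have "\<dots> = ennreal (real (card I) * mass ^ card I)"
    using assms by (simp add: emeasure_power_measure_space ennreal_mult)
  finally show ?thesis .
qed

lemma total_clusters_marginal:
  assumes "finite W" "V \<subseteq> W"
  shows "graph_mean \<phi> x W (\<lambda>E. real (num_clusters V (\<lambda>e. e \<in> E)))
       = graph_mean \<phi> x V (\<lambda>E. real (num_clusters V (\<lambda>e. e \<in> E)))"
  using assms by (intro bernoulli_expectation_marginal vertex_pairs_mono finite_vertex_pairs)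
    (auto intro!: num_clusters_cong)

definition connection_mass :: ennreal where
  "connection_mass = (\<integral>\<^sup>+v. \<integral>\<^sup>+w. ennreal (\<phi> v w) \<partial>\<mu> \<partial>\<mu>)"

text \<open>
  The pointwise inequality \<open>num_clusters_second_difference\<close> is integrated over the positions of
  \<open>k + 2\<close> vertices. A vertex that does not take part in the graph contributes a factor \<open>mass\<close>, and
  the two additional vertices can be exchanged.
\<close>

lemma total_clusters_second_difference:
  "2 * ennreal mass * total_clusters {..<Suc k}
    \<le> total_clusters {..<Suc (Suc k)} + (ennreal mass)\<^sup>2 * total_clusters {..<k} + ennreal (mass ^ k) * connection_mass"
proof -
  let ?I = "{..<k}" and ?W = "insert (Suc k) (insert k {..<k})"
  define U where "U V x = graph_mean \<phi> x V (\<lambda>E. real (num_clusters V (\<lambda>e. e \<in> E)))"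
    for V :: "nat set" and x
  have U_meas: "(\<lambda>x. ennreal (U V x)) \<in> borel_measurable (power_measure J)" if "V \<subseteq> J" for V J
    unfolding U_def using measurable_bernoulli_expectation[OF that] by measurable
  have U_nonneg: "0 \<le> U V x" if "finite V" for V x
    unfolding U_def using that by (intro bernoulli_expectation_edge_prob_nonneg) auto
  have U_upd: "U V (x(i := y)) = U V x" if "i \<notin> V" for V x i y
    unfolding U_def using that by (intro bernoulli_expectation_edge_prob_cong) auto
  have forget: "(\<integral>\<^sup>+x. ennreal (U V x) \<partial>power_measure (insert i J)) = ennreal mass * (\<integral>\<^sup>+x. ennreal (U V x) \<partial>power_measure J)"
    if "finite J" "i \<notin> J" "V \<subseteq> J" for V i J
    using that by (intro nn_integral_power_measure_forget U_meas) (auto intro!: U_upd arg_cong[of _ _ ennreal])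
  have W: "finite ?W" "{..<Suc k} = insert k {..<k}" "{..<Suc (Suc k)} = ?W" by auto
  have pointwise: "U (insert k ?I) x + U (insert (Suc k) ?I) x \<le> U ?W x + U ?I x + \<phi> (x k) (x (Suc k))" for x
  proof -
    have "graph_mean \<phi> x ?W
          (\<lambda>E. real (num_clusters (insert k ?I) (\<lambda>e. e \<in> E)) + real (num_clusters (insert (Suc k) ?I) (\<lambda>e. e \<in> E)))
       \<le> graph_mean \<phi> x ?W
          (\<lambda>E. real (num_clusters ?W (\<lambda>e. e \<in> E)) + real (num_clusters ?I (\<lambda>e. e \<in> E)) + of_bool ({Suc k, k} \<in> E))"
    proof (intro bernoulli_expectation_mono edge_prob_bounds)
      fix E
      show "real (num_clusters (insert k ?I) (\<lambda>e. e \<in> E)) + real (num_clusters (insert (Suc k) ?I) (\<lambda>e. e \<in> E))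
        \<le> real (num_clusters ?W (\<lambda>e. e \<in> E)) + real (num_clusters ?I (\<lambda>e. e \<in> E)) + of_bool ({Suc k, k} \<in> E)"
        using num_clusters_second_difference[of ?I "Suc k" k "\<lambda>e. e \<in> E"] by simp
    qed
    moreover have "graph_mean \<phi> x ?W (\<lambda>E. of_bool ({Suc k, k} \<in> E)) = \<phi> (x (Suc k)) (x k)"
      by (subst bernoulli_expectation_mem)
        (auto simp: vertex_pairs_doubleton_iff edge_prob_doubleton[of \<phi>, OF connection_sym])
    moreover have "graph_mean \<phi> x ?W (\<lambda>E. real (num_clusters V (\<lambda>e. e \<in> E))) = U V x"
      if "V \<subseteq> ?W" for V
      unfolding U_def by (rule total_clusters_marginal[OF W(1) that])
    moreover have "insert k ?I \<subseteq> ?W" "insert (Suc k) ?I \<subseteq> ?W" "?I \<subseteq> ?W" by auto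
    ultimately show ?thesis
      using connection_sym[of "x k" "x (Suc k)"] by (simp add: bernoulli_expectation_add)
  qed
  have TW: "total_clusters ?W = (\<integral>\<^sup>+x. ennreal (U ?W x) \<partial>power_measure ?W)"
    by (simp add: total_clusters_def U_def)
  have Tk: "(\<integral>\<^sup>+x. ennreal (U (insert k ?I) x) \<partial>power_measure ?W) = ennreal mass * total_clusters {..<Suc k}"
    unfolding W(2) total_clusters_def U_def[symmetric] by (intro forget) auto
  have TSk: "(\<integral>\<^sup>+x. ennreal (U (insert (Suc k) ?I) x) \<partial>power_measure ?W) = ennreal mass * total_clusters {..<Suc k}"
  proof -
    have "total_clusters {..<Suc k} = total_clusters (insert (Suc k) ?I)" by (intro total_clusters_card) auto
    then show ?thesis
      unfolding insert_commute[of "Suc k" k] by (subst forget) (auto simp: total_clusters_def U_def)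
  qed
  have TI: "(\<integral>\<^sup>+x. ennreal (U ?I x) \<partial>power_measure ?W) = (ennreal mass)\<^sup>2 * total_clusters ?I"
    using forget[of "insert k ?I" "Suc k" ?I] forget[of ?I k ?I]
    by (simp add: total_clusters_def U_def power2_eq_square mult.assoc subset_insertI)
  have T\<phi>: "(\<integral>\<^sup>+x. ennreal (\<phi> (x k) (x (Suc k))) \<partial>power_measure ?W) = ennreal (mass ^ k) * connection_mass"
  proof -
    have "(\<integral>\<^sup>+x. ennreal (\<phi> (x k) (x (Suc k))) \<partial>power_measure ?W)
        = (\<integral>\<^sup>+x. \<integral>\<^sup>+w. ennreal (\<phi> (x k) w) \<partial>\<mu> \<partial>power_measure (insert k ?I))"
      by (subst product_nn_integral_insert) auto
    also have "\<dots> = (\<integral>\<^sup>+x. \<integral>\<^sup>+v. \<integral>\<^sup>+w. ennreal (\<phi> v w) \<partial>\<mu> \<partial>\<mu> \<partial>power_measure ?I)"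
      by (subst product_nn_integral_insert) auto
    also have "\<dots> = connection_mass * ennreal (mass ^ k)"
      by (simp add: emeasure_power_measure_space connection_mass_def)
    finally show ?thesis by (simp add: mult.commute)
  qed
  have "2 * ennreal mass * total_clusters {..<Suc k} = ennreal mass * total_clusters {..<Suc k} + ennreal mass * total_clusters {..<Suc k}"
    by (simp add: mult_2 distrib_right)
  also have "\<dots> = (\<integral>\<^sup>+x. ennreal (U (insert k ?I) x) + ennreal (U (insert (Suc k) ?I) x) \<partial>power_measure ?W)"
    by (subst nn_integral_add) (auto intro!: U_meas simp: Tk TSk)
  also have "\<dots> \<le> (\<integral>\<^sup>+x. (ennreal (U ?W x) + ennreal (U ?I x)) + ennreal (\<phi> (x k) (x (Suc k))) \<partial>power_measure ?W)"
    using pointwise U_nonneg connection_bounds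
    by (intro nn_integral_mono) (simp flip: ennreal_plus add: add_nonneg_nonneg ennreal_leI)
  also have "\<dots> = (total_clusters ?W + (ennreal mass)\<^sup>2 * total_clusters ?I) + ennreal (mass ^ k) * connection_mass"
  proof (subst nn_integral_add)
    show "(\<lambda>x. ennreal (U ?W x) + ennreal (U ?I x)) \<in> borel_measurable (power_measure ?W)"
      by (intro borel_measurable_add U_meas) auto
    show "(\<integral>\<^sup>+x. ennreal (U ?W x) + ennreal (U ?I x) \<partial>power_measure ?W) + (\<integral>\<^sup>+x. ennreal (\<phi> (x k) (x (Suc k))) \<partial>power_measure ?W)
      = (total_clusters ?W + (ennreal mass)\<^sup>2 * total_clusters ?I) + ennreal (mass ^ k) * connection_mass"
      unfolding T\<phi> by (subst nn_integral_add) (auto intro!: U_meas simp: TW TI)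
  qed measurable
  finally show ?thesis unfolding W(3) .
qed

lemma total_clusters_finite: "finite I \<Longrightarrow> total_clusters I < \<infinity>"
  using total_clusters_le[of I] by (auto intro: le_less_trans)

lemma connection_mass_finite: "connection_mass < \<infinity>"
proof -
  have "connection_mass \<le> (\<integral>\<^sup>+v. \<integral>\<^sup>+w. 1 \<partial>\<mu> \<partial>\<mu>)"
    unfolding connection_mass_def using connection_bounds by (intro nn_integral_mono) simp
  also have "\<dots> < \<infinity>" by (simp add: emeasure_eq_measure ennreal_mult_less_top)
  finally show ?thesis .
qed

section \<open>Convexity in a window\<close>

definition mean_clusters :: "nat \<Rightarrow> real" where
  "mean_clusters k = enn2real (total_clusters {..<k})"

lemma ennreal_mean_clusters: "ennreal (mean_clusters k) = total_clusters {..<k}"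
  unfolding mean_clusters_def using total_clusters_finite[of "{..<k}"] by simp

lemma mean_clusters_bounds: "0 \<le> mean_clusters k" "mean_clusters k \<le> 1 * (2 * mass) ^ k"
proof -
  show "0 \<le> mean_clusters k" by (simp add: mean_clusters_def)
  have "mean_clusters k \<le> real k * mass ^ k"
    using total_clusters_le[of "{..<k}"] unfolding mean_clusters_def by (intro enn2real_leI) auto
  \<comment> \<open>a geometric bound, as required for exponential generating functions\<close>
  also have "\<dots> \<le> 2 ^ k * mass ^ k"
    using less_exp[of k] by (intro mult_right_mono) (auto simp: less_imp_le)
  finally show "mean_clusters k \<le> 1 * (2 * mass) ^ k" by (simp add: power_mult_distrib)
qed

text \<open>
  The mean number of clusters of the graph on a Poisson process with intensity measure \<open>t\<close> times \<open>\<mu>\<close>.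
\<close>

definition cluster_number :: "real \<Rightarrow> real" where
  "cluster_number t = exp (- (mass * t)) * (\<Sum>k. mean_clusters k / fact k * t ^ k)"

lemma convex_cluster_number:
  "convex_on {0..} (\<lambda>t. cluster_number t + enn2real connection_mass * t\<^sup>2 / 2)"
  unfolding cluster_number_def
proof (rule convex_on_poisson_transform)
  show "\<bar>mean_clusters k\<bar> \<le> 1 * (2 * mass) ^ k" for k
    using mean_clusters_bounds[of k] by simp
  fix k
  have "ennreal (2 * mass * mean_clusters (Suc k))
    \<le> ennreal (mean_clusters (Suc (Suc k)) + mass\<^sup>2 * mean_clusters k + mass ^ k * enn2real connection_mass)"
    using total_clusters_second_difference[of k] connection_mass_finite
    by (simp add: ennreal_mult ennreal_mean_clusters mean_clusters_bounds ennreal_power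
        flip: ennreal_numeral)
  then have "2 * mass * mean_clusters (Suc k)
    \<le> mean_clusters (Suc (Suc k)) + mass\<^sup>2 * mean_clusters k + mass ^ k * enn2real connection_mass"
    by (subst (asm) ennreal_le_iff) (auto intro!: add_nonneg_nonneg mult_nonneg_nonneg mean_clusters_bounds)
  then show "- enn2real connection_mass * mass ^ k
    \<le> mean_clusters (Suc (Suc k)) - 2 * mass * mean_clusters (Suc k) + mass\<^sup>2 * mean_clusters k"
    by (simp add: mult.commute)
qed simp

lemma ennreal_cluster_number:
  assumes "0 \<le> t"
  shows "ennreal (cluster_number t) = (\<Sum>k. ennreal (exp (- (mass * t)) * t ^ k / fact k) * total_clusters {..<k})"
proof -
  have "summable (\<lambda>k. mean_clusters k / fact k * t ^ k)"
    using mean_clusters_bounds by (intro egf_summable[where C = 1 and M = "2 * mass"]) simp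
  then have "(\<lambda>k. exp (- (mass * t)) * (mean_clusters k / fact k * t ^ k)) sums cluster_number t"
    unfolding cluster_number_def by (intro sums_mult summable_sums)
  then have "(\<Sum>k. ennreal (exp (- (mass * t)) * (mean_clusters k / fact k * t ^ k))) = ennreal (cluster_number t)"
    using assms mean_clusters_bounds by (intro suminf_ennreal_eq) auto
  moreover have "ennreal (exp (- (mass * t)) * (mean_clusters k / fact k * t ^ k))
     = ennreal (exp (- (mass * t)) * t ^ k / fact k) * total_clusters {..<k}" for k
    using assms mean_clusters_bounds(1)[of k]
    by (simp flip: ennreal_mean_clusters ennreal_mult add: mult_ac divide_inverse)
  ultimately show ?thesis by simp
qed

lemma cluster_number_nonneg: "0 \<le> t \<Longrightarrow> 0 \<le> cluster_number t"
  unfolding cluster_number_def using mean_clusters_bounds egf_summable[where C = 1 and M = "2 * mass"]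
  by (intro mult_nonneg_nonneg suminf_nonneg) auto

section \<open>The cluster expansion\<close>

text \<open>
  The mean mass of the points that have no edge to any of the points \<open>x v\<close> with \<open>v \<in> S\<close>.
\<close>

definition unreached :: "nat set \<Rightarrow> (nat \<Rightarrow> 'x) \<Rightarrow> real" where
  "unreached S x = (\<integral>y. (\<Prod>v\<in>S. 1 - \<phi> (x v) y) \<partial>\<mu>)"

definition spanning_prob :: "nat set \<Rightarrow> (nat \<Rightarrow> 'x) \<Rightarrow> real" where
  "spanning_prob S x = graph_mean \<phi> x S (\<lambda>E. of_bool (spans S (\<lambda>e. e \<in> E)))"

lemma avoid_prod_bounds: "0 \<le> (\<Prod>v\<in>S. 1 - \<phi> (x v) y)" "(\<Prod>v\<in>S. 1 - \<phi> (x v) y) \<le> 1"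
  using connection_bounds by (auto intro!: prod_nonneg prod_le_1)

lemma measurable_avoid_prod [measurable]:
  assumes "x \<in> space (power_measure S)"
  shows "(\<lambda>y. \<Prod>v\<in>S. 1 - \<phi> (x v) y) \<in> borel_measurable \<mu>"
proof -
  have [measurable]: "x v \<in> space \<mu>" if "v \<in> S" for v using assms that by (auto simp: space_PiM)
  have "(\<lambda>y. 1 - \<phi> (x v) y) \<in> borel_measurable \<mu>" if "v \<in> S" for v using that by measurable
  then show ?thesis by (rule borel_measurable_prod)
qed

lemma nn_integral_avoid_prod:
  assumes "x \<in> space (power_measure S)"
  shows "(\<integral>\<^sup>+y. ennreal (\<Prod>v\<in>S. 1 - \<phi> (x v) y) \<partial>\<mu>) = ennreal (unreached S x)"
  unfolding unreached_def using assms avoid_prod_bounds measurable_avoid_prod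
  by (intro nn_integral_eq_integral integrable_const_bound[where B = 1] AE_I2) auto

lemma unreached_nonneg: "0 \<le> unreached S x"
  unfolding unreached_def by (intro integral_nonneg_AE) (simp add: avoid_prod_bounds)

lemma unreached_le: "x \<in> space (power_measure S) \<Longrightarrow> unreached S x \<le> mass"
proof -
  assume x: "x \<in> space (power_measure S)"
  have "ennreal (unreached S x) \<le> (\<integral>\<^sup>+y. 1 \<partial>\<mu>)"
    unfolding nn_integral_avoid_prod[OF x, symmetric] using avoid_prod_bounds
    by (intro nn_integral_mono) simp
  then show ?thesis by (simp add: emeasure_eq_measure)
qed

lemma measurable_unreached [measurable]:
  assumes "finite S" shows "unreached S \<in> borel_measurable (power_measure S)"
proof -
  have "(\<lambda>(x, y). \<Prod>v\<in>S. 1 - \<phi> (x v) y) \<in> borel_measurable (power_measure S \<Otimes>\<^sub>M \<mu>)"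
    unfolding split_beta by (intro borel_measurable_prod) measurable
  then show ?thesis unfolding unreached_def
    by (intro borel_measurable_lebesgue_integral) (simp add: split_beta)
qed

lemma unreached_cong: "(\<And>v. v \<in> S \<Longrightarrow> x v = y v) \<Longrightarrow> unreached S x = unreached S y"
  unfolding unreached_def by simp

lemma spanning_prob_bounds:
  assumes "finite S" shows "0 \<le> spanning_prob S x" "spanning_prob S x \<le> 1"
proof -
  show "0 \<le> spanning_prob S x"
    unfolding spanning_prob_def using assms by (intro bernoulli_expectation_edge_prob_nonneg) auto
  have "spanning_prob S x \<le> graph_mean \<phi> x S (\<lambda>E. 1)"
    unfolding spanning_prob_def using edge_prob_bounds by (intro bernoulli_expectation_mono) auto
  then show "spanning_prob S x \<le> 1" using assms by (simp add: bernoulli_expectation_const)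
qed

lemma measurable_spanning_prob [measurable]: "spanning_prob S \<in> borel_measurable (power_measure S)"
  using measurable_bernoulli_expectation[of S S] unfolding spanning_prob_def by simp

lemma spanning_prob_cong: "(\<And>v. v \<in> S \<Longrightarrow> x v = y v) \<Longrightarrow> spanning_prob S x = spanning_prob S y"
  unfolding spanning_prob_def by (rule bernoulli_expectation_edge_prob_cong)

lemma spanning_prob_empty: "spanning_prob {} x = 0"
  by (simp add: spanning_prob_def spans_def vertex_pairs_def bernoulli_expectation_def)

definition spanning_integral :: "nat \<Rightarrow> nat \<Rightarrow> ennreal" where
  "spanning_integral n j = (\<integral>\<^sup>+x. ennreal (spanning_prob {..<n} x * unreached {..<n} x ^ j) \<partial>power_measure {..<n})"

lemma nn_integral_spanning_relabel:
  assumes S: "finite S"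
  shows "(\<integral>\<^sup>+x. ennreal (spanning_prob S x * unreached S x ^ j) \<partial>power_measure S) = spanning_integral (card S) j"
proof -
  obtain \<pi> where \<pi>: "bij_betw \<pi> {..<card S} S" using S bij_betw_from_nat_into_finite by blast
  then have \<pi>': "inj_on \<pi> {..<card S}" "S = \<pi> ` {..<card S}" by (auto simp: bij_betw_def)
  let ?J = "{..<card S}"
  have "spanning_integral (card S) j = (\<integral>\<^sup>+x. ennreal (spanning_prob ?J (\<lambda>j\<in>?J. x (\<pi> j)) * unreached ?J (\<lambda>j\<in>?J. x (\<pi> j)) ^ j) \<partial>power_measure S)"
    unfolding spanning_integral_def by (intro nn_integral_power_measure_relabel \<pi>) auto
  also have "\<dots> = (\<integral>\<^sup>+x. ennreal (spanning_prob S x * unreached S x ^ j) \<partial>power_measure S)"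
  proof (intro nn_integral_cong)
    fix x
    have "unreached ?J (\<lambda>j\<in>?J. x (\<pi> j)) = unreached ?J (\<lambda>j. x (\<pi> j))" by (rule unreached_cong) simp
    also have "\<dots> = unreached S x"
      unfolding unreached_def using prod.reindex_bij_betw[OF \<pi>, of "\<lambda>v. 1 - \<phi> (x v) y" for y] by simp
    finally have 1: "unreached ?J (\<lambda>j\<in>?J. x (\<pi> j)) = unreached S x" .
    have "spanning_prob ?J (\<lambda>j\<in>?J. x (\<pi> j)) = spanning_prob ?J (\<lambda>j. x (\<pi> j))" by (rule spanning_prob_cong) simp
    also have "\<dots> = spanning_prob (\<pi> ` ?J) x"
      unfolding spanning_prob_def
      by (rule bernoulli_expectation_relabel[symmetric, of \<phi>, OF connection_sym \<pi>'(1)])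
         (simp add: spans_image_edges[OF \<pi>'(1)])
    finally have 2: "spanning_prob ?J (\<lambda>j\<in>?J. x (\<pi> j)) = spanning_prob S x" using \<pi>'(2) by simp
    show "ennreal (spanning_prob ?J (\<lambda>j\<in>?J. x (\<pi> j)) * unreached ?J (\<lambda>j\<in>?J. x (\<pi> j)) ^ j)
        = ennreal (spanning_prob S x * unreached S x ^ j)"
      by (simp only: 1 2)
  qed
  finally show ?thesis by simp
qed

text \<open>
  For fixed positions of the vertices in \<open>S\<close>, the remaining vertices fail to be joined to \<open>S\<close>
  independently of each other.
\<close>

lemma nn_integral_isolated_spanning:
  assumes I: "finite I" and S: "S \<subseteq> I"
  shows "(\<integral>\<^sup>+x. ennreal (spanning_prob S x * (\<Prod>w\<in>I - S. \<Prod>v\<in>S. 1 - edge_prob \<phi> x {v, w})) \<partial>power_measure I)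
       = spanning_integral (card S) (card (I - S))"
proof -
  have fin: "finite S" "finite (I - S)" and I_eq: "S \<union> (I - S) = I" using I S finite_subset by auto
  let ?f = "\<lambda>x. ennreal (spanning_prob S x * (\<Prod>w\<in>I - S. \<Prod>v\<in>S. 1 - edge_prob \<phi> x {v, w}))"
  have meas: "?f \<in> borel_measurable (power_measure I)"
  proof -
    have "(\<lambda>x. edge_prob \<phi> x {v, w}) \<in> borel_measurable (power_measure I)" if "v \<in> S" "w \<in> I - S" for v w
      using that S by (intro measurable_edge_prob) (auto simp: vertex_pairs_doubleton_iff)
    moreover have "spanning_prob S \<in> borel_measurable (power_measure I)"
      using measurable_bernoulli_expectation[OF S] unfolding spanning_prob_def by simp
    ultimately show ?thesis
      by (intro measurable_compose[OF _ measurable_ennreal] borel_measurable_times borel_measurable_prod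
          borel_measurable_diff borel_measurable_const)
  qed
  have "(\<integral>\<^sup>+x. ?f x \<partial>power_measure I)
     = (\<integral>\<^sup>+x. \<integral>\<^sup>+y. ?f (merge S (I - S) (x, y)) \<partial>power_measure (I - S) \<partial>power_measure S)"
    by (rule product_nn_integral_fold[of S "I - S" ?f, unfolded I_eq]) (use fin meas in auto)
  also have "\<dots> = (\<integral>\<^sup>+x. ennreal (spanning_prob S x * unreached S x ^ card (I - S)) \<partial>power_measure S)"
  proof (intro nn_integral_cong)
    fix x assume x: "x \<in> space (power_measure S)"
    have "?f (merge S (I - S) (x, y)) = ennreal (spanning_prob S x) * (\<Prod>w\<in>I - S. ennreal (\<Prod>v\<in>S. 1 - \<phi> (x v) (y w)))" for y
    proof -
      have "spanning_prob S (merge S (I - S) (x, y)) = spanning_prob S x"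
        by (rule spanning_prob_cong) simp
      moreover have "(\<Prod>w\<in>I - S. \<Prod>v\<in>S. 1 - edge_prob \<phi> (merge S (I - S) (x, y)) {v, w})
          = (\<Prod>w\<in>I - S. \<Prod>v\<in>S. 1 - \<phi> (x v) (y w))"
      proof (intro prod.cong refl)
        fix v w assume "v \<in> S" "w \<in> I - S"
        moreover from this have "v \<noteq> w" by auto
        ultimately show "1 - edge_prob \<phi> (merge S (I - S) (x, y)) {v, w} = 1 - \<phi> (x v) (y w)"
          by (simp add: edge_prob_doubleton[of \<phi>, OF connection_sym] merge_def)
      qed
      moreover have "0 \<le> (\<Prod>w\<in>I - S. \<Prod>v\<in>S. 1 - \<phi> (x v) (y w))"
        by (intro prod_nonneg avoid_prod_bounds)
      moreover have "(\<Prod>w\<in>I - S. ennreal (\<Prod>v\<in>S. 1 - \<phi> (x v) (y w))) = ennreal (\<Prod>w\<in>I - S. \<Prod>v\<in>S. 1 - \<phi> (x v) (y w))"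
        by (intro prod_ennreal avoid_prod_bounds)
      ultimately show ?thesis
        using spanning_prob_bounds(1)[OF fin(1), of x] by (simp only: ennreal_mult)
    qed
    then have "(\<integral>\<^sup>+y. ?f (merge S (I - S) (x, y)) \<partial>power_measure (I - S))
      = (\<integral>\<^sup>+y. ennreal (spanning_prob S x) * (\<Prod>w\<in>I - S. ennreal (\<Prod>v\<in>S. 1 - \<phi> (x v) (y w))) \<partial>power_measure (I - S))"
      by simp
    also have "\<dots> = ennreal (spanning_prob S x) * (\<integral>\<^sup>+y. (\<Prod>w\<in>I - S. ennreal (\<Prod>v\<in>S. 1 - \<phi> (x v) (y w))) \<partial>power_measure (I - S))"
    proof (rule nn_integral_cmult, rule borel_measurable_prod_ennreal)
      fix w assume w: "w \<in> I - S"
      show "(\<lambda>y. ennreal (\<Prod>v\<in>S. 1 - \<phi> (x v) (y w))) \<in> borel_measurable (power_measure (I - S))"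
        using measurable_compose[OF measurable_component_singleton[OF w] measurable_avoid_prod[OF x]] by simp
    qed
    also have "(\<integral>\<^sup>+y. (\<Prod>w\<in>I - S. ennreal (\<Prod>v\<in>S. 1 - \<phi> (x v) (y w))) \<partial>power_measure (I - S))
       = (\<Prod>w\<in>I - S. \<integral>\<^sup>+y. ennreal (\<Prod>v\<in>S. 1 - \<phi> (x v) y) \<partial>\<mu>)"
      using product_nn_integral_prod[of "I - S" "\<lambda>_ y. ennreal (\<Prod>v\<in>S. 1 - \<phi> (x v) y)"] fin measurable_avoid_prod[OF x]
      by simp
    also have "\<dots> = ennreal (unreached S x) ^ card (I - S)"
      by (simp add: nn_integral_avoid_prod[OF x])
    finally show "(\<integral>\<^sup>+y. ?f (merge S (I - S) (x, y)) \<partial>power_measure (I - S))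
        = ennreal (spanning_prob S x * unreached S x ^ card (I - S))"
      using spanning_prob_bounds[OF fin(1), of x] unreached_nonneg[of S x] by (simp add: ennreal_mult ennreal_power)
  qed
  also have "\<dots> = spanning_integral (card S) (card (I - S))"
    by (rule nn_integral_spanning_relabel[OF fin(1)])
  finally show ?thesis .
qed

lemma nn_integral_cluster_functional:
  fixes g :: "nat \<Rightarrow> real"
  assumes g: "\<And>n. 0 \<le> g n"
  shows "(\<integral>\<^sup>+x. ennreal (graph_mean \<phi> x {..<k}
            (\<lambda>E. \<Sum>S\<in>cluster {..<k} (\<lambda>e. e \<in> E) ` {..<k}. g (card S))) \<partial>power_measure {..<k})
       = (\<Sum>n\<le>k. of_nat (k choose n) * (ennreal (g n) * spanning_integral n (k - n)))"
proof -
  let ?I = "{..<k}"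
  let ?h = "\<lambda>S x. spanning_prob S x * (\<Prod>w\<in>?I - S. \<Prod>v\<in>S. 1 - edge_prob \<phi> x {v, w})"
  have h_nonneg: "0 \<le> ?h S x" if "S \<subseteq> ?I" for S x
    using that spanning_prob_bounds finite_subset[OF that] edge_prob_bounds[of _ ?I x]
    by (intro mult_nonneg_nonneg prod_nonneg) (force simp: vertex_pairs_doubleton_iff)+
  have h_meas: "(\<lambda>x. ennreal (?h S x)) \<in> borel_measurable (power_measure ?I)" if S: "S \<subseteq> ?I" for S
  proof -
    have "(\<lambda>x. edge_prob \<phi> x {v, w}) \<in> borel_measurable (power_measure ?I)" if "v \<in> S" "w \<in> ?I - S" for v w
      using that S by (intro measurable_edge_prob) (auto simp: vertex_pairs_doubleton_iff)
    moreover have "spanning_prob S \<in> borel_measurable (power_measure ?I)"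
      using measurable_bernoulli_expectation[OF S] unfolding spanning_prob_def by simp
    ultimately show ?thesis
      by (intro measurable_compose[OF _ measurable_ennreal] borel_measurable_times borel_measurable_prod
          borel_measurable_diff borel_measurable_const)
  qed
  have "(\<integral>\<^sup>+x. ennreal (graph_mean \<phi> x ?I
            (\<lambda>E. \<Sum>S\<in>cluster ?I (\<lambda>e. e \<in> E) ` ?I. g (card S))) \<partial>power_measure ?I)
     = (\<integral>\<^sup>+x. (\<Sum>S\<in>Pow ?I. ennreal (g (card S)) * ennreal (?h S x)) \<partial>power_measure ?I)"
  proof (intro nn_integral_cong)
    fix x
    have "ennreal (\<Sum>S\<in>Pow ?I. g (card S) * ?h S x) = (\<Sum>S\<in>Pow ?I. ennreal (g (card S)) * ennreal (?h S x))"
      using g h_nonneg by (subst sum_ennreal[symmetric]) (auto simp: ennreal_mult intro!: sum.cong)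
    then show "ennreal (graph_mean \<phi> x ?I
            (\<lambda>E. \<Sum>S\<in>cluster ?I (\<lambda>e. e \<in> E) ` ?I. g (card S))) = (\<Sum>S\<in>Pow ?I. ennreal (g (card S)) * ennreal (?h S x))"
      unfolding spanning_prob_def by (subst bernoulli_expectation_cluster_functional) auto
  qed
  also have "\<dots> = (\<Sum>S\<in>Pow ?I. ennreal (g (card S)) * (\<integral>\<^sup>+x. ennreal (?h S x) \<partial>power_measure ?I))"
    using h_meas by (subst nn_integral_sum) (auto intro!: sum.cong nn_integral_cmult borel_measurable_times)
  also have "\<dots> = (\<Sum>S\<in>Pow ?I. ennreal (g (card S)) * spanning_integral (card S) (k - card S))"
    by (intro sum.cong refl) (simp add: nn_integral_isolated_spanning card_Diff_subset finite_subset[of _ ?I])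
  also have "\<dots> = (\<Sum>n\<le>k. \<Sum>S\<in>{S\<in>Pow ?I. card S = n}. ennreal (g (card S)) * spanning_integral (card S) (k - card S))"
    using card_mono[of ?I] by (intro sum.group[symmetric]) auto
  also have "\<dots> = (\<Sum>n\<le>k. of_nat (k choose n) * (ennreal (g n) * spanning_integral n (k - n)))"
  proof (intro sum.cong refl)
    fix n
    have "(\<Sum>S\<in>{S\<in>Pow ?I. card S = n}. ennreal (g (card S)) * spanning_integral (card S) (k - card S))
        = (\<Sum>S\<in>{S\<in>Pow ?I. card S = n}. ennreal (g n) * spanning_integral n (k - n))"
      by (intro sum.cong) auto
    then show "(\<Sum>S\<in>{S\<in>Pow ?I. card S = n}. ennreal (g (card S)) * spanning_integral (card S) (k - card S))
        = of_nat (k choose n) * (ennreal (g n) * spanning_integral n (k - n))"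
      using n_subsets[of ?I n] by simp
  qed
  finally show ?thesis .
qed

lemma suminf_cauchy_ennreal:
  fixes f :: "nat \<Rightarrow> nat \<Rightarrow> ennreal"
  shows "(\<Sum>k. \<Sum>n\<le>k. f n (k - n)) = (\<Sum>n. \<Sum>j. f n j)"
proof -
  have "(\<Sum>k. \<Sum>n\<le>k. f n (k - n)) = (\<Sum>k. \<Sum>n. f n (k - n) * of_bool (n \<le> k))"
  proof (rule suminf_cong)
    fix k
    have "(\<Sum>n. f n (k - n) * of_bool (n \<le> k)) = (\<Sum>n\<in>{..k}. f n (k - n) * of_bool (n \<le> k))"
      by (rule suminf_finite) auto
    then show "(\<Sum>n\<le>k. f n (k - n)) = (\<Sum>n. f n (k - n) * of_bool (n \<le> k))" by simp
  qed
  also have "\<dots> = (\<Sum>n. \<Sum>k. f n (k - n) * of_bool (n \<le> k))"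
    using nn_integral_suminf[of "\<lambda>n k. f n (k - n) * of_bool (n \<le> k)" "count_space UNIV"]
    by (simp add: nn_integral_count_space_nat)
  also have "\<dots> = (\<Sum>n. \<Sum>j. f n j)"
  proof (rule suminf_cong)
    fix n
    have "(\<Sum>k. f n (k - n) * of_bool (n \<le> k)) = (\<Sum>k. f n (k + n - n) * of_bool (n \<le> k + n)) + (\<Sum>k<n. f n (k - n) * of_bool (n \<le> k))"
      by (rule suminf_offset) simp
    then show "(\<Sum>k. f n (k - n) * of_bool (n \<le> k)) = (\<Sum>j. f n j)" by simp
  qed
  finally show ?thesis .
qed

text \<open>
  The mass \<open>h\<close> of the points that are joined to the first \<open>n\<close> points is the complement of the
  unreached mass; no such point may belong to the process if these \<open>n\<close> points are to form a cluster.
\<close>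

definition gamma_weight :: "nat \<Rightarrow> real \<Rightarrow> (nat \<Rightarrow> 'x) \<Rightarrow> real" where
  "gamma_weight n t x = spanning_prob {..<n} x * (t ^ n * exp (- (t * (mass - unreached {..<n} x)))) / fact n"

text \<open>
  On the left, a sum over the number \<open>k\<close> of points contains for each configuration a sum over its
  clusters. Summing over the possible vertex sets of clusters first, the \<open>k - n\<close> points outside a cluster with
  \<open>n\<close> points contribute a power of the unreached mass, and the sum over \<open>k\<close> becomes an exponential series.
\<close>

lemma cluster_expansion:
  fixes g :: "nat \<Rightarrow> real"
  assumes g: "\<And>n. 0 \<le> g n" and t: "0 \<le> t"
  shows "(\<Sum>k. ennreal (exp (- (mass * t)) * t ^ k / fact k) *
          (\<integral>\<^sup>+x. ennreal (graph_mean \<phi> x {..<k}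
            (\<lambda>E. \<Sum>S\<in>cluster {..<k} (\<lambda>e. e \<in> E) ` {..<k}. g (card S))) \<partial>power_measure {..<k}))
     = (\<Sum>n. ennreal (g n) * (\<integral>\<^sup>+x. ennreal (gamma_weight n t x) \<partial>power_measure {..<n}))"
proof -
  let ?e = "exp (- (mass * t))"
  have binom: "ennreal (?e * t ^ k / fact k) * (of_nat (k choose n) * (ennreal (g n) * spanning_integral n (k - n)))
     = ennreal (g n) * (ennreal (?e * (t ^ n / fact n)) * (ennreal (t ^ (k - n) / fact (k - n)) * spanning_integral n (k - n)))"
    if "n \<le> k" for n k
  proof -
    have "?e * t ^ k / fact k * real (k choose n) = ?e * (t ^ n / fact n) * (t ^ (k - n) / fact (k - n))"
      using that power_add[of t n "k - n"] by (simp add: binomial_fact[OF that] field_simps)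
    then have "ennreal (?e * t ^ k / fact k) * ennreal (real (k choose n)) = ennreal (?e * (t ^ n / fact n)) * ennreal (t ^ (k - n) / fact (k - n))"
      using t by (simp flip: ennreal_mult)
    then have "ennreal (?e * t ^ k / fact k) * ennreal (real (k choose n)) * (ennreal (g n) * spanning_integral n (k - n))
       = ennreal (?e * (t ^ n / fact n)) * ennreal (t ^ (k - n) / fact (k - n)) * (ennreal (g n) * spanning_integral n (k - n))"
      by (simp only:)
    then show ?thesis by (simp only: ennreal_of_nat_eq_real_of_nat mult_ac)
  qed
  have exp_series: "(\<Sum>j. ennreal (t ^ j / fact j) * spanning_integral n j)
     = (\<integral>\<^sup>+x. ennreal (spanning_prob {..<n} x * exp (t * unreached {..<n} x)) \<partial>power_measure {..<n})" for n
  proof -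
    have "(\<Sum>j. ennreal (t ^ j / fact j) * spanning_integral n j)
       = (\<Sum>j. \<integral>\<^sup>+x. ennreal (spanning_prob {..<n} x * ((t * unreached {..<n} x) ^ j / fact j)) \<partial>power_measure {..<n})"
      unfolding spanning_integral_def using t spanning_prob_bounds[of "{..<n}"] unreached_nonneg
      by (intro suminf_cong, subst nn_integral_cmult[symmetric])
        (auto intro!: nn_integral_cong simp flip: ennreal_mult simp: power_mult_distrib mult_ac)
    also have "\<dots> = (\<integral>\<^sup>+x. (\<Sum>j. ennreal (spanning_prob {..<n} x * ((t * unreached {..<n} x) ^ j / fact j))) \<partial>power_measure {..<n})"
      by (rule nn_integral_suminf[symmetric]) measurable
    also have "\<dots> = (\<integral>\<^sup>+x. ennreal (spanning_prob {..<n} x * exp (t * unreached {..<n} x)) \<partial>power_measure {..<n})"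
    proof (intro nn_integral_cong suminf_ennreal_eq)
      fix x
      show "0 \<le> spanning_prob {..<n} x * ((t * unreached {..<n} x) ^ j / fact j)" for j
        using t spanning_prob_bounds[of "{..<n}" x] unreached_nonneg by simp
      show "(\<lambda>j. spanning_prob {..<n} x * ((t * unreached {..<n} x) ^ j / fact j)) sums (spanning_prob {..<n} x * exp (t * unreached {..<n} x))"
        using exp_converges[of "t * unreached {..<n} x"] by (intro sums_mult) (simp add: divide_inverse mult.commute)
    qed
    finally show ?thesis .
  qed
  have "(\<Sum>k. ennreal (?e * t ^ k / fact k) *
          (\<integral>\<^sup>+x. ennreal (graph_mean \<phi> x {..<k}
            (\<lambda>E. \<Sum>S\<in>cluster {..<k} (\<lambda>e. e \<in> E) ` {..<k}. g (card S))) \<partial>power_measure {..<k}))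
     = (\<Sum>k. \<Sum>n\<le>k. ennreal (g n) * (ennreal (?e * (t ^ n / fact n)) * (ennreal (t ^ (k - n) / fact (k - n)) * spanning_integral n (k - n))))"
    unfolding nn_integral_cluster_functional[of g, OF g] sum_distrib_left
    by (intro suminf_cong sum.cong refl) (simp only: binom atMost_iff)
  also have "\<dots> = (\<Sum>n. \<Sum>j. ennreal (g n) * (ennreal (?e * (t ^ n / fact n)) * (ennreal (t ^ j / fact j) * spanning_integral n j)))"
    by (rule suminf_cauchy_ennreal)
  also have "\<dots> = (\<Sum>n. ennreal (g n) * (\<integral>\<^sup>+x. ennreal (gamma_weight n t x) \<partial>power_measure {..<n}))"
  proof (rule suminf_cong)
    fix n
    have "(\<Sum>j. ennreal (g n) * (ennreal (?e * (t ^ n / fact n)) * (ennreal (t ^ j / fact j) * spanning_integral n j)))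
      = ennreal (g n) * (ennreal (?e * (t ^ n / fact n)) *
        (\<integral>\<^sup>+x. ennreal (spanning_prob {..<n} x * exp (t * unreached {..<n} x)) \<partial>power_measure {..<n}))"
      by (simp add: exp_series)
    also have "ennreal (?e * (t ^ n / fact n)) *
        (\<integral>\<^sup>+x. ennreal (spanning_prob {..<n} x * exp (t * unreached {..<n} x)) \<partial>power_measure {..<n})
      = (\<integral>\<^sup>+x. ennreal (gamma_weight n t x) \<partial>power_measure {..<n})"
    proof (subst nn_integral_cmult[symmetric])
      have "?e * (t ^ n / fact n) * (spanning_prob {..<n} x * exp (t * unreached {..<n} x)) = gamma_weight n t x" for x
      proof -
        have "exp (- (t * (mass - unreached {..<n} x))) = ?e * exp (t * unreached {..<n} x)"
          by (simp add: mult_exp_exp algebra_simps)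
        then show ?thesis by (simp add: gamma_weight_def)
      qed
      then show "(\<integral>\<^sup>+x. ennreal (?e * (t ^ n / fact n)) * ennreal (spanning_prob {..<n} x * exp (t * unreached {..<n} x)) \<partial>power_measure {..<n})
         = (\<integral>\<^sup>+x. ennreal (gamma_weight n t x) \<partial>power_measure {..<n})"
        using t by (simp flip: ennreal_mult')
    qed measurable
    finally show "(\<Sum>j. ennreal (g n) * (ennreal (?e * (t ^ n / fact n)) * (ennreal (t ^ j / fact j) * spanning_integral n j)))
       = ennreal (g n) * (\<integral>\<^sup>+x. ennreal (gamma_weight n t x) \<partial>power_measure {..<n})" .
  qed
  finally show ?thesis .
qed

section \<open>Uniform smoothness in a window\<close>

lemma gamma_weight_bounds:
  assumes "0 \<le> t" "x \<in> space (power_measure {..<n})"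
  shows "0 \<le> gamma_weight n t x" "gamma_weight n t x \<le> t ^ n / fact n"
proof -
  have "spanning_prob {..<n} x * (t ^ n * exp (- (t * (mass - unreached {..<n} x)))) \<le> 1 * (t ^ n * 1)"
    using assms spanning_prob_bounds[of "{..<n}" x] unreached_le[OF assms(2)]
    by (intro mult_mono mult_nonneg_nonneg zero_le_power) auto
  then show "gamma_weight n t x \<le> t ^ n / fact n"
    unfolding gamma_weight_def by (intro divide_right_mono) auto
  show "0 \<le> gamma_weight n t x"
    using assms spanning_prob_bounds[of "{..<n}" x] by (simp add: gamma_weight_def)
qed

lemma measurable_gamma_weight [measurable]: "gamma_weight n t \<in> borel_measurable (power_measure {..<n})"
  unfolding gamma_weight_def by measurable

lemma integrable_gamma_weight: "0 \<le> t \<Longrightarrow> integrable (power_measure {..<n}) (gamma_weight n t)"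
  using gamma_weight_bounds[of t _ n]
  by (intro finite_measure.integrable_const_bound[OF finite_measure_power_measure, where B = "t ^ n / fact n"] AE_I2)
     auto

definition cluster_weight :: "nat \<Rightarrow> real \<Rightarrow> real" where
  "cluster_weight n t = (\<integral>x. gamma_weight n t x \<partial>power_measure {..<n})"

lemma ennreal_cluster_weight:
  "0 \<le> t \<Longrightarrow> (\<integral>\<^sup>+x. ennreal (gamma_weight n t x) \<partial>power_measure {..<n}) = ennreal (cluster_weight n t)"
  unfolding cluster_weight_def using gamma_weight_bounds
  by (intro nn_integral_eq_integral integrable_gamma_weight AE_I2) auto

lemma cluster_weight_nonneg: "0 \<le> t \<Longrightarrow> 0 \<le> cluster_weight n t"
  unfolding cluster_weight_def using gamma_weight_bounds by (intro integral_nonneg_AE AE_I2) auto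

lemma cluster_weight_sums:
  assumes t: "0 \<le> t" shows "(\<lambda>n. cluster_weight n t) sums cluster_number t"
proof -
  have "(\<Sum>k. ennreal (exp (- (mass * t)) * t ^ k / fact k) * total_clusters {..<k}) = (\<Sum>n. ennreal (cluster_weight n t))"
    using cluster_expansion[of "\<lambda>_. 1" t] t
    by (simp add: total_clusters_def num_clusters_def ennreal_cluster_weight)
  then have "(\<Sum>n. ennreal (cluster_weight n t)) = ennreal (cluster_number t)"
    using ennreal_cluster_number[OF t] by simp
  then have "(\<lambda>n. ennreal (cluster_weight n t)) sums ennreal (cluster_number t)"
    using summable_sums[OF summableI, of "\<lambda>n. ennreal (cluster_weight n t)"] by simp
  then show ?thesis using t by (simp add: cluster_weight_nonneg cluster_number_nonneg)
qed

text \<open>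
  The sizes of the clusters add up to the number of points, which has mean \<open>mass * t\<close>. At tilted
  intensities, this identity is what bounds the sums of the weights.
\<close>

lemma sized_cluster_weight_sums:
  assumes t: "0 \<le> t" shows "(\<lambda>n. real n * cluster_weight n t) sums (mass * t)"
proof -
  have "(\<Sum>k. ennreal (exp (- (mass * t)) * t ^ k / fact k) * ennreal (real k * mass ^ k))
      = (\<Sum>n. ennreal (real n) * ennreal (cluster_weight n t))"
  proof -
    have "graph_mean \<phi> x {..<k}
            (\<lambda>E. \<Sum>S\<in>cluster {..<k} (\<lambda>e. e \<in> E) ` {..<k}. real (card S)) = real k" for x and k :: nat
      by (subst sum_cluster_sizes) (auto simp: bernoulli_expectation_const)
    then have "(\<integral>\<^sup>+x. ennreal (graph_mean \<phi> x {..<k}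
            (\<lambda>E. \<Sum>S\<in>cluster {..<k} (\<lambda>e. e \<in> E) ` {..<k}. real (card S))) \<partial>power_measure {..<k})
       = ennreal (real k * mass ^ k)" for k :: nat
      by (simp add: emeasure_power_measure_space ennreal_mult)
    then show ?thesis using cluster_expansion[of real t] t by (simp add: ennreal_cluster_weight)
  qed
  moreover have "(\<Sum>k. ennreal (exp (- (mass * t)) * t ^ k / fact k) * ennreal (real k * mass ^ k)) = ennreal (mass * t)"
  proof -
    have "(\<lambda>k. (mass * t) ^ k /\<^sub>R fact k) sums exp (mass * t)" by (rule exp_converges)
    then have "(\<lambda>k. (mass * t * exp (- (mass * t))) * ((mass * t) ^ k /\<^sub>R fact k)) sums ((mass * t * exp (- (mass * t))) * exp (mass * t))"
      by (rule sums_mult)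
    moreover have "(mass * t * exp (- (mass * t))) * ((mass * t) ^ k /\<^sub>R fact k)
       = (exp (- (mass * t)) * t ^ Suc k / fact (Suc k)) * (real (Suc k) * mass ^ Suc k)" for k
      by (simp add: power_mult_distrib divide_simps del: of_nat_Suc)
    ultimately have "(\<lambda>k. (exp (- (mass * t)) * t ^ Suc k / fact (Suc k)) * (real (Suc k) * mass ^ Suc k)) sums (mass * t)"
      by (simp add: mult_exp_exp mult.assoc flip: exp_minus_inverse)
    then have "(\<lambda>k. (exp (- (mass * t)) * t ^ k / fact k) * (real k * mass ^ k)) sums (mass * t)"
      by (subst (asm) sums_Suc_iff) simp
    then have "(\<Sum>k. ennreal ((exp (- (mass * t)) * t ^ k / fact k) * (real k * mass ^ k))) = ennreal (mass * t)"
      using t by (intro suminf_ennreal_eq) auto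
    moreover have "ennreal ((exp (- (mass * t)) * t ^ k / fact k) * (real k * mass ^ k))
       = ennreal (exp (- (mass * t)) * t ^ k / fact k) * ennreal (real k * mass ^ k)" for k
      using t by (intro ennreal_mult) auto
    ultimately show ?thesis by (simp only:)
  qed
  ultimately have "(\<Sum>n. ennreal (real n * cluster_weight n t)) = ennreal (mass * t)"
    using t by (simp add: ennreal_mult cluster_weight_nonneg)
  then have "(\<lambda>n. ennreal (real n * cluster_weight n t)) sums ennreal (mass * t)"
    using summable_sums[OF summableI, of "\<lambda>n. ennreal (real n * cluster_weight n t)"] by simp
  then show ?thesis using t by (simp add: cluster_weight_nonneg)
qed

lemma cluster_weight_second_difference:
  fixes n :: nat and t \<delta> :: real and w :: "real \<Rightarrow> real"
  assumes t: "0 < t" and \<delta>: "0 < \<delta>" "\<delta> \<le> 1/2"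
  defines "w \<equiv> cluster_weight n"
  defines "p \<equiv> t * (1 + \<delta> ^ 3)" and "q \<equiv> t * (1 - \<delta> ^ 3)"
  shows "w p + w q \<le> 2 * w t + \<delta> ^ 4 * (20 * (n * w p + n * w q)
     + 150 * (n * w (p * (1 + \<delta>)) + n * w (p * (1 - \<delta>)) + n * w (q * (1 + \<delta>)) + n * w (q * (1 - \<delta>))))"
proof -
  have "\<delta> ^ 3 \<le> 1" using \<delta> by (intro power_le_one) auto
  then have nonneg: "0 \<le> p" "0 \<le> q" "0 \<le> t" "0 \<le> p * (1 + \<delta>)" "0 \<le> p * (1 - \<delta>)" "0 \<le> q * (1 + \<delta>)" "0 \<le> q * (1 - \<delta>)"
    using t \<delta> by (auto simp: p_def q_def intro!: mult_nonneg_nonneg add_nonneg_nonneg zero_le_power)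
  note int = nonneg[THEN integrable_gamma_weight[of _ n]]
  let ?g = "gamma_weight n"
  have pointwise: "?g p x + ?g q x \<le> 2 * ?g t x + \<delta> ^ 4 * (20 * (n * ?g p x + n * ?g q x)
     + 150 * (n * ?g (p * (1 + \<delta>)) x + n * ?g (p * (1 - \<delta>)) x + n * ?g (q * (1 + \<delta>)) x + n * ?g (q * (1 - \<delta>)) x))" for x
  proof (cases "n = 0")
    case True
    then show ?thesis by (simp add: gamma_weight_def spanning_prob_empty)
  next
    case False
    let ?s = "spanning_prob {..<n} x / fact n"
    define a where "a u = u ^ n * exp (- (u * (mass - unreached {..<n} x)))" for u
    have ga: "?g u x = ?s * a u" for u by (simp add: gamma_weight_def a_def)
    have "0 \<le> ?s" using spanning_prob_bounds[of "{..<n}" x] by simp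
    moreover have "a p + a q \<le> 2 * a t + n * (\<delta> ^ 4 * (20 * (a p + a q)
     + 150 * (a (p * (1 + \<delta>)) + a (p * (1 - \<delta>)) + a (q * (1 + \<delta>)) + a (q * (1 - \<delta>)))))"
      unfolding a_def p_def q_def using False by (intro gamma_weight_second_difference t \<delta>) simp
    ultimately have "?s * (a p + a q) \<le> ?s * (2 * a t + n * (\<delta> ^ 4 * (20 * (a p + a q)
     + 150 * (a (p * (1 + \<delta>)) + a (p * (1 - \<delta>)) + a (q * (1 + \<delta>)) + a (q * (1 - \<delta>))))))"
      by (rule mult_left_mono[rotated])
    then show ?thesis unfolding ga by (simp only: ring_distribs mult_ac)
  qed
  have "(\<integral>x. ?g p x + ?g q x \<partial>power_measure {..<n})
     \<le> (\<integral>x. 2 * ?g t x + \<delta> ^ 4 * (20 * (n * ?g p x + n * ?g q x)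
     + 150 * (n * ?g (p * (1 + \<delta>)) x + n * ?g (p * (1 - \<delta>)) x + n * ?g (q * (1 + \<delta>)) x + n * ?g (q * (1 - \<delta>)) x)) \<partial>power_measure {..<n})"
    by (intro integral_mono pointwise Bochner_Integration.integrable_add integrable_mult_right int)
  then show ?thesis unfolding w_def cluster_weight_def by (simp add: int)
qed

text \<open>
  By \<open>sized_cluster_weight_sums\<close>, the error terms at \<open>p\<close> and \<open>q\<close> sum up to
  \<open>20 * mass * (p + q) = 40 * mass * t\<close>, and those at the four tilted intensities to
  \<open>150 * mass * 2 * (p + q) = 600 * mass * t\<close>. The bound is proportional to \<open>mass\<close>, hence uniform in the
  window after division by the volume.
\<close>

lemma cluster_number_second_difference:
  assumes t: "0 < t" and \<delta>: "0 < \<delta>" "\<delta> \<le> 1/2"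
  shows "cluster_number (t * (1 + \<delta> ^ 3)) + cluster_number (t * (1 - \<delta> ^ 3)) - 2 * cluster_number t
     \<le> 640 * mass * t * \<delta> ^ 4"
proof -
  define p q where "p = t * (1 + \<delta> ^ 3)" and "q = t * (1 - \<delta> ^ 3)"
  have "\<delta> ^ 3 \<le> 1" using \<delta> by (intro power_le_one) auto
  then have nonneg: "0 \<le> p" "0 \<le> q" "0 \<le> t" "0 \<le> p * (1 + \<delta>)" "0 \<le> p * (1 - \<delta>)" "0 \<le> q * (1 + \<delta>)" "0 \<le> q * (1 - \<delta>)"
    using t \<delta> by (auto simp: p_def q_def intro!: mult_nonneg_nonneg add_nonneg_nonneg zero_le_power)
  note s = nonneg[THEN cluster_weight_sums] and ns = nonneg[THEN sized_cluster_weight_sums]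
  let ?w = cluster_weight
  have le: "?w n p + ?w n q \<le> 2 * ?w n t + \<delta> ^ 4 * (20 * (n * ?w n p + n * ?w n q)
     + 150 * (n * ?w n (p * (1 + \<delta>)) + n * ?w n (p * (1 - \<delta>)) + n * ?w n (q * (1 + \<delta>)) + n * ?w n (q * (1 - \<delta>))))" for n
    using cluster_weight_second_difference[OF t \<delta>, of n] by (simp only: p_def q_def)
  have A: "(\<lambda>n. ?w n p + ?w n q) sums (cluster_number p + cluster_number q)" by (intro sums_add s)
  have B: "(\<lambda>n. 2 * ?w n t + \<delta> ^ 4 * (20 * (n * ?w n p + n * ?w n q)
     + 150 * (n * ?w n (p * (1 + \<delta>)) + n * ?w n (p * (1 - \<delta>)) + n * ?w n (q * (1 + \<delta>)) + n * ?w n (q * (1 - \<delta>)))))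
     sums (2 * cluster_number t + \<delta> ^ 4 * (20 * (mass * p + mass * q)
     + 150 * (mass * (p * (1 + \<delta>)) + mass * (p * (1 - \<delta>)) + mass * (q * (1 + \<delta>)) + mass * (q * (1 - \<delta>)))))"
    by (intro sums_add sums_mult s ns)
  have "cluster_number p + cluster_number q \<le> 2 * cluster_number t + \<delta> ^ 4 * (20 * (mass * p + mass * q)
     + 150 * (mass * (p * (1 + \<delta>)) + mass * (p * (1 - \<delta>)) + mass * (q * (1 + \<delta>)) + mass * (q * (1 - \<delta>))))"
    by (rule sums_le[OF le A B])
  also have "20 * (mass * p + mass * q)
     + 150 * (mass * (p * (1 + \<delta>)) + mass * (p * (1 - \<delta>)) + mass * (q * (1 + \<delta>)) + mass * (q * (1 - \<delta>))) = 640 * mass * t"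
    by (simp add: p_def q_def algebra_simps)
  finally show ?thesis by (simp add: p_def q_def mult_ac)
qed

section \<open>The cluster of a root\<close>

lemma measurable_inverse_root_cluster [measurable]:
  "inverse_root_cluster \<phi> k \<in> borel_measurable (power_measure (insert k {..<k}))"
  using measurable_bernoulli_expectation[of "{..<Suc k}" "insert k {..<k}"]
  unfolding inverse_root_cluster_def by (simp add: lessThan_Suc)

text \<open>
  The mean of the inverse cluster size of a root placed at \<open>v\<close>, for a Poisson process with intensity
  measure \<open>t\<close> times \<open>\<mu>\<close>.
\<close>

definition rooted_mean :: "real \<Rightarrow> 'x \<Rightarrow> ennreal" where
  "rooted_mean t v = (\<Sum>k. ennreal (exp (- (mass * t)) * t ^ k / fact k) *
      (\<integral>\<^sup>+x. ennreal (inverse_root_cluster \<phi> k (x(k := v))) \<partial>power_measure {..<k}))"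

lemma measurable_rooted_mean_pair:
  "(\<lambda>(v, x). ennreal (inverse_root_cluster \<phi> k (x(k := v)))) \<in> borel_measurable (\<mu> \<Otimes>\<^sub>M power_measure {..<k})"
proof -
  have "(\<lambda>(v, x). x(k := v)) \<in> \<mu> \<Otimes>\<^sub>M power_measure {..<k} \<rightarrow>\<^sub>M power_measure (insert k {..<k})"
    by measurable
  then show ?thesis
    using measurable_compose[OF _ measurable_inverse_root_cluster] by (simp add: split_beta')
qed

lemma measurable_rooted_mean [measurable]: "rooted_mean t \<in> borel_measurable \<mu>"
proof -
  have "sigma_finite_measure (power_measure {..<k})" for k :: nat
    using finite_measure_power_measure[of "{..<k}"] by (simp add: finite_measure_def)
  then have [measurable]: "(\<lambda>v. \<integral>\<^sup>+x. ennreal (inverse_root_cluster \<phi> k (x(k := v))) \<partial>power_measure {..<k}) \<in> borel_measurable \<mu>" for k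
    using measurable_rooted_mean_pair by (rule sigma_finite_measure.borel_measurable_nn_integral)
  show ?thesis unfolding rooted_mean_def by measurable
qed

text \<open>
  Each cluster is counted by its vertices with weight one over its size, and all vertices play the
  same role, so that the last one can represent them all.
\<close>

lemma total_clusters_Suc:
  "total_clusters {..<Suc k} = of_nat (Suc k) * (\<integral>\<^sup>+v. \<integral>\<^sup>+x. ennreal (inverse_root_cluster \<phi> k (x(k := v))) \<partial>power_measure {..<k} \<partial>\<mu>)"
proof -
  let ?I = "{..<Suc k}"
  define R where "R i x = graph_mean \<phi> x ?I (\<lambda>E. 1 / real (card (cluster ?I (\<lambda>e. e \<in> E) i)))" for i x
  have R_nonneg: "0 \<le> R i x" for i x unfolding R_def by (intro bernoulli_expectation_edge_prob_nonneg) auto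
  have R_meas: "(\<lambda>x. ennreal (R i x)) \<in> borel_measurable (power_measure ?I)" for i
    unfolding R_def using measurable_bernoulli_expectation[of ?I ?I] by measurable
  have "total_clusters ?I = (\<integral>\<^sup>+x. (\<Sum>i\<in>?I. ennreal (R i x)) \<partial>power_measure ?I)"
    unfolding total_clusters_def sum_inverse_cluster_size[OF finite_lessThan, symmetric] bernoulli_expectation_sum
    using R_nonneg by (intro nn_integral_cong) (simp add: R_def del: sum.lessThan_Suc)
  also have "\<dots> = (\<Sum>i\<in>?I. \<integral>\<^sup>+x. ennreal (R i x) \<partial>power_measure ?I)"
    using R_meas by (intro nn_integral_sum)
  also have "\<dots> = (\<Sum>i\<in>?I. \<integral>\<^sup>+x. ennreal (R k x) \<partial>power_measure ?I)"
  proof (intro sum.cong refl)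
    fix i assume i: "i \<in> ?I"
    \<comment> \<open>exchanging \<open>i\<close> with the last vertex is a relabelling of the graph\<close>
    let ?\<pi> = "Transposition.transpose i k"
    have inj: "inj_on ?\<pi> ?I" by simp
    have img: "?\<pi> ` ?I = ?I" using i by (intro transpose_image_eq) auto
    have "card (cluster ?I (\<lambda>e. e \<in> (`) ?\<pi> ` E) i) = card (cluster ?I (\<lambda>e. e \<in> E) k)" if "E \<subseteq> vertex_pairs ?I" for E
      using card_cluster_image_edges[OF inj _ that, of k] img by simp
    then show "(\<integral>\<^sup>+x. ennreal (R i x) \<partial>power_measure ?I) = (\<integral>\<^sup>+x. ennreal (R k x) \<partial>power_measure ?I)"
      unfolding R_def using inj img by (intro nn_integral_bernoulli_relabel[where \<pi> = ?\<pi>]) (auto simp: bij_betw_def)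
  qed
  also have "\<dots> = of_nat (Suc k) * (\<integral>\<^sup>+x. ennreal (R k x) \<partial>power_measure ?I)" by simp
  also have "(\<integral>\<^sup>+x. ennreal (R k x) \<partial>power_measure ?I)
     = (\<integral>\<^sup>+v. \<integral>\<^sup>+x. ennreal (inverse_root_cluster \<phi> k (x(k := v))) \<partial>power_measure {..<k} \<partial>\<mu>)"
  proof -
    have "R k = inverse_root_cluster \<phi> k" by (simp add: R_def inverse_root_cluster_def fun_eq_iff)
    then show ?thesis
      using product_nn_integral_insert_rev[of "{..<k}" k "\<lambda>x. ennreal (inverse_root_cluster \<phi> k x)"]
      by (simp add: lessThan_Suc)
  qed
  finally show ?thesis .
qed

lemma cluster_number_eq_rooted_mean:
  assumes t: "0 \<le> t"
  shows "ennreal (cluster_number t) = ennreal t * (\<integral>\<^sup>+v. rooted_mean t v \<partial>\<mu>)"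
proof -
  have sf: "sigma_finite_measure (power_measure {..<k})" for k :: nat
    using finite_measure_power_measure[of "{..<k}"] by (simp add: finite_measure_def)
  have meas: "(\<lambda>v. \<integral>\<^sup>+x. ennreal (inverse_root_cluster \<phi> k (x(k := v))) \<partial>power_measure {..<k}) \<in> borel_measurable \<mu>" for k
    using sf measurable_rooted_mean_pair by (rule sigma_finite_measure.borel_measurable_nn_integral)
  let ?J = "\<lambda>k. \<integral>\<^sup>+v. \<integral>\<^sup>+x. ennreal (inverse_root_cluster \<phi> k (x(k := v))) \<partial>power_measure {..<k} \<partial>\<mu>"
  have "ennreal (cluster_number t) = (\<Sum>k. ennreal (exp (- (mass * t)) * t ^ Suc k / fact (Suc k)) * total_clusters {..<Suc k})"
  proof -
    have "total_clusters {..<0} = 0" using total_clusters_le[of "{..<0}"] by simp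
    then show ?thesis
      unfolding ennreal_cluster_number[OF t]
      by (subst suminf_offset[where i = 1]) (simp_all del: power_Suc fact_Suc)
  qed
  also have "\<dots> = (\<Sum>k. ennreal t * (ennreal (exp (- (mass * t)) * t ^ k / fact k) * ?J k))"
  proof (rule suminf_cong)
    fix k
    have "exp (- (mass * t)) * t ^ Suc k / fact (Suc k) * real (Suc k) = t * (exp (- (mass * t)) * t ^ k / fact k)"
      by (simp add: divide_simps del: of_nat_Suc)
    then have "ennreal (exp (- (mass * t)) * t ^ Suc k / fact (Suc k)) * of_nat (Suc k) = ennreal t * ennreal (exp (- (mass * t)) * t ^ k / fact k)"
      using t by (simp flip: ennreal_mult add: ennreal_of_nat_eq_real_of_nat del: power_Suc fact_Suc of_nat_Suc)
    then show "ennreal (exp (- (mass * t)) * t ^ Suc k / fact (Suc k)) * total_clusters {..<Suc k}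
       = ennreal t * (ennreal (exp (- (mass * t)) * t ^ k / fact k) * ?J k)"
      unfolding total_clusters_Suc by (simp only: mult.assoc[symmetric])
  qed
  also have "\<dots> = ennreal t * (\<Sum>k. \<integral>\<^sup>+v. ennreal (exp (- (mass * t)) * t ^ k / fact k) *
       (\<integral>\<^sup>+x. ennreal (inverse_root_cluster \<phi> k (x(k := v))) \<partial>power_measure {..<k}) \<partial>\<mu>)"
    using meas by (simp add: nn_integral_cmult)
  also have "\<dots> = ennreal t * (\<integral>\<^sup>+v. rooted_mean t v \<partial>\<mu>)"
    unfolding rooted_mean_def using meas by (subst nn_integral_suminf) auto
  finally show ?thesis .
qed

end

section \<open>Graphs on countable sets of points\<close>

lemma measurable_edge_indicator [measurable (raw)]:
  assumes "e \<in> S" shows "Measurable.pred (\<Pi>\<^sub>M e\<in>S. measure_pmf (bernoulli_pmf (a e))) (\<lambda>c. c e)"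
proof -
  have "(\<lambda>c. c e) \<in> (\<Pi>\<^sub>M e\<in>S. measure_pmf (bernoulli_pmf (a e))) \<rightarrow>\<^sub>M measure_pmf (bernoulli_pmf (a e))"
    using assms by (rule measurable_component_singleton)
  then show ?thesis by simp
qed

lemma measurable_edge_set_functional:
  fixes F :: "'e set \<Rightarrow> ennreal"
  assumes "finite S"
  shows "(\<lambda>c. F {e \<in> S. c e}) \<in> borel_measurable (\<Pi>\<^sub>M e\<in>S. measure_pmf (bernoulli_pmf (a e)))"
proof -
  have "F {e \<in> S. c e} = (\<Sum>E\<in>Pow S. if \<forall>e\<in>S. c e \<longleftrightarrow> e \<in> E then F E else 0)" for c
  proof -
    have "(\<forall>e\<in>S. c e \<longleftrightarrow> e \<in> E) \<longleftrightarrow> E = {e \<in> S. c e}" if "E \<in> Pow S" for E using that by auto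
    then have "(\<Sum>E\<in>Pow S. if \<forall>e\<in>S. c e \<longleftrightarrow> e \<in> E then F E else 0) = (\<Sum>E\<in>Pow S. if E = {e \<in> S. c e} then F E else 0)"
      by (intro sum.cong) simp_all
    then show ?thesis using assms by (simp add: sum.delta')
  qed
  moreover have "(\<lambda>c. if \<forall>e\<in>S. c e \<longleftrightarrow> e \<in> E then F E else 0)
      \<in> borel_measurable (\<Pi>\<^sub>M e\<in>S. measure_pmf (bernoulli_pmf (a e)))" for E
    using assms by (intro measurable_If) (auto intro!: pred_intros_finite measurable_edge_indicator)
  ultimately show ?thesis by simp
qed

lemma nn_integral_bernoulli_product:
  fixes F :: "'e set \<Rightarrow> real"
  assumes "finite S" "\<And>e. e \<in> S \<Longrightarrow> 0 \<le> a e \<and> a e \<le> 1" "\<And>E. 0 \<le> F E"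
  shows "(\<integral>\<^sup>+c. ennreal (F {e \<in> S. c e}) \<partial>(\<Pi>\<^sub>M e\<in>S. measure_pmf (bernoulli_pmf (a e))))
     = ennreal (bernoulli_expectation a S F)"
  using assms
proof (induction S arbitrary: F rule: finite_induct)
  case empty
  then show ?case by (simp add: PiM_empty nn_integral_count_space_finite)
next
  case (insert e S)
  interpret product_prob_space "\<lambda>e. measure_pmf (bernoulli_pmf (a e))" UNIV ..
  let ?P = "\<lambda>S. \<Pi>\<^sub>M e\<in>S. measure_pmf (bernoulli_pmf (a e))"
  have upd: "{f \<in> insert e S. (c(e := b)) f} = (if b then insert e {f \<in> S. c f} else {f \<in> S. c f})" for c b
    using insert.hyps by auto
  have "(\<integral>\<^sup>+c. ennreal (F {f \<in> insert e S. c f}) \<partial>?P (insert e S))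
     = (\<integral>\<^sup>+c. \<integral>\<^sup>+b. ennreal (F {f \<in> insert e S. (c(e := b)) f}) \<partial>bernoulli_pmf (a e) \<partial>?P S)"
    using insert.hyps by (intro product_nn_integral_insert measurable_edge_set_functional[of _ "\<lambda>E. ennreal (F E)"]) auto
  also have "\<dots> = (\<integral>\<^sup>+c. ennreal (a e) * ennreal (F (insert e {f \<in> S. c f})) + ennreal (1 - a e) * ennreal (F {f \<in> S. c f}) \<partial>?P S)"
    unfolding upd using insert.prems by (intro nn_integral_cong) (simp add: mult.commute)
  also have "\<dots> = ennreal (a e) * (\<integral>\<^sup>+c. ennreal (F (insert e {f \<in> S. c f})) \<partial>?P S)
      + ennreal (1 - a e) * (\<integral>\<^sup>+c. ennreal (F {f \<in> S. c f}) \<partial>?P S)"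
    using measurable_edge_set_functional[OF insert.hyps(1), of "\<lambda>E. ennreal (F E)" a]
      measurable_edge_set_functional[OF insert.hyps(1), of "\<lambda>E. ennreal (F (insert e E))" a]
    by (simp add: nn_integral_add nn_integral_cmult)
  also have "\<dots> = ennreal (bernoulli_expectation a (insert e S) F)"
  proof -
    have nonneg: "0 \<le> bernoulli_expectation a S G" if "\<And>E. 0 \<le> G E" for G
      unfolding bernoulli_expectation_def using that insert.prems(1)
      by (intro sum_nonneg mult_nonneg_nonneg prod_nonneg) auto
    show ?thesis
      using insert.IH[of F] insert.IH[of "\<lambda>E. F (insert e E)"] insert.prems nonneg
      by (simp add: bernoulli_expectation_insert[OF insert.hyps(1,2)] ennreal_mult)
  qed
  finally show ?case .
qed

text \<open>
  The conditional mean of the inverse cluster size of \<open>v\<close>, given that \<open>W\<close> is the set of points of the process.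
\<close>

definition mean_inverse_cluster :: "('x \<Rightarrow> 'x \<Rightarrow> real) \<Rightarrow> 'x \<Rightarrow> 'x set \<Rightarrow> ennreal" where
  "mean_inverse_cluster \<phi> v W =
     (\<integral>\<^sup>+c. inverse (num_points (cluster (insert v W) c v)) \<partial>edge_law \<phi> (insert v W))"

lemma inverse_num_points_finite:
  assumes "finite A" "A \<noteq> {}" shows "inverse (num_points A) = ennreal (1 / real (card A))"
  using assms by (simp add: num_points_def ennreal_of_nat_eq_real_of_nat inverse_ennreal card_gt_0_iff inverse_eq_divide)

lemma mean_inverse_cluster_finite:
  assumes sym: "\<And>v w. \<phi> v w = \<phi> w v" and bounds: "\<And>v w. 0 \<le> \<phi> v w \<and> \<phi> v w \<le> 1"
    and inj: "inj_on x {..<k}" and v: "v \<notin> x ` {..<k}"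
  shows "mean_inverse_cluster \<phi> v (x ` {..<k}) = ennreal (inverse_root_cluster \<phi> k (x(k := v)))"
proof -
  let ?z = "x(k := v)" and ?I = "{..<Suc k}"
  have inj_z: "inj_on ?z ?I"
    using inj v by (auto simp: inj_on_def lessThan_Suc image_iff)
  have W: "insert v (x ` {..<k}) = ?z ` ?I" by (force simp: lessThan_Suc)
  define V where "V = ?z ` ?I"
  have V: "finite V" "v \<in> V" by (auto simp: V_def)
  have "mean_inverse_cluster \<phi> v (x ` {..<k})
     = (\<integral>\<^sup>+c. ennreal (1 / real (card (cluster V (\<lambda>e. e \<in> {e \<in> vertex_pairs V. c e}) v))) \<partial>edge_law \<phi> V)"
    unfolding mean_inverse_cluster_def W V_def[symmetric]
  proof (intro nn_integral_cong)
    fix c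
    have "cluster V c v = cluster V (\<lambda>e. e \<in> {e \<in> vertex_pairs V. c e}) v" by (rule cluster_cong) auto
    then show "inverse (num_points (cluster V c v)) = ennreal (1 / real (card (cluster V (\<lambda>e. e \<in> {e \<in> vertex_pairs V. c e}) v)))"
      using inverse_num_points_finite[OF finite_cluster[OF V], of c] mem_cluster_self[of v V c] by (auto simp del: mem_cluster_self)
  qed
  also have "\<dots> = ennreal (bernoulli_expectation (pair_prob \<phi>) (vertex_pairs V) (\<lambda>E. 1 / real (card (cluster V (\<lambda>e. e \<in> E) v))))"
    unfolding edge_law_def
  proof (rule nn_integral_bernoulli_product)
    show "0 \<le> pair_prob \<phi> e \<and> pair_prob \<phi> e \<le> 1" if "e \<in> vertex_pairs V" for e
      using that by (rule vertex_pairsE) (simp add: pair_prob_eq[of \<phi>, OF sym] bounds)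
  qed (use V in auto)
  also have "bernoulli_expectation (pair_prob \<phi>) (vertex_pairs V) (\<lambda>E. 1 / real (card (cluster V (\<lambda>e. e \<in> E) v)))
     = inverse_root_cluster \<phi> k ?z"
  proof -
    have "card (cluster V (\<lambda>e. e \<in> (`) ?z ` E) v) = card (cluster ?I (\<lambda>e. e \<in> E) k)" if "E \<subseteq> vertex_pairs ?I" for E
      using card_cluster_image_edges[OF inj_z _ that, of k] by (simp add: V_def)
    then have "graph_mean \<phi> (\<lambda>v. v) (?z ` ?I) (\<lambda>E. 1 / real (card (cluster V (\<lambda>e. e \<in> E) v)))
       = graph_mean \<phi> (\<lambda>i. ?z i) ?I (\<lambda>E. 1 / real (card (cluster ?I (\<lambda>e. e \<in> E) k)))"
      by (intro bernoulli_expectation_relabel[of \<phi>, OF sym inj_z]) simp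
    then show ?thesis by (simp add: V_def inverse_root_cluster_def edge_prob_def)
  qed
  finally show ?thesis .
qed

lemma adjacency_mono: "V \<subseteq> W \<Longrightarrow> adjacency V c \<subseteq> adjacency W c"
  using vertex_pairs_mono[of V W] by (auto simp: adjacency_def)

lemma measurable_num_points_cluster:
  assumes V: "countable V" and W: "W \<subseteq> V" and v: "v \<in> W"
  shows "(\<lambda>c. num_points (cluster W c v)) \<in> borel_measurable (edge_law \<phi> V)"
proof -
  have W': "countable W" using V W countable_subset by auto
  have edge: "Measurable.pred (edge_law \<phi> V) (\<lambda>c. (x, y) \<in> adjacency W c)" for x y
  proof (cases "{x, y} \<in> vertex_pairs W")
    case True
    then have "{x, y} \<in> vertex_pairs V" using vertex_pairs_mono[OF W] by auto
    then have "Measurable.pred (edge_law \<phi> V) (\<lambda>c. c {x, y})" unfolding edge_law_def by (rule measurable_edge_indicator)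
    then show ?thesis using True by (simp add: adjacency_def)
  qed (simp add: adjacency_def)
  have path: "Measurable.pred (edge_law \<phi> V) (\<lambda>c. (v, y) \<in> adjacency W c ^^ n)" for n y
  proof (induction n arbitrary: y)
    case (Suc n)
    have "(v, y) \<in> adjacency W c ^^ Suc n \<longleftrightarrow> (\<exists>z\<in>W. (v, z) \<in> adjacency W c ^^ n \<and> (z, y) \<in> adjacency W c)" for c
      by (auto simp: adjacency_def vertex_pairs_doubleton_iff)
    moreover have "Measurable.pred (edge_law \<phi> V) (\<lambda>c. \<exists>z\<in>W. (v, z) \<in> adjacency W c ^^ n \<and> (z, y) \<in> adjacency W c)"
    proof -
      have "(\<exists>z\<in>W. (v, z) \<in> adjacency W c ^^ n \<and> (z, y) \<in> adjacency W c)
        \<longleftrightarrow> (\<exists>i. (v, from_nat_into W i) \<in> adjacency W c ^^ n \<and> (from_nat_into W i, y) \<in> adjacency W c)" for c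
        using range_from_nat_into[OF _ W'] v by (metis empty_iff rangeE rangeI)
      then show ?thesis by (simp only:) (intro pred_intros_countable pred_intros_logic Suc edge)
    qed
    ultimately show ?case by simp
  qed simp
  have mem: "Measurable.pred (edge_law \<phi> V) (\<lambda>c. y \<in> cluster W c v)" for y
  proof -
    have "y \<in> cluster W c v \<longleftrightarrow> (\<exists>n. (v, y) \<in> adjacency W c ^^ n)" for c
      by (simp add: mem_cluster_iff rtrancl_power)
    then show ?thesis using path by simp
  qed
  have eq: "num_points (cluster W c v) = (\<integral>\<^sup>+y. indicator (cluster W c v) y \<partial>count_space W)" for c
    using cluster_subset[OF v, of c] by (simp add: num_points_def emeasure_count_space)
  interpret W: sigma_finite_measure "count_space W" using W' by (rule sigma_finite_measure_count_space_countable)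
  have "(\<lambda>(c, y). indicator (cluster W c v) y :: ennreal) \<in> borel_measurable (edge_law \<phi> V \<Otimes>\<^sub>M count_space W)"
    using W' mem
    by (subst measurable_pair_swap_iff, intro measurable_pair_measure_countable1) (auto simp: indicator_def)
  then show ?thesis unfolding eq by (intro W.borel_measurable_nn_integral)
qed

text \<open>
  The edges between vertices of \<open>W\<close> have the same law in both graphs.
\<close>

lemma nn_integral_edge_law_restrict:
  assumes V: "countable V" and W: "W \<subseteq> V" and v: "v \<in> W"
  shows "(\<integral>\<^sup>+c. inverse (num_points (cluster W c v)) \<partial>edge_law \<phi> W)
       = (\<integral>\<^sup>+c. inverse (num_points (cluster W c v)) \<partial>edge_law \<phi> V)"
proof -
  let ?r = "\<lambda>c. \<lambda>e\<in>vertex_pairs W. c e"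
  have sub: "vertex_pairs W \<subseteq> vertex_pairs V" using W by (rule vertex_pairs_mono)
  have distr: "distr (edge_law \<phi> V) (edge_law \<phi> W) ?r = edge_law \<phi> W"
    unfolding edge_law_def using sub
    by (intro distr_PiM_reindex[where f = "\<lambda>e. e", simplified]) (auto intro: prob_space_measure_pmf)
  have meas: "?r \<in> edge_law \<phi> V \<rightarrow>\<^sub>M edge_law \<phi> W"
    unfolding edge_law_def using sub by (rule measurable_restrict_subset)
  have W': "countable W" using V W countable_subset by auto
  have "(\<integral>\<^sup>+c. inverse (num_points (cluster W c v)) \<partial>edge_law \<phi> W)
      = (\<integral>\<^sup>+c. inverse (num_points (cluster W c v)) \<partial>distr (edge_law \<phi> V) (edge_law \<phi> W) ?r)"
    by (simp only: distr)
  also have "\<dots> = (\<integral>\<^sup>+c. inverse (num_points (cluster W (?r c) v)) \<partial>edge_law \<phi> V)"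
    using measurable_num_points_cluster[OF W' order_refl v, of \<phi>] by (intro nn_integral_distr meas) measurable
  also have "\<dots> = (\<integral>\<^sup>+c. inverse (num_points (cluster W c v)) \<partial>edge_law \<phi> V)"
  proof (intro nn_integral_cong)
    fix c
    have "cluster W (?r c) v = cluster W c v" by (intro cluster_cong) auto
    then show "inverse (num_points (cluster W (?r c) v)) = inverse (num_points (cluster W c v))" by simp
  qed
  finally show ?thesis .
qed

text \<open>
  A path visits finitely many vertices, all of which belong to some \<open>W n\<close>.
\<close>

lemma cluster_eq_UN:
  assumes W: "incseq W" "(\<Union>n. W n) = V"
  shows "cluster V c v = (\<Union>n. cluster (W n) c v)"
proof (rule antisym)
  have mono: "cluster (W m) c v \<subseteq> cluster (W n) c v" if "m \<le> n" for m n
    by (intro cluster_mono adjacency_mono incseqD[OF W(1) that])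
  show "cluster V c v \<subseteq> (\<Union>n. cluster (W n) c v)"
  proof (rule cluster_closed)
    fix x y assume "x \<in> (\<Union>n. cluster (W n) c v)" and xy: "(x, y) \<in> adjacency V c"
    then obtain k where k: "x \<in> cluster (W k) c v" by auto
    obtain i j where ij: "x \<in> W i" "y \<in> W j" using xy W(2) by (auto simp: adjacency_def vertex_pairs_doubleton_iff)
    define n where "n = max k (max i j)"
    have "x \<in> W n" "y \<in> W n" "x \<in> cluster (W n) c v"
      using ij k subsetD[OF incseqD[OF W(1), of i n]] subsetD[OF incseqD[OF W(1), of j n]]
        subsetD[OF mono[of k n]] by (simp_all add: n_def)
    moreover from this xy have "(x, y) \<in> adjacency (W n) c" by (auto simp: adjacency_def vertex_pairs_doubleton_iff)
    ultimately have "y \<in> cluster (W n) c v" by (auto simp: mem_cluster_iff intro: rtrancl_into_rtrancl)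
    then show "y \<in> (\<Union>n. cluster (W n) c v)" by auto
  qed simp
  have "W n \<subseteq> V" for n using W(2) by auto
  then have "cluster (W n) c v \<subseteq> cluster V c v" for n
    by (intro cluster_mono adjacency_mono)
  then show "(\<Union>n. cluster (W n) c v) \<subseteq> cluster V c v" by auto
qed

lemma mean_inverse_cluster_le_1: "mean_inverse_cluster \<phi> v W \<le> 1"
proof -
  have "mean_inverse_cluster \<phi> v W \<le> (\<integral>\<^sup>+c. 1 \<partial>edge_law \<phi> (insert v W))"
    unfolding mean_inverse_cluster_def by (intro nn_integral_mono inverse_cluster_size_le_1)
  then show ?thesis using prob_space.emeasure_space_1[OF prob_space_edge_law[of \<phi> "insert v W"]] by simp
qed

lemma ennreal_inverse_antimono: "(a :: ennreal) \<le> b \<Longrightarrow> inverse b \<le> inverse a"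
proof (cases "a = 0 \<or> b = top")
  case False
  assume "a \<le> b"
  with False obtain r s where "a = ennreal r" "b = ennreal s" "0 < r" "r \<le> s"
    by (cases a; cases b) (auto simp: top_unique less_le)
  then show ?thesis by (simp add: inverse_ennreal le_imp_inverse_le ennreal_leI)
qed auto

lemma mean_inverse_cluster_antimono:
  assumes "countable V" "W \<subseteq> V"
  shows "mean_inverse_cluster \<phi> v V \<le> mean_inverse_cluster \<phi> v W"
proof -
  have "mean_inverse_cluster \<phi> v W = (\<integral>\<^sup>+c. inverse (num_points (cluster (insert v W) c v)) \<partial>edge_law \<phi> (insert v V))"
    unfolding mean_inverse_cluster_def using assms by (intro nn_integral_edge_law_restrict) auto
  moreover have "num_points (cluster (insert v W) c v) \<le> num_points (cluster (insert v V) c v)" for c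
    unfolding num_points_def using assms(2)
    by (intro emeasure_mono cluster_mono adjacency_mono) auto
  ultimately show ?thesis
    unfolding mean_inverse_cluster_def by (auto intro!: nn_integral_mono intro: ennreal_inverse_antimono)
qed

text \<open>
  The cluster sizes increase to the size of the whole cluster, even if that is infinite; the inverse
  sizes are bounded by one.
\<close>

lemma mean_inverse_cluster_tendsto:
  assumes V: "countable V" and W: "incseq W" "(\<Union>n. W n) = V"
  shows "(\<lambda>n. mean_inverse_cluster \<phi> v (W n)) \<longlonglongrightarrow> mean_inverse_cluster \<phi> v V"
proof -
  let ?V = "insert v V" and ?W = "\<lambda>n. insert v (W n)"
  have V': "countable ?V" using V by simp
  have W': "incseq ?W" "(\<Union>n. ?W n) = ?V" using W by (auto simp: incseq_def)
  have sub: "?W n \<subseteq> ?V" for n using W by auto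
  have meas: "(\<lambda>c. inverse (num_points (cluster (?W n) c v))) \<in> borel_measurable (edge_law \<phi> ?V)" for n
    using measurable_num_points_cluster[OF V' sub, of v n \<phi>] by measurable
  have measV: "(\<lambda>c. inverse (num_points (cluster ?V c v))) \<in> borel_measurable (edge_law \<phi> ?V)"
    using measurable_num_points_cluster[OF V' order_refl, of v \<phi>] by measurable
  have lim: "(\<lambda>n. inverse (num_points (cluster (?W n) c v))) \<longlonglongrightarrow> inverse (num_points (cluster ?V c v))" for c
  proof -
    have "incseq (\<lambda>n. cluster (?W n) c v)"
      by (intro monoI cluster_mono adjacency_mono incseqD[OF W'(1)])
    then have *: "(\<lambda>n. num_points (cluster (?W n) c v)) \<longlonglongrightarrow> num_points (\<Union>n. cluster (?W n) c v)"
      unfolding num_points_def by (intro Lim_emeasure_incseq) auto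
    have "isCont inverse (x :: ennreal)" for x
      using continuous_on_inverse_ennreal[OF continuous_on_id, of UNIV]
      by (simp add: continuous_on_eq_continuous_at)
    then show ?thesis unfolding cluster_eq_UN[OF W'] using * by (rule isCont_tendsto_compose)
  qed
  have "(\<lambda>n. \<integral>\<^sup>+c. inverse (num_points (cluster (?W n) c v)) \<partial>edge_law \<phi> ?V)
      \<longlonglongrightarrow> (\<integral>\<^sup>+c. inverse (num_points (cluster ?V c v)) \<partial>edge_law \<phi> ?V)"
  proof (rule nn_integral_dominated_convergence[where w = "\<lambda>_. 1"])
    show "(\<integral>\<^sup>+c. 1 \<partial>edge_law \<phi> ?V) < \<infinity>"
      using prob_space.emeasure_space_1[OF prob_space_edge_law[of \<phi> ?V]] by simp
  qed (use lim meas measV in \<open>auto intro: inverse_cluster_size_le_1\<close>)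
  moreover have "(\<integral>\<^sup>+c. inverse (num_points (cluster (?W n) c v)) \<partial>edge_law \<phi> ?V) = mean_inverse_cluster \<phi> v (W n)" for n
    unfolding mean_inverse_cluster_def using V' sub by (intro nn_integral_edge_law_restrict[symmetric]) auto
  ultimately show ?thesis by (simp add: mean_inverse_cluster_def)
qed

section \<open>The law of a Poisson process in a window\<close>

lemma num_points_eq_of_nat_iff: "num_points A = of_nat k \<longleftrightarrow> finite A \<and> card A = k"
  by (auto simp: num_points_def emeasure_count_space)

text \<open>
  The values are chosen one after the other: the value at \<open>i\<close> has to lie in the class \<open>D (\<tau> i)\<close> and
  to differ from the values that have already been chosen from that class.
\<close>

lemma card_coloured_injections:
  fixes F :: "'x set" and D :: "'c \<Rightarrow> 'x set"
  assumes F: "finite F" and D: "\<And>c. c \<in> C \<Longrightarrow> D c \<subseteq> F" "disjoint_family_on D C" and C: "finite C"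
    and I: "finite I" and \<tau>: "\<tau> ` I \<subseteq> C"
  shows "card {x \<in> I \<rightarrow>\<^sub>E F. inj_on x I \<and> (\<forall>i\<in>I. x i \<in> D (\<tau> i))}
       = (\<Prod>c\<in>C. \<Prod>j<card {i \<in> I. \<tau> i = c}. card (D c) - j)"
  using I \<tau>
proof (induction I rule: finite_induct)
  case empty
  then show ?case by simp
next
  case (insert i I)
  let ?X = "\<lambda>I. {x \<in> I \<rightarrow>\<^sub>E F. inj_on x I \<and> (\<forall>i\<in>I. x i \<in> D (\<tau> i))}"
  let ?m = "\<lambda>I c. card {i \<in> I. \<tau> i = c}"
  let ?c = "\<tau> i"
  have c: "?c \<in> C" using insert.prems by simp
  have finX: "finite (?X I)" using insert.hyps F by (intro finite_subset[OF _ finite_PiE[of I "\<lambda>_. F"]]) auto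
  have finD: "finite (D ?c)" using D c F finite_subset by blast
  have "bij_betw (\<lambda>(x, y). x(i := y)) (SIGMA x:?X I. D ?c - x ` I) (?X (insert i I))"
  proof (rule bij_betwI[where g = "\<lambda>z. (z(i := undefined), z i)"])
    show "(\<lambda>(x, y). x(i := y)) \<in> (SIGMA x:?X I. D ?c - x ` I) \<rightarrow> ?X (insert i I)"
    proof
      fix p assume p: "p \<in> (SIGMA x:?X I. D ?c - x ` I)"
      obtain x y where xy: "p = (x, y)" "x \<in> ?X I" "y \<in> D ?c" "y \<notin> x ` I" using p by auto
      have "x(i := y) \<in> insert i I \<rightarrow>\<^sub>E F" using xy D(1)[OF c] by (auto simp: PiE_iff extensional_def)
      moreover have "inj_on (x(i := y)) (insert i I)"
        using xy insert.hyps by (auto simp: inj_on_def)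
      moreover have "\<forall>j\<in>insert i I. (x(i := y)) j \<in> D (\<tau> j)" using xy by auto
      ultimately show "(case p of (x, y) \<Rightarrow> x(i := y)) \<in> ?X (insert i I)" by (simp add: xy(1))
    qed
    show "(\<lambda>z. (z(i := undefined), z i)) \<in> ?X (insert i I) \<rightarrow> (SIGMA x:?X I. D ?c - x ` I)"
    proof
      fix z assume z: "z \<in> ?X (insert i I)"
      have "z(i := undefined) \<in> I \<rightarrow>\<^sub>E F" using z insert.hyps by (auto simp: PiE_iff extensional_def)
      moreover have "inj_on (z(i := undefined)) I" using z insert.hyps by (auto simp: inj_on_def)
      moreover have "\<forall>j\<in>I. (z(i := undefined)) j \<in> D (\<tau> j)" using z insert.hyps by auto
      moreover have "z i \<in> D ?c - (z(i := undefined)) ` I" using z insert.hyps by (auto simp: inj_on_def)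
      ultimately show "(z(i := undefined), z i) \<in> (SIGMA x:?X I. D ?c - x ` I)" by auto
    qed
    show "(\<lambda>z. (z(i := undefined), z i)) ((\<lambda>(x, y). x(i := y)) p) = p"
      if p: "p \<in> (SIGMA x:?X I. D ?c - x ` I)" for p
    proof -
      obtain x y where xy: "p = (x, y)" "x \<in> I \<rightarrow>\<^sub>E F" using p by auto
      then have "x i = undefined" using insert.hyps by (auto simp: PiE_iff extensional_def)
      then have "x(i := undefined) = x" by (rule fun_upd_idem)
      then show ?thesis by (simp add: xy)
    qed
    show "(\<lambda>(x, y). x(i := y)) ((\<lambda>z. (z(i := undefined), z i)) z) = z" for z by simp
  qed
  then have "card (?X (insert i I)) = card (SIGMA x:?X I. D ?c - x ` I)" by (rule bij_betw_same_card[symmetric])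
  also have "\<dots> = (\<Sum>x\<in>?X I. card (D ?c - x ` I))" using finX finD by (intro card_SigmaI) auto
  also have "\<dots> = (\<Sum>x\<in>?X I. card (D ?c) - ?m I ?c)"
  proof (intro sum.cong refl)
    fix x assume x: "x \<in> ?X I"
    have "D ?c \<inter> x ` I = x ` {j \<in> I. \<tau> j = ?c}"
    proof (intro set_eqI iffI)
      fix y assume "y \<in> D ?c \<inter> x ` I"
      then obtain j where j: "j \<in> I" "y = x j" "x j \<in> D ?c" by auto
      have "x j \<in> D (\<tau> j)" "\<tau> j \<in> C" using x j insert.prems by auto
      then have "\<tau> j = ?c" using disjoint_family_onD[OF D(2) _ c, of "\<tau> j"] j by blast
      then show "y \<in> x ` {j \<in> I. \<tau> j = ?c}" using j by auto
    qed (use x in auto)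
    then have "card (D ?c \<inter> x ` I) = ?m I ?c"
      using x by (simp add: card_image inj_on_subset[of x I])
    then show "card (D ?c - x ` I) = card (D ?c) - ?m I ?c"
      using insert.hyps finD by (subst card_Diff_subset_Int) auto
  qed
  also have "\<dots> = card (?X I) * (card (D ?c) - ?m I ?c)" by simp
  also have "card (?X I) = (\<Prod>c\<in>C. \<Prod>j<?m I c. card (D c) - j)" using insert by simp
  also have "(\<Prod>c\<in>C. \<Prod>j<?m I c. card (D c) - j) * (card (D ?c) - ?m I ?c)
     = (\<Prod>c\<in>C. \<Prod>j<?m (insert i I) c. card (D c) - j)"
  proof -
    have "{j \<in> insert i I. \<tau> j = ?c} = insert i {j \<in> I. \<tau> j = ?c}" by auto
    then have same: "?m (insert i I) ?c = Suc (?m I ?c)" using insert.hyps by simp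
    have other: "?m (insert i I) c = ?m I c" if "c \<in> C - {?c}" for c
      using that by (intro arg_cong[of _ _ card]) auto
    show ?thesis
      unfolding prod.remove[OF C c] same using other by simp
  qed
  finally show ?case .
qed

lemma prod_falling_eq_fact: "(\<Prod>j<n. n - j) = fact n"
  by (simp add: fact_prod_rev lessThan_atLeast0)

text \<open>
  The sets \<open>atom S n A J\<close> with \<open>J \<subseteq> {..<n}\<close> are the atoms of the algebra on \<open>S\<close> generated by
  \<open>A 0, \<dots>, A (n - 1)\<close>.
\<close>

definition atom :: "'x set \<Rightarrow> nat \<Rightarrow> (nat \<Rightarrow> 'x set) \<Rightarrow> nat set \<Rightarrow> 'x set" where
  "atom S n A J = {x \<in> S. \<forall>i<n. x \<in> A i \<longleftrightarrow> i \<in> J}"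

lemma atom_sets:
  assumes A: "\<And>i. i < n \<Longrightarrow> A i \<in> sets \<mu>" shows "atom (space \<mu>) n A J \<in> sets \<mu>"
proof -
  have "atom (space \<mu>) n A J = {x \<in> space \<mu>. \<forall>i\<in>{..<n}. x \<in> A i \<longleftrightarrow> i \<in> J}" by (auto simp: atom_def)
  also have "\<dots> \<in> sets \<mu>"
  proof (intro sets.sets_Collect_finite_All)
    fix i assume "i \<in> {..<n}"
    then have "{x \<in> space \<mu>. x \<in> A i \<longleftrightarrow> i \<in> J} = (if i \<in> J then A i else space \<mu> - A i)"
      using sets.sets_into_space[OF A, of i] by auto
    then show "{x \<in> space \<mu>. x \<in> A i \<longleftrightarrow> i \<in> J} \<in> sets \<mu>" using A \<open>i \<in> {..<n}\<close> by auto
  qed simp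
  finally show ?thesis .
qed

text \<open>
  Independence of a Poisson process concerns disjoint sets. A rectangle whose sides may overlap is
  therefore cut into rectangles whose sides are equal or disjoint.
\<close>

lemma emeasure_rectangle_atoms:
  fixes M :: "(nat \<Rightarrow> 'x) measure"
  assumes M: "sets M = sets (\<Pi>\<^sub>M i\<in>{..<n}. \<mu>)" and A: "\<And>i. i < n \<Longrightarrow> A i \<in> sets \<mu>"
  shows "emeasure M (Pi\<^sub>E {..<n} A)
    = (\<Sum>\<tau>\<in>(\<Pi>\<^sub>E i\<in>{..<n}. {J \<in> Pow {..<n}. i \<in> J}). emeasure M (Pi\<^sub>E {..<n} (\<lambda>i. atom (space \<mu>) n A (\<tau> i))))"
proof -
  let ?T = "\<Pi>\<^sub>E i\<in>{..<n}. {J \<in> Pow {..<n}. i \<in> J}"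
  let ?R = "\<lambda>\<tau>. Pi\<^sub>E {..<n} (\<lambda>i. atom (space \<mu>) n A (\<tau> i))"
  have atom: "atom (space \<mu>) n A J \<in> sets \<mu>" for J using A by (rule atom_sets)
  have "Pi\<^sub>E {..<n} A = (\<Union>\<tau>\<in>?T. ?R \<tau>)"
  proof (intro set_eqI iffI)
    fix x assume x: "x \<in> Pi\<^sub>E {..<n} A"
    define \<tau> where "\<tau> = (\<lambda>i\<in>{..<n}. {j\<in>{..<n}. x i \<in> A j})"
    have "\<tau> \<in> ?T" using x by (auto simp: \<tau>_def)
    moreover have "x \<in> ?R \<tau>" using x A[THEN sets.sets_into_space] by (auto simp: \<tau>_def atom_def PiE_iff)
    ultimately show "x \<in> (\<Union>\<tau>\<in>?T. ?R \<tau>)" by blast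
  next
    fix x assume "x \<in> (\<Union>\<tau>\<in>?T. ?R \<tau>)"
    then show "x \<in> Pi\<^sub>E {..<n} A" by (auto simp: atom_def PiE_iff)
  qed
  then have "emeasure M (Pi\<^sub>E {..<n} A) = emeasure M (\<Union>\<tau>\<in>?T. ?R \<tau>)" by simp
  also have "\<dots> = (\<Sum>\<tau>\<in>?T. emeasure M (?R \<tau>))"
  proof (rule sum_emeasure[symmetric])
    show "finite ?T" by (intro finite_PiE) auto
    show "?R ` ?T \<subseteq> sets M" unfolding M using atom by (auto intro!: sets_PiM_I_finite)
    show "disjoint_family_on ?R ?T" unfolding disjoint_family_on_def
    proof (intro ballI impI)
      fix \<sigma> \<tau> assume st: "\<sigma> \<in> ?T" "\<tau> \<in> ?T" "\<sigma> \<noteq> \<tau>"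
      then obtain i where i: "i < n" "\<sigma> i \<noteq> \<tau> i" using PiE_ext[OF st(1,2)] by blast
      have "\<sigma> i \<subseteq> {..<n}" "\<tau> i \<subseteq> {..<n}" using st i by (auto simp: PiE_iff)
      then obtain j where "j < n" "j \<in> \<sigma> i \<longleftrightarrow> j \<notin> \<tau> i" using i(2) by blast
      then show "?R \<sigma> \<inter> ?R \<tau> = {}" using i by (auto simp: atom_def PiE_iff)
    qed
  qed
  finally show ?thesis .
qed

text \<open>
  In the window \<open>B\<close>, the intensity measure \<open>\<nu>\<close> is \<open>t\<close> times the finite measure \<open>\<mu>\<close>. Separating the factor
  \<open>t\<close> allows it to vary while \<open>\<mu>\<close> is kept.
\<close>

locale poisson_window =
  fixes P :: "'w measure" and \<eta> :: "'w \<Rightarrow> 'x set" and \<nu> :: "'x measure" and B :: "'x set"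
    and t :: real and \<mu> :: "'x measure"
  assumes poisson: "poisson_process P \<eta> \<nu>" and window_sets: "B \<in> sets \<nu>" and t_nonneg: "0 \<le> t"
    and finite_window: "finite_measure \<mu>" and sets_eq: "sets \<mu> = sets \<nu>"
    and window: "\<And>A. A \<in> sets \<nu> \<Longrightarrow> emeasure \<nu> (A \<inter> B) = ennreal t * emeasure \<mu> A"
    and nonempty: "space \<nu> \<noteq> {}"
begin

sublocale prob_space P using poisson by (simp add: poisson_process_def)

sublocale window: finite_measure \<mu> by (rule finite_window)

lemma space_eq: "space \<mu> = space \<nu>" using sets_eq by (rule sets_eq_imp_space_eq)

lemma points_in_space: "\<omega> \<in> space P \<Longrightarrow> \<eta> \<omega> \<subseteq> space \<mu>"
  using poisson by (auto simp: poisson_process_def space_eq)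

lemma measurable_counts:
  "A \<in> sets \<mu> \<Longrightarrow> (\<lambda>\<omega>. num_points (\<eta> \<omega> \<inter> (A \<inter> B))) \<in> borel_measurable P"
  using poisson window_sets unfolding poisson_process_def sets_eq by (auto intro: sets.Int)

lemma prob_count:
  assumes "A \<in> sets \<mu>"
  shows "prob {\<omega> \<in> space P. num_points (\<eta> \<omega> \<inter> (A \<inter> B)) = of_nat k}
       = (t * measure \<mu> A) ^ k / fact k * exp (- (t * measure \<mu> A))"
proof -
  have AB: "A \<inter> B \<in> sets \<nu>" using assms window_sets sets_eq by auto
  have em: "emeasure \<nu> (A \<inter> B) = ennreal (t * measure \<mu> A)"
    using assms t_nonneg by (simp add: window sets_eq window.emeasure_eq_measure ennreal_mult)
  moreover from em have "measure \<nu> (A \<inter> B) = t * measure \<mu> A" using t_nonneg by (simp add: measure_def)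
  ultimately show ?thesis using poisson AB by (auto simp: poisson_process_def)
qed

lemma prob_counts:
  fixes A :: "'c \<Rightarrow> 'x set" and m :: "'c \<Rightarrow> nat"
  assumes C: "finite C" and A: "\<And>c. c \<in> C \<Longrightarrow> A c \<in> sets \<mu>" and disj: "disjoint_family_on A C"
  shows "prob {\<omega> \<in> space P. \<forall>c\<in>C. num_points (\<eta> \<omega> \<inter> (A c \<inter> B)) = of_nat (m c)}
      = (\<Prod>c\<in>C. (t * measure \<mu> (A c)) ^ m c / fact (m c) * exp (- (t * measure \<mu> (A c))))"
proof (cases "C = {}")
  case True
  then show ?thesis using prob_space by simp
next
  case False
  obtain h where h: "bij_betw h {..<card C} C" using C bij_betw_from_nat_into_finite by blast
  let ?n = "card C" and ?A = "\<lambda>i. A (h i) \<inter> B"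
  have n: "{..<?n} \<noteq> {}" using False C by (simp add: lessThan_empty_iff)
  have ball: "(\<forall>c\<in>C. Q c) \<longleftrightarrow> (\<forall>i\<in>{..<?n}. Q (h i))" for Q
    using bij_betw_imp_surj_on[OF h] by (metis imageE imageI)
  have hC: "h i \<in> C" if "i < ?n" for i using bij_betwE[OF h] that by auto
  have "?A ` {..<?n} \<subseteq> sets \<nu>" using A hC window_sets sets_eq by auto
  moreover have "disjoint_family_on ?A {..<?n}" unfolding disjoint_family_on_def
  proof (intro ballI impI)
    fix i j assume "i \<in> {..<?n}" "j \<in> {..<?n}" "i \<noteq> j"
    then have "h i \<in> C" "h j \<in> C" "h i \<noteq> h j" using hC h by (auto simp: bij_betw_def inj_on_def)
    then show "?A i \<inter> ?A j = {}" using disjoint_family_onD[OF disj] by blast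
  qed
  ultimately have ind: "indep_vars (\<lambda>_. borel) (\<lambda>i \<omega>. num_points (\<eta> \<omega> \<inter> ?A i)) {..<?n}"
    using poisson unfolding poisson_process_def by blast
  have "{\<omega> \<in> space P. \<forall>c\<in>C. num_points (\<eta> \<omega> \<inter> (A c \<inter> B)) = of_nat (m c)}
     = (\<Inter>i\<in>{..<?n}. (\<lambda>\<omega>. num_points (\<eta> \<omega> \<inter> ?A i)) -` {of_nat (m (h i))} \<inter> space P)"
    using n by (auto simp: ball)
  then have "prob {\<omega> \<in> space P. \<forall>c\<in>C. num_points (\<eta> \<omega> \<inter> (A c \<inter> B)) = of_nat (m c)}
     = (\<Prod>i<?n. prob ((\<lambda>\<omega>. num_points (\<eta> \<omega> \<inter> ?A i)) -` {of_nat (m (h i))} \<inter> space P))"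
    using indep_varsD_finite[OF ind n, of "\<lambda>i. {of_nat (m (h i))}"] by simp
  also have "\<dots> = (\<Prod>i<?n. (t * measure \<mu> (A (h i))) ^ m (h i) / fact (m (h i)) * exp (- (t * measure \<mu> (A (h i)))))"
  proof (intro prod.cong refl)
    fix i assume "i \<in> {..<?n}"
    then have "A (h i) \<in> sets \<mu>" using A hC by auto
    moreover have "(\<lambda>\<omega>. num_points (\<eta> \<omega> \<inter> ?A i)) -` {of_nat (m (h i))} \<inter> space P
        = {\<omega> \<in> space P. num_points (\<eta> \<omega> \<inter> ?A i) = of_nat (m (h i))}" by auto
    ultimately show "prob ((\<lambda>\<omega>. num_points (\<eta> \<omega> \<inter> ?A i)) -` {of_nat (m (h i))} \<inter> space P)
      = (t * measure \<mu> (A (h i))) ^ m (h i) / fact (m (h i)) * exp (- (t * measure \<mu> (A (h i))))"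
      by (simp add: prob_count)
  qed
  also have "\<dots> = (\<Prod>c\<in>C. (t * measure \<mu> (A c)) ^ m c / fact (m c) * exp (- (t * measure \<mu> (A c))))"
    by (rule prod.reindex_bij_betw[OF h])
  finally show ?thesis .
qed

definition arrangements :: "nat \<Rightarrow> 'w \<Rightarrow> (nat \<Rightarrow> 'x) set" where
  "arrangements n \<omega> = {x \<in> {..<n} \<rightarrow>\<^sub>E \<eta> \<omega> \<inter> B. inj_on x {..<n}}"

text \<open>
  A uniformly random enumeration of the points in the window, if there are exactly \<open>n\<close> of them. It turns the
  random set into a random vector, whose law is determined by its values on rectangles; a function of the
  set is recovered because it does not depend on the enumeration.
\<close>

definition arrangement_kernel :: "nat \<Rightarrow> 'w \<Rightarrow> (nat \<Rightarrow> 'x) measure" where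
  "arrangement_kernel n \<omega> =
     (if num_points (\<eta> \<omega> \<inter> B) = of_nat n
      then distr (uniform_count_measure (arrangements n \<omega>)) (\<Pi>\<^sub>M i\<in>{..<n}. \<mu>) (\<lambda>x. x)
      else null_measure (\<Pi>\<^sub>M i\<in>{..<n}. \<mu>))"

lemma sets_arrangement_kernel [simp]: "sets (arrangement_kernel n \<omega>) = sets (\<Pi>\<^sub>M i\<in>{..<n}. \<mu>)"
  by (simp add: arrangement_kernel_def)

lemma card_arrangements:
  assumes "num_points (\<eta> \<omega> \<inter> B) = of_nat n"
  shows "finite (arrangements n \<omega>)" "card (arrangements n \<omega>) = fact n"
proof -
  have fin: "finite (\<eta> \<omega> \<inter> B)" "card (\<eta> \<omega> \<inter> B) = n" using assms by (auto simp: num_points_eq_of_nat_iff)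
  show "finite (arrangements n \<omega>)"
    unfolding arrangements_def using fin by (intro finite_subset[OF _ finite_PiE[of "{..<n}" "\<lambda>_. \<eta> \<omega> \<inter> B"]]) auto
  have "arrangements n \<omega> = {x \<in> {..<n} \<rightarrow>\<^sub>E \<eta> \<omega> \<inter> B. inj_on x {..<n} \<and> (\<forall>i\<in>{..<n}. x i \<in> \<eta> \<omega> \<inter> B)}"
    by (auto simp: arrangements_def)
  also have "card \<dots> = (\<Prod>c\<in>{()}. \<Prod>j<card {i \<in> {..<n}. () = c}. card (\<eta> \<omega> \<inter> B) - j)"
    using fin by (intro card_coloured_injections) (auto simp: disjoint_family_on_def)
  also have "\<dots> = fact n" by (simp add: fin prod_falling_eq_fact)
  finally show "card (arrangements n \<omega>) = fact n" .
qed

lemma arrangements_subset_space: "\<omega> \<in> space P \<Longrightarrow> arrangements n \<omega> \<subseteq> space (\<Pi>\<^sub>M i\<in>{..<n}. \<mu>)"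
  using points_in_space[of \<omega>] PiE_mono[of "{..<n}" "\<lambda>_. \<eta> \<omega> \<inter> B" "\<lambda>_. space \<mu>"]
  by (auto simp: arrangements_def space_PiM)

lemma measurable_arrangements:
  assumes "\<omega> \<in> space P"
  shows "(\<lambda>x. x) \<in> uniform_count_measure (arrangements n \<omega>) \<rightarrow>\<^sub>M (\<Pi>\<^sub>M i\<in>{..<n}. \<mu>)"
  using arrangements_subset_space[OF assms, of n]
  by (intro measurableI) (auto simp: space_uniform_count_measure sets_uniform_count_measure)

lemma subprob_arrangement_kernel:
  assumes \<omega>: "\<omega> \<in> space P" shows "subprob_space (arrangement_kernel n \<omega>)"
proof (cases "num_points (\<eta> \<omega> \<inter> B) = of_nat n")
  case True
  have "arrangements n \<omega> \<noteq> {}" using card_arrangements[OF True] by auto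
  then have "prob_space (uniform_count_measure (arrangements n \<omega>))"
    using card_arrangements[OF True] by (intro prob_space_uniform_count_measure)
  then show ?thesis
    using True measurable_arrangements[OF \<omega>, of n]
    by (simp add: arrangement_kernel_def prob_space_imp_subprob_space prob_space.prob_space_distr)
next
  case False
  have "space (\<Pi>\<^sub>M i\<in>{..<n}. \<mu>) \<noteq> {}" using nonempty by (simp add: space_PiM space_eq PiE_eq_empty_iff)
  then show ?thesis using False by (simp add: arrangement_kernel_def subprob_space_null_measure)
qed

text \<open>
  An enumeration that maps each \<open>i\<close> into the cell \<open>A (\<tau> i)\<close> uses every point of the window once. It exists
  only if each cell \<open>A c\<close> contains exactly as many points as there are indices of colour \<open>c\<close>, and then
  the points within the cells can be permuted freely.
\<close>

lemma emeasure_kernel_atoms: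
  assumes \<omega>: "\<omega> \<in> space P" and C: "finite C" and A: "\<And>c. c \<in> C \<Longrightarrow> A c \<in> sets \<mu>"
    and disj: "disjoint_family_on A C" and cover: "(\<Union>c\<in>C. A c) = space \<mu>" and \<tau>: "\<tau> ` {..<n} \<subseteq> C"
  defines "m \<equiv> \<lambda>c. card {i \<in> {..<n}. \<tau> i = c}"
  shows "emeasure (arrangement_kernel n \<omega>) (Pi\<^sub>E {..<n} (\<lambda>i. A (\<tau> i)))
     = ennreal (real (\<Prod>c\<in>C. fact (m c)) / fact n) *
       indicator {\<omega> \<in> space P. \<forall>c\<in>C. num_points (\<eta> \<omega> \<inter> (A c \<inter> B)) = of_nat (m c)} \<omega>"
proof -
  let ?F = "\<eta> \<omega> \<inter> B"
  let ?D = "\<lambda>c. \<eta> \<omega> \<inter> (A c \<inter> B)"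
  have F_eq: "?F = (\<Union>c\<in>C. ?D c)" using points_in_space[OF \<omega>] cover by blast
  have disjD: "disjoint_family_on ?D C" using disj by (auto simp: disjoint_family_on_def)
  have sum_m: "(\<Sum>c\<in>C. m c) = n"
  proof -
    have "(\<Sum>c\<in>C. m c) = card {..<n}"
      unfolding m_def card_eq_sum using C \<tau> by (intro sum.group) auto
    then show ?thesis by simp
  qed
  show ?thesis
  proof (cases "num_points ?F = of_nat n")
    case True
    have fin: "finite ?F" "card ?F = n" using True by (auto simp: num_points_eq_of_nat_iff)
    have finD: "finite (?D c)" for c using fin by (auto intro: finite_subset)
    let ?X = "{x \<in> {..<n} \<rightarrow>\<^sub>E ?F. inj_on x {..<n} \<and> (\<forall>i\<in>{..<n}. x i \<in> ?D (\<tau> i))}"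
    have "(\<lambda>x. x) -` Pi\<^sub>E {..<n} (\<lambda>i. A (\<tau> i)) \<inter> space (uniform_count_measure (arrangements n \<omega>)) = ?X"
      by (auto simp: space_uniform_count_measure arrangements_def PiE_iff extensional_def)
    then have "emeasure (arrangement_kernel n \<omega>) (Pi\<^sub>E {..<n} (\<lambda>i. A (\<tau> i))) = emeasure (uniform_count_measure (arrangements n \<omega>)) ?X"
      using True A \<tau> measurable_arrangements[OF \<omega>, of n]
      by (simp add: arrangement_kernel_def emeasure_distr sets_PiM_I_finite image_subset_iff)
    also have "\<dots> = ennreal (real (card ?X) / real (card (arrangements n \<omega>)))"
      using card_arrangements[OF True] by (intro emeasure_uniform_count_measure) (auto simp: arrangements_def)
    also have "card ?X = (\<Prod>c\<in>C. \<Prod>j<m c. card (?D c) - j)"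
      unfolding m_def using fin C disjD \<tau> by (intro card_coloured_injections) auto
    also have "\<dots> = (\<Prod>c\<in>C. fact (m c)) * of_bool (\<forall>c\<in>C. card (?D c) = m c)"
    proof (cases "\<forall>c\<in>C. card (?D c) = m c")
      case True
      then show ?thesis by (simp add: prod_falling_eq_fact)
    next
      case False
      have "card ?F = (\<Sum>c\<in>C. card (?D c))"
        unfolding F_eq using C finD disjD by (intro card_UN_disjoint') auto
      then have "(\<Sum>c\<in>C. card (?D c)) = (\<Sum>c\<in>C. m c)" using fin sum_m by simp
      \<comment> \<open>both families of numbers have the sum \<open>n\<close>, so if they differ, some cell has too few points\<close>
      moreover have "\<exists>c\<in>C. card (?D c) < m c"
      proof (rule ccontr)
        assume "\<not> ?thesis"
        then have le: "\<And>c. c \<in> C \<Longrightarrow> m c \<le> card (?D c)" by (meson not_le)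
        then obtain c where "c \<in> C" "m c < card (?D c)" using False le_neq_implies_less by metis
        then have "(\<Sum>c\<in>C. m c) < (\<Sum>c\<in>C. card (?D c))" using C le by (intro sum_strict_mono_ex1) auto
        then show False using \<open>(\<Sum>c\<in>C. card (?D c)) = (\<Sum>c\<in>C. m c)\<close> by simp
      qed
      then obtain c where "c \<in> C" "card (?D c) < m c" by auto
      then have "(\<Prod>j<m c. card (?D c) - j) = 0" by (intro prod_zero) auto
      then have "(\<Prod>c\<in>C. \<Prod>j<m c. card (?D c) - j) = 0" using C \<open>c \<in> C\<close> by (intro prod_zero) auto
      then show ?thesis using False by simp
    qed
    also have "real \<dots> / real (card (arrangements n \<omega>)) = real (\<Prod>c\<in>C. fact (m c)) / fact n * of_bool (\<forall>c\<in>C. card (?D c) = m c)"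
      by (simp add: card_arrangements[OF True])
    also have "ennreal \<dots> = ennreal (real (\<Prod>c\<in>C. fact (m c)) / fact n) *
       indicator {\<omega> \<in> space P. \<forall>c\<in>C. num_points (\<eta> \<omega> \<inter> (A c \<inter> B)) = of_nat (m c)} \<omega>"
      using \<omega> finD by (auto simp: num_points_eq_of_nat_iff indicator_def)
    finally show ?thesis .
  next
    case False
    have "\<not> (\<forall>c\<in>C. num_points (?D c) = of_nat (m c))"
    proof
      assume *: "\<forall>c\<in>C. num_points (?D c) = of_nat (m c)"
      then have "finite ?F" unfolding F_eq using C by (intro finite_UN_I) (auto simp: num_points_eq_of_nat_iff)
      moreover have "card ?F = (\<Sum>c\<in>C. card (?D c))"
        unfolding F_eq using C * disjD by (intro card_UN_disjoint') (auto simp: num_points_eq_of_nat_iff)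
      ultimately have "num_points ?F = of_nat n" using * sum_m by (simp add: num_points_eq_of_nat_iff)
      then show False using False by simp
    qed
    then show ?thesis using False by (simp add: arrangement_kernel_def)
  qed
qed

lemma arrangement_kernel_rectangle:
  assumes X: "\<And>i. i < n \<Longrightarrow> X i \<in> sets \<mu>"
  shows "(\<lambda>\<omega>. emeasure (arrangement_kernel n \<omega>) (Pi\<^sub>E {..<n} X)) \<in> borel_measurable P"
    and "(\<integral>\<^sup>+\<omega>. emeasure (arrangement_kernel n \<omega>) (Pi\<^sub>E {..<n} X) \<partial>P)
       = ennreal (exp (- (t * measure \<mu> (space \<mu>))) * t ^ n / fact n) * emeasure (\<Pi>\<^sub>M i\<in>{..<n}. \<mu>) (Pi\<^sub>E {..<n} X)"
proof -
  interpret product_sigma_finite "\<lambda>_::nat. \<mu>" by standard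
  let ?T = "\<Pi>\<^sub>E i\<in>{..<n}. {J \<in> Pow {..<n}. i \<in> J}"
  let ?C = "Pow {..<n}" and ?A = "atom (space \<mu>) n X"
  let ?m = "\<lambda>\<tau> c. card {i \<in> {..<n}. \<tau> i = c}"
  let ?ev = "\<lambda>\<tau>. {\<omega> \<in> space P. \<forall>c\<in>?C. num_points (\<eta> \<omega> \<inter> (?A c \<inter> B)) = of_nat (?m \<tau> c)}"
  let ?w = "\<lambda>\<tau>. real (\<Prod>c\<in>?C. fact (?m \<tau> c)) / fact n"
  have C: "finite ?C" by simp
  have A: "?A c \<in> sets \<mu>" for c using X by (rule atom_sets)
  have disj: "disjoint_family_on ?A ?C"
    unfolding disjoint_family_on_def
  proof (intro ballI impI)
    fix J K assume "J \<in> ?C" "K \<in> ?C" "J \<noteq> K"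
    then obtain j where "j < n" "j \<in> J \<longleftrightarrow> j \<notin> K" by blast
    then show "?A J \<inter> ?A K = {}" by (auto simp: atom_def)
  qed
  have cover: "(\<Union>c\<in>?C. ?A c) = space \<mu>"
  proof (intro set_eqI iffI)
    fix x assume "x \<in> space \<mu>"
    then have "x \<in> ?A {i \<in> {..<n}. x \<in> X i}" by (auto simp: atom_def)
    then show "x \<in> (\<Union>c\<in>?C. ?A c)" by (rule UN_I[rotated]) auto
  qed (auto simp: atom_def)
  have \<tau>C: "\<tau> ` {..<n} \<subseteq> ?C" if "\<tau> \<in> ?T" for \<tau> using that by (auto simp: PiE_iff)
  have ev: "?ev \<tau> \<in> events" for \<tau>
  proof (rule sets.sets_Collect_finite_All[OF _ C])
    fix c
    have "{\<omega> \<in> space P. num_points (\<eta> \<omega> \<inter> (?A c \<inter> B)) = of_nat (?m \<tau> c)}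
       = (\<lambda>\<omega>. num_points (\<eta> \<omega> \<inter> (?A c \<inter> B))) -` {of_nat (?m \<tau> c)} \<inter> space P" by auto
    also have "\<dots> \<in> events" using measurable_counts[OF A] by (rule measurable_sets) simp
    finally show "{\<omega> \<in> space P. num_points (\<eta> \<omega> \<inter> (?A c \<inter> B)) = of_nat (?m \<tau> c)} \<in> events" .
  qed
  have kernel: "emeasure (arrangement_kernel n \<omega>) (Pi\<^sub>E {..<n} X) = (\<Sum>\<tau>\<in>?T. ennreal (?w \<tau>) * indicator (?ev \<tau>) \<omega>)"
    if \<omega>: "\<omega> \<in> space P" for \<omega>
  proof -
    have "emeasure (arrangement_kernel n \<omega>) (Pi\<^sub>E {..<n} X)
      = (\<Sum>\<tau>\<in>?T. emeasure (arrangement_kernel n \<omega>) (Pi\<^sub>E {..<n} (\<lambda>i. ?A (\<tau> i))))"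
      using X by (intro emeasure_rectangle_atoms) auto
    also have "\<dots> = (\<Sum>\<tau>\<in>?T. ennreal (?w \<tau>) * indicator (?ev \<tau>) \<omega>)"
      using emeasure_kernel_atoms[OF \<omega> C A disj cover \<tau>C] by (intro sum.cong) auto
    finally show ?thesis .
  qed
  have "(\<lambda>\<omega>. \<Sum>\<tau>\<in>?T. ennreal (?w \<tau>) * indicator (?ev \<tau>) \<omega>) \<in> borel_measurable P"
    by (intro borel_measurable_sum borel_measurable_times_ennreal borel_measurable_const borel_measurable_indicator ev)
  then show "(\<lambda>\<omega>. emeasure (arrangement_kernel n \<omega>) (Pi\<^sub>E {..<n} X)) \<in> borel_measurable P"
    by (subst measurable_cong[OF kernel])
  have total: "(\<Sum>c\<in>?C. measure \<mu> (?A c)) = measure \<mu> (space \<mu>)"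
    using window.finite_measure_finite_Union[OF C image_subsetI[OF A] disj] cover by simp
  have weight: "ennreal (?w \<tau>) * emeasure P (?ev \<tau>)
     = ennreal (exp (- (t * measure \<mu> (space \<mu>))) * t ^ n / fact n) * emeasure (\<Pi>\<^sub>M i\<in>{..<n}. \<mu>) (Pi\<^sub>E {..<n} (\<lambda>i. ?A (\<tau> i)))"
    if \<tau>: "\<tau> \<in> ?T" for \<tau>
  proof -
    let ?p = "\<lambda>c. t * measure \<mu> (?A c)"
    have "prob (?ev \<tau>) = (\<Prod>c\<in>?C. ?p c ^ ?m \<tau> c / fact (?m \<tau> c) * exp (- ?p c))"
      using C A disj by (rule prob_counts)
    also have "\<dots> = (\<Prod>c\<in>?C. ?p c ^ ?m \<tau> c) / real (\<Prod>c\<in>?C. fact (?m \<tau> c)) * (\<Prod>c\<in>?C. exp (- ?p c))"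
      by (simp add: prod.distrib prod_dividef)
    also have "(\<Prod>c\<in>?C. exp (- ?p c)) = exp (- (t * measure \<mu> (space \<mu>)))"
      by (simp add: exp_sum[symmetric] sum_negf sum_distrib_left[symmetric] total)
    also have "(\<Prod>c\<in>?C. ?p c ^ ?m \<tau> c) = (\<Prod>i<n. ?p (\<tau> i))"
    proof -
      have "(\<Prod>i<n. ?p (\<tau> i)) = (\<Prod>c\<in>?C. \<Prod>i\<in>{i \<in> {..<n}. \<tau> i = c}. ?p (\<tau> i))"
        using \<tau>C[OF \<tau>] by (intro prod.group[symmetric]) auto
      also have "\<dots> = (\<Prod>c\<in>?C. \<Prod>i\<in>{i \<in> {..<n}. \<tau> i = c}. ?p c)" by (intro prod.cong) auto
      finally show ?thesis by simp
    qed
    also have "\<dots> = t ^ n * (\<Prod>i<n. measure \<mu> (?A (\<tau> i)))" by (simp add: prod.distrib)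
    finally have "?w \<tau> * prob (?ev \<tau>) = exp (- (t * measure \<mu> (space \<mu>))) * t ^ n / fact n * (\<Prod>i<n. measure \<mu> (?A (\<tau> i)))"
      by simp
    then have "ennreal (?w \<tau>) * ennreal (prob (?ev \<tau>))
      = ennreal (exp (- (t * measure \<mu> (space \<mu>))) * t ^ n / fact n) * ennreal (\<Prod>i<n. measure \<mu> (?A (\<tau> i)))"
      using t_nonneg by (simp flip: ennreal_mult add: prod_nonneg)
    then show ?thesis
      using A by (simp add: emeasure_eq_measure emeasure_PiM window.emeasure_eq_measure prod_ennreal)
  qed
  have "(\<integral>\<^sup>+\<omega>. emeasure (arrangement_kernel n \<omega>) (Pi\<^sub>E {..<n} X) \<partial>P)
     = (\<integral>\<^sup>+\<omega>. (\<Sum>\<tau>\<in>?T. ennreal (?w \<tau>) * indicator (?ev \<tau>) \<omega>) \<partial>P)"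
    by (intro nn_integral_cong kernel)
  also have "\<dots> = (\<Sum>\<tau>\<in>?T. ennreal (?w \<tau>) * emeasure P (?ev \<tau>))"
    using ev by (subst nn_integral_sum) (auto intro!: sum.cong nn_integral_cmult_indicator)
  also have "\<dots> = (\<Sum>\<tau>\<in>?T. ennreal (exp (- (t * measure \<mu> (space \<mu>))) * t ^ n / fact n) * emeasure (\<Pi>\<^sub>M i\<in>{..<n}. \<mu>) (Pi\<^sub>E {..<n} (\<lambda>i. ?A (\<tau> i))))"
    by (intro sum.cong refl weight)
  also have "\<dots> = ennreal (exp (- (t * measure \<mu> (space \<mu>))) * t ^ n / fact n) * emeasure (\<Pi>\<^sub>M i\<in>{..<n}. \<mu>) (Pi\<^sub>E {..<n} X)"
    unfolding sum_distrib_left[symmetric] using emeasure_rectangle_atoms[OF refl X] by simp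
  finally show "(\<integral>\<^sup>+\<omega>. emeasure (arrangement_kernel n \<omega>) (Pi\<^sub>E {..<n} X) \<partial>P)
       = ennreal (exp (- (t * measure \<mu> (space \<mu>))) * t ^ n / fact n) * emeasure (\<Pi>\<^sub>M i\<in>{..<n}. \<mu>) (Pi\<^sub>E {..<n} X)" .
qed

lemma measurable_arrangement_kernel:
  "arrangement_kernel n \<in> P \<rightarrow>\<^sub>M subprob_algebra (\<Pi>\<^sub>M i\<in>{..<n}. \<mu>)"
proof (rule measurable_subprob_algebra_generated)
  show "sets (\<Pi>\<^sub>M i\<in>{..<n}. \<mu>) = sigma_sets (\<Pi>\<^sub>E i\<in>{..<n}. space \<mu>) (prod_algebra {..<n} (\<lambda>_. \<mu>))"
    by (rule sets_PiM)
  show "Int_stable (prod_algebra {..<n} (\<lambda>_. \<mu>))" by (rule Int_stable_prod_algebra)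
  show "prod_algebra {..<n} (\<lambda>_. \<mu>) \<subseteq> Pow (\<Pi>\<^sub>E i\<in>{..<n}. space \<mu>)" by (rule prod_algebra_sets_into_space)
  show "(\<lambda>\<omega>. emeasure (arrangement_kernel n \<omega>) A) \<in> borel_measurable P" if "A \<in> prod_algebra {..<n} (\<lambda>_. \<mu>)" for A
    using that arrangement_kernel_rectangle(1)[of n] by (auto simp: prod_algebra_eq_finite)
  show "(\<lambda>\<omega>. emeasure (arrangement_kernel n \<omega>) (\<Pi>\<^sub>E i\<in>{..<n}. space \<mu>)) \<in> borel_measurable P"
    by (rule arrangement_kernel_rectangle(1)) simp
qed (auto intro: subprob_arrangement_kernel)

text \<open>
  On rectangles made of cells, the factorials from counting the enumerations cancel those in the Poisson
  probabilities, and what remains is a product over the coordinates.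
\<close>

lemma arrangement_kernel_law:
  "P \<bind> arrangement_kernel n
   = scale_measure (ennreal (exp (- (t * measure \<mu> (space \<mu>))) * t ^ n / fact n)) (\<Pi>\<^sub>M i\<in>{..<n}. \<mu>)"
proof (rule measure_eqI_PiM_finite[symmetric])
  interpret product_sigma_finite "\<lambda>_::nat. \<mu>" by standard
  let ?c = "ennreal (exp (- (t * measure \<mu> (space \<mu>))) * t ^ n / fact n)"
  show "sets (P \<bind> arrangement_kernel n) = sets (\<Pi>\<^sub>M i\<in>{..<n}. \<mu>)"
    using measurable_arrangement_kernel not_empty by (intro sets_bind) auto
  show "emeasure (scale_measure ?c (\<Pi>\<^sub>M i\<in>{..<n}. \<mu>)) (Pi\<^sub>E {..<n} A) = emeasure (P \<bind> arrangement_kernel n) (Pi\<^sub>E {..<n} A)"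
    if "\<And>i. i \<in> {..<n} \<Longrightarrow> A i \<in> sets \<mu>" for A
    using that not_empty measurable_arrangement_kernel
    by (subst emeasure_bind) (auto simp: arrangement_kernel_rectangle(2) sets_PiM_I_finite)
  show "range (\<lambda>_::nat. space (\<Pi>\<^sub>M i\<in>{..<n}. \<mu>)) \<subseteq> prod_algebra {..<n} (\<lambda>_. \<mu>)"
    by (auto simp: space_PiM prod_algebra_eq_finite intro!: exI[of _ "\<lambda>_. space \<mu>"])
  show "emeasure (scale_measure ?c (\<Pi>\<^sub>M i\<in>{..<n}. \<mu>)) (space (\<Pi>\<^sub>M i\<in>{..<n}. \<mu>)) \<noteq> \<infinity>"
    by (simp add: space_PiM emeasure_PiM window.emeasure_eq_measure ennreal_power ennreal_mult_eq_top_iff)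
qed auto

lemma AE_finite_count: "AE \<omega> in P. \<exists>n::nat. num_points (\<eta> \<omega> \<inter> B) = of_nat n"
proof -
  let ?E = "\<lambda>n::nat. {\<omega> \<in> space P. num_points (\<eta> \<omega> \<inter> (space \<mu> \<inter> B)) = of_nat n}"
  let ?r = "t * measure \<mu> (space \<mu>)"
  have E: "?E n \<in> events" for n
  proof -
    have "?E n = (\<lambda>\<omega>. num_points (\<eta> \<omega> \<inter> (space \<mu> \<inter> B))) -` {of_nat n} \<inter> space P" by auto
    also have "\<dots> \<in> events" using measurable_counts[OF sets.top] by (rule measurable_sets) simp
    finally show ?thesis .
  qed
  have "(\<lambda>n. ?r ^ n / fact n * exp (- ?r)) sums (exp ?r * exp (- ?r))"
    using exp_converges[of ?r] by (intro sums_mult2) (simp add: divide_inverse mult.commute)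
  then have "(\<lambda>n. prob (?E n)) sums 1" by (simp add: prob_count mult_exp_exp)
  moreover have "(\<lambda>n. prob (?E n)) sums prob (\<Union>n. ?E n)"
    using E by (intro finite_measure_UNION) (auto simp: disjoint_family_on_def)
  ultimately have "prob (\<Union>n. ?E n) = 1" using sums_unique2 by blast
  then have "AE \<omega> in P. \<omega> \<in> (\<Union>n. ?E n)" using E by (subst prob_eq_1[symmetric]) auto
  then show ?thesis
  proof (rule AE_mp, intro AE_I2 impI)
    fix \<omega> assume \<omega>: "\<omega> \<in> space P" "\<omega> \<in> (\<Union>n. ?E n)"
    have "\<eta> \<omega> \<inter> (space \<mu> \<inter> B) = \<eta> \<omega> \<inter> B" using points_in_space[OF \<omega>(1)] by auto
    then show "\<exists>n::nat. num_points (\<eta> \<omega> \<inter> B) = of_nat n" using \<omega>(2) by auto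
  qed
qed

lemma AE_avoids_null_set:
  assumes S: "S \<in> sets \<mu>" "measure \<mu> S = 0" shows "AE \<omega> in P. \<eta> \<omega> \<inter> (S \<inter> B) = {}"
proof -
  let ?E = "{\<omega> \<in> space P. num_points (\<eta> \<omega> \<inter> (S \<inter> B)) = of_nat 0}"
  have "?E = (\<lambda>\<omega>. num_points (\<eta> \<omega> \<inter> (S \<inter> B))) -` {of_nat 0} \<inter> space P" by auto
  also have "\<dots> \<in> events" using measurable_counts[OF S(1)] by (rule measurable_sets) simp
  finally have "?E \<in> events" .
  moreover have "prob ?E = 1" using prob_count[OF S(1), of 0] S(2) by simp
  ultimately have "AE \<omega> in P. \<omega> \<in> ?E" using prob_eq_1 by metis
  then show ?thesis
    by eventually_elim (simp only: mem_Collect_eq num_points_eq_of_nat_iff card_eq_0_iff, blast)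
qed

text \<open>
  The function \<open>G\<close> has to be given by \<open>H\<close> only for configurations that avoid the null set \<open>S\<close>, as the
  process almost surely does; later, \<open>S\<close> consists of the root alone. Measurability of \<open>G\<close> is replaced
  by the measurable version \<open>F\<close>.
\<close>

theorem expectation_of_point_configuration:
  fixes G :: "'x set \<Rightarrow> ennreal" and H :: "nat \<Rightarrow> (nat \<Rightarrow> 'x) \<Rightarrow> ennreal"
  assumes S: "S \<in> sets \<mu>" "measure \<mu> S = 0"
    and H: "\<And>n. H n \<in> borel_measurable (\<Pi>\<^sub>M i\<in>{..<n}. \<mu>)"
    and G: "\<And>n x. inj_on x {..<n} \<Longrightarrow> x ` {..<n} \<inter> S = {} \<Longrightarrow> G (x ` {..<n}) = H n x"
  shows "\<exists>F\<in>borel_measurable P. (AE \<omega> in P. G (\<eta> \<omega> \<inter> B) = F \<omega>) \<and>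
     (\<integral>\<^sup>+\<omega>. F \<omega> \<partial>P) = (\<Sum>n. ennreal (exp (- (t * measure \<mu> (space \<mu>))) * t ^ n / fact n) * (\<integral>\<^sup>+x. H n x \<partial>(\<Pi>\<^sub>M i\<in>{..<n}. \<mu>)))"
proof (intro bexI[of _ "\<lambda>\<omega>. \<Sum>n. \<integral>\<^sup>+x. H n x \<partial>arrangement_kernel n \<omega>"] conjI)
  have meas: "(\<lambda>\<omega>. \<integral>\<^sup>+x. H n x \<partial>arrangement_kernel n \<omega>) \<in> borel_measurable P" for n
    using measurable_compose[OF measurable_arrangement_kernel nn_integral_measurable_subprob_algebra[OF H]] by simp
  then show "(\<lambda>\<omega>. \<Sum>n. \<integral>\<^sup>+x. H n x \<partial>arrangement_kernel n \<omega>) \<in> borel_measurable P" by measurable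
  have "(\<integral>\<^sup>+\<omega>. (\<Sum>n. \<integral>\<^sup>+x. H n x \<partial>arrangement_kernel n \<omega>) \<partial>P)
     = (\<Sum>n. \<integral>\<^sup>+x. H n x \<partial>(P \<bind> arrangement_kernel n))"
    using meas by (subst nn_integral_suminf) (auto simp: nn_integral_bind[OF H measurable_arrangement_kernel])
  then show "(\<integral>\<^sup>+\<omega>. (\<Sum>n. \<integral>\<^sup>+x. H n x \<partial>arrangement_kernel n \<omega>) \<partial>P)
     = (\<Sum>n. ennreal (exp (- (t * measure \<mu> (space \<mu>))) * t ^ n / fact n) * (\<integral>\<^sup>+x. H n x \<partial>(\<Pi>\<^sub>M i\<in>{..<n}. \<mu>)))"
    by (simp add: arrangement_kernel_law nn_integral_scale_measure[OF H])
  show "AE \<omega> in P. G (\<eta> \<omega> \<inter> B) = (\<Sum>n. \<integral>\<^sup>+x. H n x \<partial>arrangement_kernel n \<omega>)"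
    using AE_finite_count AE_avoids_null_set[OF S] AE_space
  proof eventually_elim
    case (elim \<omega>)
    then obtain n where n: "num_points (\<eta> \<omega> \<inter> B) = of_nat n" by auto
    have fin: "finite (\<eta> \<omega> \<inter> B)" "card (\<eta> \<omega> \<inter> B) = n" using n by (auto simp: num_points_eq_of_nat_iff)
    have "(\<Sum>k. \<integral>\<^sup>+x. H k x \<partial>arrangement_kernel k \<omega>) = (\<Sum>k\<in>{n}. \<integral>\<^sup>+x. H k x \<partial>arrangement_kernel k \<omega>)"
      using n by (intro suminf_finite) (auto simp: arrangement_kernel_def)
    also have "\<dots> = (\<integral>\<^sup>+x. H n x \<partial>uniform_count_measure (arrangements n \<omega>))"
      using n by (simp add: arrangement_kernel_def nn_integral_distr[OF measurable_arrangements[OF elim(3)]] H)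
    also have "\<dots> = (\<integral>\<^sup>+x. G (\<eta> \<omega> \<inter> B) \<partial>uniform_count_measure (arrangements n \<omega>))"
    proof (intro nn_integral_cong)
      fix x assume "x \<in> space (uniform_count_measure (arrangements n \<omega>))"
      then have x: "x ` {..<n} \<subseteq> \<eta> \<omega> \<inter> B" "inj_on x {..<n}"
        by (auto simp: space_uniform_count_measure arrangements_def PiE_iff)
      then have "x ` {..<n} = \<eta> \<omega> \<inter> B" using fin by (intro card_subset_eq) (auto simp: card_image)
      moreover have "(\<eta> \<omega> \<inter> B) \<inter> S = {}" using elim(2) by blast
      ultimately show "H n x = G (\<eta> \<omega> \<inter> B)" using G[OF x(2)] by simp
    qed
    also have "\<dots> = G (\<eta> \<omega> \<inter> B)"
    proof -
      have "arrangements n \<omega> \<noteq> {}" using card_arrangements[OF n] by auto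
      then have "emeasure (uniform_count_measure (arrangements n \<omega>)) (arrangements n \<omega>) = 1"
        using card_arrangements(1)[OF n] prob_space.emeasure_space_1[OF prob_space_uniform_count_measure, of "arrangements n \<omega>"]
        by (simp add: space_uniform_count_measure)
      then show ?thesis by (simp add: space_uniform_count_measure)
    qed
    finally show ?case by simp
  qed
qed

end

section \<open>The stationary model\<close>

lemma distr_PiM_map:
  fixes \<mu> :: "'x measure" and \<mu>' :: "'y measure" and I :: "'i set"
  assumes \<mu>: "sigma_finite_measure \<mu>" and \<mu>': "sigma_finite_measure \<mu>'" and I: "finite I"
    and T: "T \<in> \<mu> \<rightarrow>\<^sub>M \<mu>'" "distr \<mu> \<mu>' T = \<mu>'"
  shows "distr (\<Pi>\<^sub>M i\<in>I. \<mu>) (\<Pi>\<^sub>M i\<in>I. \<mu>') (\<lambda>x. \<lambda>i\<in>I. T (x i)) = (\<Pi>\<^sub>M i\<in>I. \<mu>')"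
proof -
  interpret m: sigma_finite_measure \<mu> by fact
  interpret m': sigma_finite_measure \<mu>' by fact
  interpret p: product_sigma_finite "\<lambda>_::'i. \<mu>" by standard
  interpret p': product_sigma_finite "\<lambda>_::'i. \<mu>'" by standard
  note T(1)[measurable]
  have meas: "(\<lambda>x. \<lambda>i\<in>I. T (x i)) \<in> (\<Pi>\<^sub>M i\<in>I. \<mu>) \<rightarrow>\<^sub>M (\<Pi>\<^sub>M i\<in>I. \<mu>')"
    by (rule measurable_restrict) measurable
  show ?thesis
  proof (rule p'.PiM_eqI[OF I])
    fix A assume A: "\<And>i. i \<in> I \<Longrightarrow> A i \<in> sets \<mu>'"
    have "(\<lambda>x. \<lambda>i\<in>I. T (x i)) -` Pi\<^sub>E I A \<inter> space (\<Pi>\<^sub>M i\<in>I. \<mu>) = (\<Pi>\<^sub>E i\<in>I. T -` A i \<inter> space \<mu>)"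
      by (auto simp: space_PiM PiE_iff)
    then have "emeasure (distr (\<Pi>\<^sub>M i\<in>I. \<mu>) (\<Pi>\<^sub>M i\<in>I. \<mu>') (\<lambda>x. \<lambda>i\<in>I. T (x i))) (Pi\<^sub>E I A)
      = emeasure (\<Pi>\<^sub>M i\<in>I. \<mu>) (\<Pi>\<^sub>E i\<in>I. T -` A i \<inter> space \<mu>)"
      using A I by (subst emeasure_distr[OF meas]) (auto intro!: sets_PiM_I_finite)
    also have "\<dots> = (\<Prod>i\<in>I. emeasure \<mu> (T -` A i \<inter> space \<mu>))"
      using A I measurable_sets[OF T(1)] by (intro p.emeasure_PiM) auto
    also have "\<dots> = (\<Prod>i\<in>I. emeasure \<mu>' (A i))"
    proof (intro prod.cong refl)
      fix i assume "i \<in> I"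
      then have "emeasure (distr \<mu> \<mu>' T) (A i) = emeasure \<mu> (T -` A i \<inter> space \<mu>)"
        using A T(1) by (intro emeasure_distr) auto
      then show "emeasure \<mu> (T -` A i \<inter> space \<mu>) = emeasure \<mu>' (A i)" by (simp add: T(2))
    qed
    finally show "emeasure (distr (\<Pi>\<^sub>M i\<in>I. \<mu>) (\<Pi>\<^sub>M i\<in>I. \<mu>') (\<lambda>x. \<lambda>i\<in>I. T (x i))) (Pi\<^sub>E I A) = (\<Prod>i\<in>I. emeasure \<mu>' (A i))" .
  qed simp
qed

locale stationary_connection_model =
  fixes Q :: "'m::polish_space measure" and \<phi> :: "'a::euclidean_space \<times> 'm \<Rightarrow> 'a \<times> 'm \<Rightarrow> real"
    and P :: "real \<Rightarrow> 'w measure" and \<eta> :: "'w \<Rightarrow> ('a \<times> 'm) set"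
  assumes prob_Q: "prob_space Q" and sets_Q: "sets Q = sets borel"
    and meas_\<phi>: "(\<lambda>(v, w). \<phi> v w) \<in> borel_measurable (borel \<Otimes>\<^sub>M borel)"
    and bounds: "\<And>v w. 0 \<le> \<phi> v w \<and> \<phi> v w \<le> 1"
    and sym: "\<And>v w. \<phi> v w = \<phi> w v"
    and translation: "\<And>x p y q. \<phi> (x, p) (y, q) = \<phi> (0, p) (y - x, q)"
    and d_phi_finite: "d_phi \<phi> Q < \<infinity>"
    and poisson_process: "\<And>t. 0 \<le> t \<Longrightarrow> poisson_process (P t) \<eta> (scale_measure (ennreal t) (lborel \<Otimes>\<^sub>M Q))"
begin

sublocale Q: prob_space Q by (rule prob_Q)

abbreviation L :: "('a \<times> 'm) measure" where "L \<equiv> lborel \<Otimes>\<^sub>M Q"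

lemma sets_L: "sets L = sets borel"
proof -
  have "sets L = sets ((borel :: 'a measure) \<Otimes>\<^sub>M (borel :: 'm measure))"
    by (intro sets_pair_measure_cong) (simp_all add: sets_Q)
  then show ?thesis unfolding borel_prod .
qed

lemma space_Q [simp]: "space Q = UNIV" using sets_eq_imp_space_eq[OF sets_Q] by simp

lemma space_L [simp]: "space L = UNIV" by (simp add: space_pair_measure)

lemma cylinder_sets: "A \<in> sets borel \<Longrightarrow> A \<times> UNIV \<in> sets L"
  using sets.top[of Q] by (intro pair_measureI) auto

lemma emeasure_cylinder: "A \<in> sets borel \<Longrightarrow> emeasure L (A \<times> UNIV) = emeasure lborel A"
  using sets.top[of Q] Q.emeasure_space_1 by (subst Q.emeasure_pair_measure_Times) auto

text \<open>
  The intensity measure at unit intensity, restricted to the points with position in \<open>A\<close>.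
\<close>

definition win :: "'a set \<Rightarrow> ('a \<times> 'm) measure" where
  "win A = density L (indicator (A \<times> UNIV))"

lemma sets_win [simp]: "sets (win A) = sets L" by (simp add: win_def)

lemma space_win [simp]: "space (win A) = UNIV" by (simp add: win_def)

lemma emeasure_win: "A \<in> sets borel \<Longrightarrow> S \<in> sets L \<Longrightarrow> emeasure (win A) S = emeasure L (S \<inter> (A \<times> UNIV))"
  unfolding win_def using cylinder_sets by (subst emeasure_restricted) (auto simp: Int_commute)

lemma emeasure_win_space: "A \<in> sets borel \<Longrightarrow> emeasure (win A) UNIV = emeasure lborel A"
  using emeasure_win[of A UNIV] sets.top[of L] by (simp add: emeasure_cylinder)

lemma finite_win: "A \<in> sets borel \<Longrightarrow> emeasure lborel A < \<infinity> \<Longrightarrow> finite_measure (win A)"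
  by (intro finite_measureI) (simp add: emeasure_win_space)

lemma connection_model_win:
  assumes "A \<in> sets borel" "emeasure lborel A < \<infinity>"
  shows "finite_connection_model (win A) \<phi>"
proof -
  interpret finite_measure "win A" using assms by (rule finite_win)
  show ?thesis
  proof
    have "sets (win A \<Otimes>\<^sub>M win A) = sets (borel \<Otimes>\<^sub>M borel)" by (intro sets_pair_measure_cong) (simp_all only: sets_win sets_L)
    then show "(\<lambda>(v, w). \<phi> v w) \<in> borel_measurable (win A \<Otimes>\<^sub>M win A)"
      using meas_\<phi> by (simp cong: measurable_cong_sets)
  qed (use bounds sym in auto)
qed

lemma poisson_window_win:
  assumes t: "0 \<le> t" and A: "A \<in> sets borel" "emeasure lborel A < \<infinity>"
  shows "poisson_window (P t) \<eta> (scale_measure (ennreal t) L) (A \<times> UNIV) t (win A)"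
proof (rule poisson_window.intro)
  show "finite_measure (win A)" using A by (rule finite_win)
  show "A \<times> UNIV \<in> sets (scale_measure (ennreal t) L)" using cylinder_sets[OF A(1)] by simp
  show "space (scale_measure (ennreal t) L) \<noteq> {}" by (simp add: space_scale_measure space_pair_measure)
qed (use assms in \<open>simp_all add: poisson_process emeasure_win\<close>)

abbreviation rooted :: "'a set \<Rightarrow> real \<Rightarrow> 'a \<times> 'm \<Rightarrow> ennreal" where
  "rooted A t v \<equiv> finite_connection_model.rooted_mean (win A) \<phi> t v"

lemma prob_space_P: "0 \<le> t \<Longrightarrow> prob_space (P t)"
  using poisson_process[of t] by (simp add: poisson_process_def)

lemma countable_points: "0 \<le> t \<Longrightarrow> \<omega> \<in> space (P t) \<Longrightarrow> countable (\<eta> \<omega>)"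
  using poisson_process[of t] by (simp add: poisson_process_def)

text \<open>
  The root is almost surely not a point of the process, so that adding it to the process increases the
  number of vertices by one, as it does in \<open>inverse_root_cluster\<close>.
\<close>

lemma rooted_eq_expectation:
  assumes t: "0 \<le> t" and A: "A \<in> sets borel" "emeasure lborel A < \<infinity>"
  shows "\<exists>F\<in>borel_measurable (P t). (AE \<omega> in P t. mean_inverse_cluster \<phi> v (\<eta> \<omega> \<inter> (A \<times> UNIV)) = F \<omega>) \<and>
    (\<integral>\<^sup>+\<omega>. F \<omega> \<partial>P t) = rooted A t v"
proof -
  interpret finite_connection_model "win A" \<phi> using A by (rule connection_model_win)
  interpret w: poisson_window "P t" \<eta> "scale_measure (ennreal t) L" "A \<times> UNIV" t "win A"
    using assms by (rule poisson_window_win)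
  have v: "{v} \<in> sets (win A)" unfolding sets_win sets_L by simp
  have "emeasure (win A) {v} \<le> emeasure L ({fst v} \<times> UNIV)"
    unfolding emeasure_win[OF A(1) v[unfolded sets_win]]
    using cylinder_sets[of "{fst v}"] by (intro emeasure_mono) (auto simp: mem_Times_iff)
  then have null: "measure (win A) {v} = 0" by (simp add: emeasure_cylinder measure_def)
  have H: "(\<lambda>x. ennreal (inverse_root_cluster \<phi> n (x(n := v)))) \<in> borel_measurable (power_measure {..<n})" for n
    using measurable_compose[OF measurable_Pair1' measurable_rooted_mean_pair, of v] by simp
  have "\<exists>F\<in>borel_measurable (P t). (AE \<omega> in P t. mean_inverse_cluster \<phi> v (\<eta> \<omega> \<inter> (A \<times> UNIV)) = F \<omega>) \<and>
    (\<integral>\<^sup>+\<omega>. F \<omega> \<partial>P t) = (\<Sum>n. ennreal (exp (- (t * mass)) * t ^ n / fact n) *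
      (\<integral>\<^sup>+x. ennreal (inverse_root_cluster \<phi> n (x(n := v))) \<partial>power_measure {..<n}))"
    by (rule w.expectation_of_point_configuration[OF v null H])
       (simp add: mean_inverse_cluster_finite[of \<phi>, OF sym bounds])
  then show ?thesis unfolding rooted_mean_def mult.commute[of t mass] .
qed

lemma rooted_le_1:
  assumes t: "0 \<le> t" and A: "A \<in> sets borel" "emeasure lborel A < \<infinity>" shows "rooted A t v \<le> 1"
proof -
  interpret prob_space "P t" using t by (rule prob_space_P)
  obtain F where F: "AE \<omega> in P t. mean_inverse_cluster \<phi> v (\<eta> \<omega> \<inter> (A \<times> UNIV)) = F \<omega>" "(\<integral>\<^sup>+\<omega>. F \<omega> \<partial>P t) = rooted A t v"
    using rooted_eq_expectation[OF assms, of v] by auto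
  have "AE \<omega> in P t. F \<omega> \<le> 1" using F(1) by eventually_elim (metis mean_inverse_cluster_le_1)
  then have "(\<integral>\<^sup>+\<omega>. F \<omega> \<partial>P t) \<le> (\<integral>\<^sup>+\<omega>. 1 \<partial>P t)" by (rule nn_integral_mono_AE)
  then show ?thesis by (simp add: F(2) emeasure_space_1)
qed

lemma rooted_antimono:
  assumes t: "0 \<le> t" and A: "A \<in> sets borel" "emeasure lborel A < \<infinity>" and A': "A' \<in> sets borel" "A' \<subseteq> A"
  shows "rooted A t v \<le> rooted A' t v"
proof -
  have A'': "emeasure lborel A' < \<infinity>" using A A' emeasure_mono[of A' A lborel] by (auto intro: le_less_trans)
  obtain F where F: "AE \<omega> in P t. mean_inverse_cluster \<phi> v (\<eta> \<omega> \<inter> (A \<times> UNIV)) = F \<omega>" "(\<integral>\<^sup>+\<omega>. F \<omega> \<partial>P t) = rooted A t v"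
    using rooted_eq_expectation[OF t A, of v] by auto
  obtain F' where F': "AE \<omega> in P t. mean_inverse_cluster \<phi> v (\<eta> \<omega> \<inter> (A' \<times> UNIV)) = F' \<omega>" "(\<integral>\<^sup>+\<omega>. F' \<omega> \<partial>P t) = rooted A' t v"
    using rooted_eq_expectation[OF t A'(1) A'', of v] by auto
  have "AE \<omega> in P t. F \<omega> \<le> F' \<omega>"
    using F(1) F'(1) AE_space
  proof eventually_elim
    case (elim \<omega>)
    have "mean_inverse_cluster \<phi> v (\<eta> \<omega> \<inter> (A \<times> UNIV)) \<le> mean_inverse_cluster \<phi> v (\<eta> \<omega> \<inter> (A' \<times> UNIV))"
      using countable_points[OF t elim(3)] A'(2) by (intro mean_inverse_cluster_antimono) auto
    then show ?case using elim by simp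
  qed
  then have "(\<integral>\<^sup>+\<omega>. F \<omega> \<partial>P t) \<le> (\<integral>\<^sup>+\<omega>. F' \<omega> \<partial>P t)" by (rule nn_integral_mono_AE)
  then show ?thesis by (simp add: F(2) F'(2))
qed

lemma ball_finite: "ball c r \<in> sets borel" "emeasure lborel (ball (c::'a) r) < \<infinity>"
  using emeasure_bounded_finite[of "ball c r"] by simp_all

lemma rooted_tendsto:
  assumes t: "0 \<le> t"
  shows "(\<lambda>n. rooted (ball 0 (real n)) t v) \<longlonglongrightarrow> expected_inverse_cluster_size \<phi> (P t) \<eta> v"
proof -
  interpret prob_space "P t" using t by (rule prob_space_P)
  let ?A = "\<lambda>n. ball (0::'a) (real n) \<times> (UNIV :: 'm set)"
  have "\<forall>n. \<exists>F. F \<in> borel_measurable (P t) \<and> (AE \<omega> in P t. mean_inverse_cluster \<phi> v (\<eta> \<omega> \<inter> ?A n) = F \<omega>) \<and>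
    (\<integral>\<^sup>+\<omega>. F \<omega> \<partial>P t) = rooted (ball 0 (real n)) t v"
    using rooted_eq_expectation[OF t ball_finite] by blast
  from choice[OF this] obtain F where F0: "\<forall>n. F n \<in> borel_measurable (P t) \<and>
    (AE \<omega> in P t. mean_inverse_cluster \<phi> v (\<eta> \<omega> \<inter> ?A n) = F n \<omega>) \<and>
    (\<integral>\<^sup>+\<omega>. F n \<omega> \<partial>P t) = rooted (ball 0 (real n)) t v" ..
  note F = F0[THEN spec, THEN conjunct1] F0[THEN spec, THEN conjunct2, THEN conjunct1]
    F0[THEN spec, THEN conjunct2, THEN conjunct2]
  have all: "AE \<omega> in P t. \<forall>n. mean_inverse_cluster \<phi> v (\<eta> \<omega> \<inter> ?A n) = F n \<omega>"
    using F(2) by (simp add: AE_all_countable)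
  \<comment> \<open>a measurable version of the limit\<close>
  define F' where "F' \<omega> = liminf (\<lambda>n. F n \<omega>)" for \<omega>
  have F'_meas: "F' \<in> borel_measurable (P t)" unfolding F'_def using F(1) by measurable
  have lim: "AE \<omega> in P t. (\<lambda>n. F n \<omega>) \<longlonglongrightarrow> mean_inverse_cluster \<phi> v (\<eta> \<omega>)"
    using all AE_space
  proof eventually_elim
    case (elim \<omega>)
    have "(\<lambda>n. mean_inverse_cluster \<phi> v (\<eta> \<omega> \<inter> ?A n)) \<longlonglongrightarrow> mean_inverse_cluster \<phi> v (\<eta> \<omega>)"
    proof (rule mean_inverse_cluster_tendsto)
      show "countable (\<eta> \<omega>)" using countable_points[OF t elim(2)] .
      show "incseq (\<lambda>n. \<eta> \<omega> \<inter> ?A n)" by (auto simp: incseq_def)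
      show "(\<Union>n. \<eta> \<omega> \<inter> ?A n) = \<eta> \<omega>"
      proof -
        have "\<exists>n. z \<in> ?A n" for z using reals_Archimedean2[of "norm (fst z)"] by (cases z) auto
        then show ?thesis by auto
      qed
    qed
    then show ?case using elim(1) by simp
  qed
  have F'_eq: "AE \<omega> in P t. F' \<omega> = mean_inverse_cluster \<phi> v (\<eta> \<omega>)"
    using lim by eventually_elim (simp add: F'_def lim_imp_Liminf)
  have "(\<lambda>n. \<integral>\<^sup>+\<omega>. F n \<omega> \<partial>P t) \<longlonglongrightarrow> (\<integral>\<^sup>+\<omega>. F' \<omega> \<partial>P t)"
  proof (rule nn_integral_dominated_convergence[where w = "\<lambda>_. 1"])
    show "AE \<omega> in P t. F n \<omega> \<le> 1" for n
      using F(2)[of n] by eventually_elim (metis mean_inverse_cluster_le_1)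
    show "AE \<omega> in P t. (\<lambda>n. F n \<omega>) \<longlonglongrightarrow> F' \<omega>"
      using lim F'_eq by eventually_elim simp
  qed (use F F'_meas in \<open>simp_all add: emeasure_space_1\<close>)
  also have "(\<integral>\<^sup>+\<omega>. F' \<omega> \<partial>P t) = expected_inverse_cluster_size \<phi> (P t) \<eta> v"
    unfolding expected_inverse_cluster_size_def mean_inverse_cluster_def[symmetric]
    using F'_eq by (rule nn_integral_cong_AE)
  finally show ?thesis by (simp add: F(3))
qed

lemma expected_le_rooted:
  assumes t: "0 \<le> t"
  shows "expected_inverse_cluster_size \<phi> (P t) \<eta> v \<le> rooted (ball c r) t v"
proof -
  obtain F where F: "AE \<omega> in P t. mean_inverse_cluster \<phi> v (\<eta> \<omega> \<inter> (ball c r \<times> UNIV)) = F \<omega>" "(\<integral>\<^sup>+\<omega>. F \<omega> \<partial>P t) = rooted (ball c r) t v"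
    using rooted_eq_expectation[OF t ball_finite, of v c r] by auto
  have "AE \<omega> in P t. mean_inverse_cluster \<phi> v (\<eta> \<omega>) \<le> F \<omega>"
    using F(1) AE_space
  proof eventually_elim
    case (elim \<omega>)
    have "mean_inverse_cluster \<phi> v (\<eta> \<omega>) \<le> mean_inverse_cluster \<phi> v (\<eta> \<omega> \<inter> (ball c r \<times> UNIV))"
      using countable_points[OF t elim(2)] by (intro mean_inverse_cluster_antimono) auto
    then show ?case using elim by simp
  qed
  then show ?thesis
    unfolding expected_inverse_cluster_size_def mean_inverse_cluster_def[symmetric] F(2)[symmetric]
    by (rule nn_integral_mono_AE)
qed

lemma distr_L_shift: "distr L L (\<lambda>(y, q). (y - c, q)) = L"
proof -
  have "distr lborel lborel (\<lambda>y. y - c) = (lborel :: 'a measure)"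
  proof -
    have "distr lborel lborel (\<lambda>y. y - c) = distr lborel borel ((+) (- c))" by (intro distr_cong) auto
    then show ?thesis by (simp only: lborel_distr_plus)
  qed
  moreover have "distr Q Q (\<lambda>q. q) = Q" by (rule distr_id)
  ultimately have "L = distr lborel lborel (\<lambda>y. y - c) \<Otimes>\<^sub>M distr Q Q (\<lambda>q. q)" by simp
  also have "\<dots> = distr L L (\<lambda>(y, q). (y - c, q))"
    by (rule pair_measure_distr) (auto simp: \<open>distr Q Q (\<lambda>q. q) = Q\<close> Q.sigma_finite_measure_axioms)
  finally show ?thesis by simp
qed

text \<open>
  Shifting all points by \<open>- x\<close> preserves \<open>\<phi>\<close> and moves the root to the origin.
\<close>

lemma rooted_shift: "rooted (ball c r) t (x, p) = rooted (ball (c - x) r) t (0, p)"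
proof -
  let ?T = "\<lambda>(y, q). (y - x, q)"
  let ?\<mu> = "win (ball c r)" and ?\<mu>' = "win (ball (c - x) r)"
  interpret m: finite_connection_model ?\<mu> \<phi> by (rule connection_model_win[OF ball_finite])
  interpret m': finite_connection_model ?\<mu>' \<phi> by (rule connection_model_win[OF ball_finite])
  have T_L: "?T \<in> L \<rightarrow>\<^sub>M L" by measurable
  then have T: "?T \<in> ?\<mu> \<rightarrow>\<^sub>M ?\<mu>'" by (simp cong: measurable_cong_sets)
  have distr_T: "distr ?\<mu> ?\<mu>' ?T = ?\<mu>'"
  proof (rule measure_eqI)
    fix S assume "S \<in> sets (distr ?\<mu> ?\<mu>' ?T)"
    then have S: "S \<in> sets L" by simp
    have S': "?T -` S \<in> sets L" using measurable_sets[OF T_L S] by simp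
    have "emeasure (distr ?\<mu> ?\<mu>' ?T) S = emeasure L (?T -` S \<inter> (ball c r \<times> UNIV))"
      using S S' T by (simp add: emeasure_distr emeasure_win ball_finite)
    also have "?T -` S \<inter> (ball c r \<times> UNIV) = ?T -` (S \<inter> (ball (c - x) r \<times> UNIV))"
      by (auto simp: dist_norm)
    also have "emeasure L \<dots> = emeasure (distr L L ?T) (S \<inter> (ball (c - x) r \<times> UNIV))"
      using S T_L cylinder_sets[OF ball_finite(1)] by (simp add: emeasure_distr sets.Int)
    also have "\<dots> = emeasure ?\<mu>' S" using S by (simp only: distr_L_shift emeasure_win ball_finite)
    finally show "emeasure (distr ?\<mu> ?\<mu>' ?T) S = emeasure ?\<mu>' S" .
  qed simp
  have mass: "m.mass = m'.mass"
    using emeasure_win_space[OF ball_finite(1), of c r] emeasure_win_space[OF ball_finite(1), of "c - x" r]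
    by (cases "r > 0") (simp_all add: measure_def emeasure_ball ball_empty)
  have inv: "inverse_root_cluster \<phi> k (\<lambda>i. ?T (z i)) = inverse_root_cluster \<phi> k z" for k z
  proof -
    have "\<phi> (?T v) (?T w) = \<phi> v w" for v w
      using translation[of "fst v - x" "snd v" "fst w - x" "snd w"] translation[of "fst v" "snd v" "fst w" "snd w"]
      by (simp add: split_beta)
    then show ?thesis by (simp add: inverse_root_cluster_def edge_prob_def)
  qed
  have "(\<integral>\<^sup>+z. ennreal (inverse_root_cluster \<phi> k (z(k := (0, p)))) \<partial>m'.power_measure {..<k})
     = (\<integral>\<^sup>+z. ennreal (inverse_root_cluster \<phi> k (z(k := (x, p)))) \<partial>m.power_measure {..<k})" for k
  proof -
    have meas: "(\<lambda>z. ennreal (inverse_root_cluster \<phi> k (z(k := (0, p))))) \<in> borel_measurable (m'.power_measure {..<k})"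
      using measurable_compose[OF measurable_Pair1' m'.measurable_rooted_mean_pair, of "(0, p)"] by simp
    have map: "(\<lambda>z. \<lambda>i\<in>{..<k}. ?T (z i)) \<in> m.power_measure {..<k} \<rightarrow>\<^sub>M m'.power_measure {..<k}"
    proof (rule measurable_restrict)
      fix i assume i: "i \<in> {..<k}"
      show "(\<lambda>z. ?T (z i)) \<in> m.power_measure {..<k} \<rightarrow>\<^sub>M ?\<mu>'"
        using measurable_compose[OF measurable_component_singleton[OF i, of "\<lambda>_. ?\<mu>"] T] .
    qed
    have "(\<integral>\<^sup>+z. ennreal (inverse_root_cluster \<phi> k (z(k := (0, p)))) \<partial>m'.power_measure {..<k})
      = (\<integral>\<^sup>+z. ennreal (inverse_root_cluster \<phi> k (z(k := (0, p)))) \<partial>distr (m.power_measure {..<k}) (m'.power_measure {..<k}) (\<lambda>z. \<lambda>i\<in>{..<k}. ?T (z i)))"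
      using distr_PiM_map[OF m.sigma_finite_measure_axioms m'.sigma_finite_measure_axioms finite_lessThan T distr_T, of k] by simp
    also have "\<dots> = (\<integral>\<^sup>+z. ennreal (inverse_root_cluster \<phi> k ((\<lambda>i\<in>{..<k}. ?T (z i))(k := (0, p)))) \<partial>m.power_measure {..<k})"
      using meas by (simp add: nn_integral_distr[OF map])
    also have "\<dots> = (\<integral>\<^sup>+z. ennreal (inverse_root_cluster \<phi> k (z(k := (x, p)))) \<partial>m.power_measure {..<k})"
    proof (intro nn_integral_cong)
      fix z
      have "inverse_root_cluster \<phi> k ((\<lambda>i\<in>{..<k}. ?T (z i))(k := (0, p))) = inverse_root_cluster \<phi> k (\<lambda>i. ?T ((z(k := (x, p))) i))"
        unfolding inverse_root_cluster_def
        by (intro m.bernoulli_expectation_edge_prob_cong) (auto simp: less_Suc_eq)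
      then show "ennreal (inverse_root_cluster \<phi> k ((\<lambda>i\<in>{..<k}. ?T (z i))(k := (0, p)))) = ennreal (inverse_root_cluster \<phi> k (z(k := (x, p))))"
        by (simp only: inv)
    qed
    finally show ?thesis .
  qed
  then show ?thesis unfolding m.rooted_mean_def m'.rooted_mean_def mass by simp
qed

lemma measurable_rooted: "(\<lambda>v. rooted (ball c r) t v) \<in> borel_measurable L"
proof -
  interpret finite_connection_model "win (ball c r)" \<phi> by (rule connection_model_win[OF ball_finite])
  show ?thesis using measurable_rooted_mean[of t] measurable_cong_sets[OF sets_win refl] by blast
qed

lemma measurable_rooted_mark: "(\<lambda>p. rooted (ball c r) t (x, p)) \<in> borel_measurable Q"
  using measurable_compose[OF measurable_Pair1'[of x lborel Q] measurable_rooted] by simp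

section \<open>The cluster density as a limit over windows\<close>

text \<open>
  The mean over the mark of a root at the origin, if only points with position in the ball
  of radius \<open>r\<close> around \<open>c\<close> are present. By \<open>rooted_shift\<close>, moving the ball is equivalent to moving the root.
\<close>

definition mean_rooted :: "'a \<Rightarrow> real \<Rightarrow> real \<Rightarrow> ennreal" where
  "mean_rooted c r t = (\<integral>\<^sup>+p. rooted (ball c r) t (0, p) \<partial>Q)"

lemma mean_rooted_le_1: "0 \<le> t \<Longrightarrow> mean_rooted c r t \<le> 1"
proof -
  assume t: "0 \<le> t"
  have "mean_rooted c r t \<le> (\<integral>\<^sup>+p. 1 \<partial>Q)"
    unfolding mean_rooted_def using rooted_le_1[OF t ball_finite] by (intro nn_integral_mono)
  then show ?thesis using Q.emeasure_space_1 by simp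
qed

lemma mean_rooted_antimono: "0 \<le> t \<Longrightarrow> ball c r \<subseteq> ball c' r' \<Longrightarrow> mean_rooted c' r' t \<le> mean_rooted c r t"
  unfolding mean_rooted_def by (intro nn_integral_mono rooted_antimono ball_finite)

lemma ennreal_cluster_density:
  assumes t: "0 \<le> t"
  shows "ennreal (cluster_density \<phi> Q (P t) \<eta>) = (\<integral>\<^sup>+p. expected_inverse_cluster_size \<phi> (P t) \<eta> (0, p) \<partial>Q)"
proof -
  have "(\<integral>\<^sup>+p. expected_inverse_cluster_size \<phi> (P t) \<eta> (0, p) \<partial>Q) \<le> (\<integral>\<^sup>+p. 1 \<partial>Q)"
    using expected_inverse_cluster_size_le_1[OF prob_space_P[OF t]] by (intro nn_integral_mono)
  also have "\<dots> < \<infinity>" using Q.emeasure_space_1 by simp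
  finally show ?thesis unfolding cluster_density_def by simp
qed

lemma cluster_density_le_mean_rooted:
  assumes t: "0 \<le> t" shows "ennreal (cluster_density \<phi> Q (P t) \<eta>) \<le> mean_rooted c r t"
  unfolding ennreal_cluster_density[OF t] mean_rooted_def by (intro nn_integral_mono expected_le_rooted[OF t])

lemma mean_rooted_tendsto:
  assumes t: "0 \<le> t"
  shows "(\<lambda>n. mean_rooted 0 (real n) t) \<longlonglongrightarrow> ennreal (cluster_density \<phi> Q (P t) \<eta>)"
  unfolding ennreal_cluster_density[OF t] mean_rooted_def
proof (rule nn_integral_dominated_convergence[where w = "\<lambda>_. 1"])
  show "(\<lambda>p. expected_inverse_cluster_size \<phi> (P t) \<eta> (0, p)) \<in> borel_measurable Q"
    by (rule borel_measurable_LIMSEQ_order[OF rooted_tendsto[OF t]]) (rule measurable_rooted_mark)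
  show "(\<integral>\<^sup>+p. 1 \<partial>Q) < \<infinity>" using Q.emeasure_space_1 by simp
qed (use rooted_le_1[OF t ball_finite] rooted_tendsto[OF t] measurable_rooted_mark in auto)

abbreviation window_clusters :: "real \<Rightarrow> real \<Rightarrow> real" where
  "window_clusters r t \<equiv> finite_connection_model.cluster_number (win (ball 0 r)) \<phi> t"

abbreviation vol :: "'a \<Rightarrow> real \<Rightarrow> real" where "vol c r \<equiv> measure lborel (ball c r)"

lemma emeasure_ball_vol: "emeasure lborel (ball (0::'a) r) = ennreal (vol 0 r)"
  using ball_finite(2)[of 0 r] by (simp add: emeasure_eq_ennreal_measure)

lemma vol_eq: "0 \<le> r \<Longrightarrow> vol 0 r = unit_ball_vol (DIM('a)) * r ^ DIM('a)"
  by (simp add: measure_def emeasure_ball)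

lemma nn_integral_win:
  assumes f: "f \<in> borel_measurable L"
  shows "(\<integral>\<^sup>+v. f v \<partial>win (ball 0 r)) = (\<integral>\<^sup>+x. indicator (ball 0 r) x * (\<integral>\<^sup>+p. f (x, p) \<partial>Q) \<partial>lborel)"
proof -
  note f[measurable]
  have cyl: "ball (0::'a) r \<times> UNIV \<in> sets L" using cylinder_sets[OF ball_finite(1)] .
  have "(\<integral>\<^sup>+v. f v \<partial>win (ball 0 r)) = (\<integral>\<^sup>+v. indicator (ball 0 r \<times> UNIV) v * f v \<partial>L)"
    unfolding win_def using cyl f by (intro nn_integral_density borel_measurable_indicator)
  also have "\<dots> = (\<integral>\<^sup>+x. \<integral>\<^sup>+p. indicator (ball 0 r \<times> UNIV) (x, p) * f (x, p) \<partial>Q \<partial>lborel)"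
    using cyl f by (intro Q.nn_integral_fst[symmetric] borel_measurable_times_ennreal borel_measurable_indicator)
  also have "\<dots> = (\<integral>\<^sup>+x. indicator (ball 0 r) x * (\<integral>\<^sup>+p. f (x, p) \<partial>Q) \<partial>lborel)"
  proof (intro nn_integral_cong)
    fix x :: 'a
    have [measurable]: "(\<lambda>p. f (x, p)) \<in> borel_measurable Q" by measurable
    have "(\<integral>\<^sup>+p. indicator (ball 0 r \<times> UNIV) (x, p) * f (x, p) \<partial>Q) = (\<integral>\<^sup>+p. indicator (ball 0 r) x * f (x, p) \<partial>Q)"
      by (intro nn_integral_cong) (simp add: indicator_def)
    then show "(\<integral>\<^sup>+p. indicator (ball 0 r \<times> UNIV) (x, p) * f (x, p) \<partial>Q) = indicator (ball 0 r) x * (\<integral>\<^sup>+p. f (x, p) \<partial>Q)"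
      by (simp add: nn_integral_cmult)
  qed
  finally show ?thesis .
qed

lemma window_clusters_eq:
  assumes t: "0 \<le> t"
  shows "ennreal (window_clusters r t) = ennreal t * (\<integral>\<^sup>+x. indicator (ball 0 r) x * mean_rooted (- x) r t \<partial>lborel)"
proof -
  interpret finite_connection_model "win (ball 0 r)" \<phi> by (rule connection_model_win[OF ball_finite])
  have "rooted (ball 0 r) t (x, p) = rooted (ball (- x) r) t (0, p)" for x p using rooted_shift[of 0 r t x p] by simp
  then show ?thesis
    unfolding cluster_number_eq_rooted_mean[OF t] nn_integral_win[OF measurable_rooted] mean_rooted_def by simp
qed

text \<open>
  A root in the window sees at most the whole process, which gives the lower bound. If its distance from the
  boundary is at least \<open>R\<close>, it sees a ball of radius \<open>R\<close> around itself; the other roots contribute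
  at most one each, which gives the upper bound.
\<close>

lemma window_clusters_bounds:
  assumes t: "0 \<le> t" and R: "0 \<le> R" "R < r"
  shows "t * cluster_density \<phi> Q (P t) \<eta> * vol 0 r \<le> window_clusters r t"
    and "window_clusters r t \<le> t * (enn2real (mean_rooted 0 R t) * vol 0 (r - R) + (vol 0 r - vol 0 (r - R)))"
proof -
  interpret finite_connection_model "win (ball 0 r)" \<phi> by (rule connection_model_win[OF ball_finite])
  let ?J = "\<integral>\<^sup>+x. indicator (ball 0 r) x * mean_rooted (- x) r t \<partial>lborel"
  let ?k = "cluster_density \<phi> Q (P t) \<eta>"
  have k: "0 \<le> ?k" by (simp add: cluster_density_def)
  have "ennreal (?k * vol 0 r) = (\<integral>\<^sup>+x. ennreal ?k * indicator (ball (0::'a) r) x \<partial>lborel)"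
    using k by (simp add: nn_integral_cmult_indicator emeasure_ball_vol ennreal_mult)
  also have "\<dots> \<le> ?J"
    using cluster_density_le_mean_rooted[OF t] by (intro nn_integral_mono) (auto simp: indicator_def)
  finally have "ennreal t * ennreal (?k * vol 0 r) \<le> ennreal t * ?J" by (rule mult_left_mono) simp
  then have "ennreal (t * (?k * vol 0 r)) \<le> ennreal (window_clusters r t)"
    using t k by (simp add: window_clusters_eq ennreal_mult)
  then show "t * ?k * vol 0 r \<le> window_clusters r t"
    using cluster_number_nonneg[OF t] by (simp add: mult.assoc)
  have sub: "ball (0::'a) (r - R) \<subseteq> ball 0 r" using R by auto
  let ?m = "mean_rooted 0 R t"
  have m: "?m < \<infinity>" using mean_rooted_le_1[OF t, of 0 R] by (auto intro: le_less_trans)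
  have "?J \<le> (\<integral>\<^sup>+x. ?m * indicator (ball 0 (r - R)) x + indicator (ball (0::'a) r - ball 0 (r - R)) x \<partial>lborel)"
  proof (intro nn_integral_mono)
    fix x :: 'a
    show "indicator (ball 0 r) x * mean_rooted (- x) r t \<le> ?m * indicator (ball 0 (r - R)) x + indicator (ball 0 r - ball 0 (r - R)) x"
    proof (cases "x \<in> ball 0 (r - R)")
      case True
      have "ball 0 R \<subseteq> ball (- x) r"
      proof
        fix y :: 'a assume "y \<in> ball 0 R"
        then have "norm (- x - y) < r" using True norm_triangle_ineq4[of "- x" y] by simp
        then show "y \<in> ball (- x) r" by (simp add: dist_norm)
      qed
      then have "mean_rooted (- x) r t \<le> ?m" by (rule mean_rooted_antimono[OF t])
      then show ?thesis using True sub by (auto simp: indicator_def)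
    next
      case False
      then show ?thesis using mean_rooted_le_1[OF t, of "- x" r] by (auto simp: indicator_def)
    qed
  qed
  also have "\<dots> = ?m * ennreal (vol 0 (r - R)) + emeasure lborel (ball (0::'a) r - ball 0 (r - R))"
    by (subst nn_integral_add) (auto intro!: borel_measurable_times_ennreal borel_measurable_indicator
        simp: nn_integral_cmult_indicator emeasure_ball_vol)
  also have "emeasure lborel (ball (0::'a) r - ball 0 (r - R)) = ennreal (vol 0 r - vol 0 (r - R))"
    using sub by (subst emeasure_Diff) (auto simp: emeasure_ball_vol ennreal_minus)
  also have "?m * ennreal (vol 0 (r - R)) + ennreal (vol 0 r - vol 0 (r - R)) = ennreal (enn2real ?m * vol 0 (r - R) + (vol 0 r - vol 0 (r - R)))"
  proof -
    have "0 \<le> vol 0 r - vol 0 (r - R)"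
      using measure_mono_fmeasurable[OF sub, of lborel] by (simp add: fmeasurable_def emeasure_ball_vol)
    then show ?thesis using m by (simp add: ennreal_mult)
  qed
  finally have J: "?J \<le> ennreal (enn2real ?m * vol 0 (r - R) + (vol 0 r - vol 0 (r - R)))" .
  have "0 \<le> enn2real ?m * vol 0 (r - R) + (vol 0 r - vol 0 (r - R))"
    using measure_mono_fmeasurable[OF sub, of lborel] by (simp add: fmeasurable_def emeasure_ball_vol)
  then have "ennreal (window_clusters r t) \<le> ennreal (t * (enn2real ?m * vol 0 (r - R) + (vol 0 r - vol 0 (r - R))))"
    unfolding window_clusters_eq[OF t] using J t by (simp add: ennreal_mult mult_left_mono)
  then show "window_clusters r t \<le> t * (enn2real ?m * vol 0 (r - R) + (vol 0 r - vol 0 (r - R)))"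
    using t \<open>0 \<le> enn2real ?m * vol 0 (r - R) + (vol 0 r - vol 0 (r - R))\<close> by (subst (asm) ennreal_le_iff) auto
qed

lemma vol_pos: "0 < r \<Longrightarrow> 0 < vol 0 r"
  by (simp add: vol_eq)

text \<open>
  In the window of radius \<open>n\<^sup>2\<close>, the boundary layer of width \<open>n\<close> has an asymptotically negligible share
  of the volume, while a ball of radius \<open>n\<close> exhausts the space.
\<close>

lemma window_density_tendsto:
  assumes t: "0 \<le> t"
  shows "(\<lambda>n. window_clusters ((real n)\<^sup>2) t / vol 0 ((real n)\<^sup>2)) \<longlonglongrightarrow> t * cluster_density \<phi> Q (P t) \<eta>"
proof (rule tendsto_sandwich)
  let ?k = "cluster_density \<phi> Q (P t) \<eta>" and ?d = "DIM('a)"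
  let ?m = "\<lambda>n. enn2real (mean_rooted 0 (real n) t)"
  let ?up = "\<lambda>n. t * (?m n * (1 - 1 / real n) ^ ?d + (1 - (1 - 1 / real n) ^ ?d))"
  show "(\<lambda>n. t * ?k) \<longlonglongrightarrow> t * ?k" by simp
  have inv: "(\<lambda>n. 1 / real n) \<longlonglongrightarrow> 0" by (rule lim_1_over_n)
  have m: "?m \<longlonglongrightarrow> ?k"
    using tendsto_enn2real[OF mean_rooted_tendsto[OF t]] by (simp add: cluster_density_def)
  have "?up \<longlonglongrightarrow> t * (?k * (1 - 0) ^ ?d + (1 - (1 - 0) ^ ?d))"
    by (intro tendsto_mult tendsto_add tendsto_diff tendsto_power tendsto_const inv m)
  then show "?up \<longlonglongrightarrow> t * ?k" by simp
  have ratio: "vol 0 ((real n)\<^sup>2 - real n) = (1 - 1 / real n) ^ ?d * vol 0 ((real n)\<^sup>2)" "real n < (real n)\<^sup>2" "0 < vol 0 ((real n)\<^sup>2)" if "2 \<le> n" for n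
  proof -
    show lt: "real n < (real n)\<^sup>2" using that by (simp add: power2_eq_square)
    show "0 < vol 0 ((real n)\<^sup>2)" using that by (intro vol_pos) simp
    have "(real n)\<^sup>2 - real n = (1 - 1 / real n) * (real n)\<^sup>2" using that by (simp add: field_simps power2_eq_square)
    then have "((real n)\<^sup>2 - real n) ^ ?d = (1 - 1 / real n) ^ ?d * (real n)\<^sup>2 ^ ?d"
      by (simp only: power_mult_distrib)
    then show "vol 0 ((real n)\<^sup>2 - real n) = (1 - 1 / real n) ^ ?d * vol 0 ((real n)\<^sup>2)"
      using vol_eq[of "(real n)\<^sup>2 - real n"] vol_eq[of "(real n)\<^sup>2"] lt by simp
  qed
  show "eventually (\<lambda>n. t * ?k \<le> window_clusters ((real n)\<^sup>2) t / vol 0 ((real n)\<^sup>2)) sequentially"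
    using eventually_ge_at_top[of 2]
  proof eventually_elim
    case (elim n)
    then show ?case using window_clusters_bounds(1)[OF t _ ratio(2)[OF elim]] ratio(3)[OF elim] by (simp add: le_divide_eq)
  qed
  show "eventually (\<lambda>n. window_clusters ((real n)\<^sup>2) t / vol 0 ((real n)\<^sup>2) \<le> ?up n) sequentially"
    using eventually_ge_at_top[of 2]
  proof eventually_elim
    case (elim n)
    have "window_clusters ((real n)\<^sup>2) t \<le> ?up n * vol 0 ((real n)\<^sup>2)"
      using window_clusters_bounds(2)[OF t _ ratio(2)[OF elim]] by (simp add: ratio(1)[OF elim] algebra_simps)
    then show ?case using ratio(3)[OF elim] by (simp add: divide_le_eq)
  qed
qed

text \<open>
  Extending the inner integral over the whole space yields, by translation invariance, \<open>d_phi\<close> for each position.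
\<close>

lemma connection_mass_window:
  "enn2real (finite_connection_model.connection_mass (win (ball 0 r)) \<phi>) \<le> enn2real (d_phi \<phi> Q) * vol 0 r"
proof -
  interpret finite_connection_model "win (ball 0 r)" \<phi> by (rule connection_model_win[OF ball_finite])
  interpret pair_sigma_finite "lborel :: 'a measure" Q ..
  have \<phi>_L: "(\<lambda>(v, w). ennreal (\<phi> v w)) \<in> borel_measurable (L \<Otimes>\<^sub>M L)"
  proof -
    have "sets (L \<Otimes>\<^sub>M L) = sets (borel \<Otimes>\<^sub>M borel)" by (intro sets_pair_measure_cong) (simp_all only: sets_L)
    then have "(\<lambda>(v, w). \<phi> v w) \<in> borel_measurable (L \<Otimes>\<^sub>M L)"
      using meas_\<phi> measurable_cong_sets[OF _ refl] by blast
    then show ?thesis by (simp add: split_beta)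
  qed
  have \<phi>_meas[measurable (raw)]: "(\<lambda>x. ennreal (\<phi> (f x) (g x))) \<in> borel_measurable M"
    if "f \<in> M \<rightarrow>\<^sub>M L" "g \<in> M \<rightarrow>\<^sub>M L" for f g and M :: "'z measure"
    using measurable_compose[OF measurable_Pair[OF that] \<phi>_L] by simp
  have L: "sigma_finite_measure L" by (rule sigma_finite_pair_measure) (rule sigma_finite_lborel, rule Q.sigma_finite_measure_axioms)
  have inner: "(\<integral>\<^sup>+w. ennreal (\<phi> (x, p) w) \<partial>L) = (\<integral>\<^sup>+q. \<integral>\<^sup>+y. ennreal (\<phi> (0, p) (y, q)) \<partial>lborel \<partial>Q)" for x p
  proof -
    have "(\<integral>\<^sup>+w. ennreal (\<phi> (x, p) w) \<partial>L) = (\<integral>\<^sup>+q. \<integral>\<^sup>+y. ennreal (\<phi> (x, p) (y, q)) \<partial>lborel \<partial>Q)"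
      by (rule nn_integral_snd[symmetric, of "\<lambda>w. ennreal (\<phi> (x, p) w)", simplified])
    also have "\<dots> = (\<integral>\<^sup>+q. \<integral>\<^sup>+y. ennreal (\<phi> (0, p) (y, q)) \<partial>lborel \<partial>Q)"
    proof (rule nn_integral_cong)
      fix q
      have [measurable]: "(\<lambda>y. ennreal (\<phi> (0, p) (y, q))) \<in> borel_measurable borel"
        by (intro \<phi>_meas) (auto intro!: measurable_Pair simp: measurable_lborel1)
      have "(\<integral>\<^sup>+y. ennreal (\<phi> (0, p) (y, q)) \<partial>lborel) = (\<integral>\<^sup>+y. ennreal (\<phi> (0, p) (y, q)) \<partial>distr lborel borel ((+) (- x)))"
        by (simp only: lborel_distr_plus)
      also have "\<dots> = (\<integral>\<^sup>+y. ennreal (\<phi> (0, p) (- x + y, q)) \<partial>lborel)" by (subst nn_integral_distr) auto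
      also have "\<dots> = (\<integral>\<^sup>+y. ennreal (\<phi> (x, p) (y, q)) \<partial>lborel)" by (simp add: translation[of x p])
      finally show "(\<integral>\<^sup>+y. ennreal (\<phi> (x, p) (y, q)) \<partial>lborel) = (\<integral>\<^sup>+y. ennreal (\<phi> (0, p) (y, q)) \<partial>lborel)" ..
    qed
    finally show ?thesis .
  qed
  have d: "d_phi \<phi> Q = (\<integral>\<^sup>+p. \<integral>\<^sup>+q. \<integral>\<^sup>+y. ennreal (\<phi> (0, p) (y, q)) \<partial>lborel \<partial>Q \<partial>Q)"
  proof -
    have "(\<lambda>z. \<integral>\<^sup>+y. ennreal (\<phi> (0, fst z) (y, snd z)) \<partial>lborel) \<in> borel_measurable (Q \<Otimes>\<^sub>M Q)"
      by measurable
    then show ?thesis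
      unfolding d_phi_def split_beta by (subst Q.nn_integral_fst[symmetric]) auto
  qed
  have "connection_mass \<le> (\<integral>\<^sup>+v. \<integral>\<^sup>+w. ennreal (\<phi> v w) \<partial>L \<partial>win (ball 0 r))"
    unfolding connection_mass_def
  proof (intro nn_integral_mono)
    fix v
    have [measurable]: "(\<lambda>w. ennreal (\<phi> v w)) \<in> borel_measurable L"
      using measurable_compose[OF measurable_Pair1'[of v L L] \<phi>_L] by (simp add: space_pair_measure)
    have "(\<integral>\<^sup>+w. ennreal (\<phi> v w) \<partial>win (ball 0 r)) = (\<integral>\<^sup>+w. indicator (ball 0 r \<times> UNIV) w * ennreal (\<phi> v w) \<partial>L)"
      unfolding win_def using cylinder_sets[OF ball_finite(1)] by (intro nn_integral_density) auto
    also have "\<dots> \<le> (\<integral>\<^sup>+w. ennreal (\<phi> v w) \<partial>L)" by (intro nn_integral_mono) (auto simp: indicator_def)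
    finally show "(\<integral>\<^sup>+w. ennreal (\<phi> v w) \<partial>win (ball 0 r)) \<le> (\<integral>\<^sup>+w. ennreal (\<phi> v w) \<partial>L)" .
  qed
  also have "\<dots> = (\<integral>\<^sup>+x. indicator (ball 0 r) x * (\<integral>\<^sup>+p. \<integral>\<^sup>+w. ennreal (\<phi> (x, p) w) \<partial>L \<partial>Q) \<partial>lborel)"
    by (intro nn_integral_win sigma_finite_measure.borel_measurable_nn_integral[OF L] \<phi>_L)
  also have "\<dots> = (\<integral>\<^sup>+x. d_phi \<phi> Q * indicator (ball (0::'a) r) x \<partial>lborel)"
    by (simp only: inner d[symmetric] mult.commute)
  also have "\<dots> = d_phi \<phi> Q * ennreal (vol 0 r)" by (simp add: nn_integral_cmult_indicator emeasure_ball_vol)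
  finally have "enn2real connection_mass \<le> enn2real (d_phi \<phi> Q * ennreal (vol 0 r))"
    using d_phi_finite by (intro enn2real_mono) (auto simp: ennreal_mult_less_top)
  then show ?thesis by (simp add: enn2real_mult)
qed

section \<open>Convexity and differentiability of the cluster density\<close>

text \<open>
  The quadratic term compensates for the edges between pairs of added points.
\<close>

definition compensated :: "real \<Rightarrow> real" where
  "compensated t = t * cluster_density \<phi> Q (P t) \<eta> + enn2real (d_phi \<phi> Q) * t\<^sup>2 / 2"

text \<open>
  The approximating functions \<open>?f n\<close> are convex: what \<open>convex_cluster_number\<close> requires is at
  most the compensating term, by \<open>connection_mass_window\<close>. Convexity is preserved by pointwise limits.
\<close>

lemma convex_compensated: "convex_on {0..} compensated"
proof (rule convex_onI)
  let ?f = "\<lambda>n t. window_clusters ((real n)\<^sup>2) t / vol 0 ((real n)\<^sup>2) + enn2real (d_phi \<phi> Q) * t\<^sup>2 / 2"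
  have cvx: "convex_on {0..} (?f n)" if n: "1 \<le> n" for n
  proof -
    let ?r = "(real n)\<^sup>2"
    interpret finite_connection_model "win (ball 0 ?r)" \<phi> by (rule connection_model_win[OF ball_finite])
    have v: "0 < vol 0 ?r" using n by (intro vol_pos) simp
    let ?D = "enn2real connection_mass"
    have "?D / vol 0 ?r \<le> enn2real (d_phi \<phi> Q)" using connection_mass_window[of ?r] v by (simp add: divide_le_eq)
    then have "convex_on {0..} (\<lambda>t. (enn2real (d_phi \<phi> Q) - ?D / vol 0 ?r) / 2 * t\<^sup>2)"
      by (intro convex_on_cmul convex_on_subset[OF convex_power2]) auto
    moreover have "convex_on {0..} (\<lambda>t. (cluster_number t + ?D * t\<^sup>2 / 2) / vol 0 ?r)"
      using v by (intro convex_on_cdiv convex_cluster_number) auto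
    ultimately have "convex_on {0..} (\<lambda>t. (cluster_number t + ?D * t\<^sup>2 / 2) / vol 0 ?r + (enn2real (d_phi \<phi> Q) - ?D / vol 0 ?r) / 2 * t\<^sup>2)"
      by (intro convex_on_add)
    moreover have "(\<lambda>t. (cluster_number t + ?D * t\<^sup>2 / 2) / vol 0 ?r + (enn2real (d_phi \<phi> Q) - ?D / vol 0 ?r) / 2 * t\<^sup>2) = ?f n"
      by (simp add: fun_eq_iff add_divide_distrib diff_divide_distrib left_diff_distrib)
    ultimately show ?thesis by simp
  qed
  have lim: "(\<lambda>n. ?f n t) \<longlonglongrightarrow> compensated t" if "0 \<le> t" for t
    unfolding compensated_def by (intro tendsto_intros window_density_tendsto that)
  fix u x y :: real assume u: "0 < u" "u < 1" and xy: "x \<in> {0..}" "y \<in> {0..}"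
  show "compensated ((1 - u) *\<^sub>R x + u *\<^sub>R y) \<le> (1 - u) * compensated x + u * compensated y"
  proof (rule LIMSEQ_le)
    show "(\<lambda>n. ?f n ((1 - u) *\<^sub>R x + u *\<^sub>R y)) \<longlonglongrightarrow> compensated ((1 - u) *\<^sub>R x + u *\<^sub>R y)"
      using u xy by (intro lim) simp
    show "(\<lambda>n. (1 - u) * ?f n x + u * ?f n y) \<longlonglongrightarrow> (1 - u) * compensated x + u * compensated y"
      using xy by (intro tendsto_add tendsto_mult_left lim) auto
    show "\<exists>N. \<forall>n\<ge>N. ?f n ((1 - u) *\<^sub>R x + u *\<^sub>R y) \<le> (1 - u) * ?f n x + u * ?f n y"
    proof (intro exI[of _ 1] allI impI)
      fix n :: nat assume n: "1 \<le> n"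
      show "?f n ((1 - u) *\<^sub>R x + u *\<^sub>R y) \<le> (1 - u) * ?f n x + u * ?f n y"
        using u xy by (intro convex_onD[OF cvx[OF n]]) auto
    qed
  qed
qed simp

lemma compensated_second_difference:
  assumes t: "0 < t" and \<delta>: "0 < \<delta>" "\<delta> \<le> 1/2"
  shows "compensated (t + t * \<delta> ^ 3) + compensated (t - t * \<delta> ^ 3) - 2 * compensated t
     \<le> (640 + enn2real (d_phi \<phi> Q) * t) * \<delta> * (t * \<delta> ^ 3)"
proof -
  let ?g = "\<lambda>t. t * cluster_density \<phi> Q (P t) \<eta>" and ?d = "enn2real (d_phi \<phi> Q)"
  let ?p = "t * (1 + \<delta> ^ 3)" and ?q = "t * (1 - \<delta> ^ 3)"
  let ?h = "\<lambda>n t. window_clusters ((real n)\<^sup>2) t / vol 0 ((real n)\<^sup>2)"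
  have d3: "\<delta> ^ 3 \<le> 1" using \<delta> by (intro power_le_one) auto
  have pq: "0 \<le> ?p" "0 \<le> ?q" using t \<delta> d3 by simp_all
  have a: "?g ?p + ?g ?q - 2 * ?g t \<le> 640 * t * \<delta> ^ 4"
  proof (rule LIMSEQ_le)
    show "(\<lambda>n. ?h n ?p + ?h n ?q - 2 * ?h n t) \<longlonglongrightarrow> ?g ?p + ?g ?q - 2 * ?g t"
      using pq t by (intro tendsto_add tendsto_diff tendsto_mult_left window_density_tendsto) auto
    show "(\<lambda>n. 640 * t * \<delta> ^ 4) \<longlonglongrightarrow> 640 * t * \<delta> ^ 4" by simp
    show "\<exists>N. \<forall>n\<ge>N. ?h n ?p + ?h n ?q - 2 * ?h n t \<le> 640 * t * \<delta> ^ 4"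
    proof (intro exI[of _ 1] allI impI)
      fix n :: nat assume n: "1 \<le> n"
      let ?r = "(real n)\<^sup>2"
      interpret finite_connection_model "win (ball 0 ?r)" \<phi> by (rule connection_model_win[OF ball_finite])
      have v: "0 < vol 0 ?r" using n by (intro vol_pos) simp
      have mass: "mass = vol 0 ?r" using emeasure_win_space[OF ball_finite(1), of 0 ?r] by (simp add: measure_def)
      have "(cluster_number ?p + cluster_number ?q - 2 * cluster_number t) / vol 0 ?r \<le> 640 * vol 0 ?r * t * \<delta> ^ 4 / vol 0 ?r"
        using cluster_number_second_difference[OF t \<delta>] v unfolding mass by (intro divide_right_mono) auto
      then show "?h n ?p + ?h n ?q - 2 * ?h n t \<le> 640 * t * \<delta> ^ 4"
        using v by (simp add: add_divide_distrib diff_divide_distrib)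
    qed
  qed
  have b: "?p\<^sup>2 + ?q\<^sup>2 - 2 * t\<^sup>2 = 2 * t\<^sup>2 * \<delta> ^ 6"
    by (simp add: power2_eq_square algebra_simps eval_nat_numeral)
  have c: "?d * (t\<^sup>2 * \<delta> ^ 6) \<le> ?d * (t\<^sup>2 * \<delta> ^ 4)"
    using \<delta> by (intro mult_left_mono power_decreasing) auto
  have "compensated ?p + compensated ?q - 2 * compensated t = (?g ?p + ?g ?q - 2 * ?g t) + ?d / 2 * (?p\<^sup>2 + ?q\<^sup>2 - 2 * t\<^sup>2)"
    unfolding compensated_def by (simp only: right_diff_distrib distrib_left times_divide_eq_left)
  also have "\<dots> \<le> 640 * t * \<delta> ^ 4 + ?d * (t\<^sup>2 * \<delta> ^ 4)" using a c unfolding b by simp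
  also have "\<dots> = (640 + ?d * t) * \<delta> * (t * \<delta> ^ 3)" by (simp add: algebra_simps power2_eq_square eval_nat_numeral)
  finally show ?thesis by (simp add: distrib_left right_diff_distrib)
qed

lemma compensated_smooth: "compensated C1_differentiable_on {0<..}"
proof (rule C1_differentiable_on_convex_second_difference)
  show "convex_on {0<..} compensated" using convex_compensated by (rule convex_on_subset) auto
  fix t \<epsilon> :: real assume t: "0 < t" and \<epsilon>: "0 < \<epsilon>"
  let ?K = "640 + enn2real (d_phi \<phi> Q) * t"
  have K: "0 < ?K" using t by (simp add: add_pos_nonneg)
  \<comment> \<open>chosen such that the bound in \<open>compensated_second_difference\<close> is at most \<open>\<epsilon> * s\<close>\<close>
  define \<delta> where "\<delta> = min (1/2) (\<epsilon> / ?K)"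
  have \<delta>: "0 < \<delta>" "\<delta> \<le> 1/2" unfolding \<delta>_def using \<epsilon> K by (simp_all only: min_less_iff_conj min.cobounded1 divide_pos_pos)
  have "\<delta> \<le> \<epsilon> / ?K" by (simp add: \<delta>_def)
  then have \<delta>_le: "?K * \<delta> \<le> \<epsilon>" using K by (simp only: pos_le_divide_eq mult.commute)
  have d3: "\<delta> ^ 3 < 1" using \<delta> by (intro power_less_one_iff[THEN iffD2]) auto
  show "\<exists>s>0. s < t - 0 \<and> compensated (t + s) + compensated (t - s) - 2 * compensated t \<le> \<epsilon> * s"
  proof (intro exI[of _ "t * \<delta> ^ 3"] conjI)
    show "0 < t * \<delta> ^ 3" "t * \<delta> ^ 3 < t - 0" using t \<delta> d3 by simp_all
    have "?K * \<delta> * (t * \<delta> ^ 3) \<le> \<epsilon> * (t * \<delta> ^ 3)" using \<delta>_le \<delta> t by (intro mult_right_mono) auto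
    then show "compensated (t + t * \<delta> ^ 3) + compensated (t - t * \<delta> ^ 3) - 2 * compensated t \<le> \<epsilon> * (t * \<delta> ^ 3)"
      using compensated_second_difference[OF t \<delta>] by linarith
  qed
qed

lemma compensated_right_differentiable: "compensated differentiable (at_right 0)"
proof (rule convex_on_right_differentiable[OF convex_compensated])
  fix t :: real assume t: "0 < t"
  have "0 \<le> cluster_density \<phi> Q (P t) \<eta>" by (simp add: cluster_density_def)
  then show "0 \<le> (compensated t - compensated 0) / (t - 0)"
    using t by (simp add: compensated_def)
qed

end

theorem theorem11p6:
  fixes Q :: "'m::polish_space measure"
    and \<phi> :: "'a::euclidean_space \<times> 'm \<Rightarrow> 'a \<times> 'm \<Rightarrow> real"
    and P :: "real \<Rightarrow> 'w measure"
    and \<eta> :: "'w \<Rightarrow> ('a \<times> 'm) set"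
  assumes "prob_space Q" and "sets Q = sets borel"
    and "(\<lambda>(v, w). \<phi> v w) \<in> borel_measurable (borel \<Otimes>\<^sub>M borel)"
    and "\<And>v w. 0 \<le> \<phi> v w \<and> \<phi> v w \<le> 1"
    and "\<And>v w. \<phi> v w = \<phi> w v"
    and "\<And>x p y q. \<phi> (x, p) (y, q) = \<phi> (0, p) (y - x, q)"
    and "d_phi \<phi> Q < \<infinity>"
    and "\<And>t. 0 \<le> t \<Longrightarrow> poisson_process (P t) \<eta> (scale_measure (ennreal t) (lborel \<Otimes>\<^sub>M Q))"
  defines "f \<equiv> \<lambda>t. t * cluster_density \<phi> Q (P t) \<eta> + enn2real (d_phi \<phi> Q) * t\<^sup>2 / 2"
  shows "f C1_differentiable_on {0<..} \<and> convex_on {0..} f \<and> f differentiable (at_right 0)"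
proof -
  interpret stationary_connection_model Q \<phi> P \<eta> using assms(1-8) by (rule stationary_connection_model.intro)
  have "f = compensated" by (simp add: f_def compensated_def fun_eq_iff)
  then show ?thesis using compensated_smooth convex_compensated compensated_right_differentiable by simp
qed

end
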